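(* Let $G$ be a minimally 2-rigid graph with $n\geq 3$ vertices and let $M_G$ be its graphic matroid. Then $$2c_2(G)\le \operatorname{nbc}(M_G),$$ where $c_2(G)$ is the 2-realisation number of $G$ and $\operatorname{nbc}(M_G)$ is the number of non-broken circuit bases of $M_G$.
   Context: **Rigidity.** Graphs are finite, simple, undirected, with vertex set $[n]$ and edge set $E$. A framework $(G,p)$ with $p:[n]\to\mathbb{R}^d$ is rigid if every edge-length preserving continuous deformation of the vertices comes from isometries of $\mathbb{R}^d$. $G$ is $d$-rigid if $(G,p)$ is rigid for almost all $p$ (all $p$ in some non-empty Zariski open set), and minimally $d$-rigid if moreover $G-e$ is not $d$-rigid for every edge $e$. **Realisation number.** Let $f_{G,d}:\mathbb{C}^{n\cdot d}\to\mathbb{C}^{E}$, $p\mapsto \frac12\big(\sum_{k=1}^d (p_{i,k}-p_{j,k})^2\big)_{ij\in E}$. Write $p\sim q$ if there are $A\in O(d,\mathbb{C})$ (complex matrices with $A^TA=AA^T=I$) and $x\in\mathbb{C}^d$ with $p_i=Aq_i+x$ for all $i$. For a $d$-rigid graph with $n\ge d+1$, $f_{G,d}^{-1}(f_{G,d}(p))/\!\sim$ has the same finite cardinality for all generic $p\in\mathbb{C}^{n\cdot d}$; this is the $d$-realisation number $c_d(G)$. **nbc-bases.** The graphic matroid $M_G$ is the matroid on $E$ whose circuits are the cycles of $G$. For a matroid $M$ with a fixed total order on its ground set, a broken circuit is a set $C\setminus\{\min C\}$ with $C$ a circuit of $M$; an nbc-basis is a basis containing no broken circuit. The number $\operatorname{nbc}(M)$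 of nbc-bases does not depend on the total order. *)

theory Defs
  imports "HOL-Analysis.Analysis"
begin

section \<open>Graphs and configurations\<close>

text \<open>A graph on \<open>{1..n}\<close> is given by \<open>n\<close> and its set \<open>E\<close> of edges,
  an edge being a two-element set of vertices.\<close>

definition simple_graph :: "nat \<Rightarrow> nat set set \<Rightarrow> bool" where
  "simple_graph n E \<longleftrightarrow> (\<forall>e\<in>E. e \<subseteq> {1..n} \<and> card e = 2)"

text \<open>The space of all maps from \<open>{1..n}\<close> to the \<open>d\<close>-dimensional space over \<open>'a\<close>, where
  \<open>d = CARD('d)\<close>. Maps are normalised to \<open>undefined\<close> outside \<open>{1..n}\<close>, so that equality of
  maps is equality on \<open>{1..n}\<close>.\<close>

definition configs :: "nat \<Rightarrow> (nat \<Rightarrow> 'a ^ 'd) set" where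
  "configs n = {1..n} \<rightarrow>\<^sub>E UNIV"

inductive_set poly_funs :: "nat \<Rightarrow> ((nat \<Rightarrow> 'a::comm_ring_1 ^ 'd) \<Rightarrow> 'a) set" for n :: nat where
  const: "(\<lambda>p. c) \<in> poly_funs n"
| coord: "i \<in> {1..n} \<Longrightarrow> (\<lambda>p. p i $ k) \<in> poly_funs n"
| add: "f \<in> poly_funs n \<Longrightarrow> g \<in> poly_funs n \<Longrightarrow> (\<lambda>p. f p + g p) \<in> poly_funs n"
| mult: "f \<in> poly_funs n \<Longrightarrow> g \<in> poly_funs n \<Longrightarrow> (\<lambda>p. f p * g p) \<in> poly_funs n"

definition zariski_open :: "nat \<Rightarrow> (nat \<Rightarrow> 'a::comm_ring_1 ^ 'd) set \<Rightarrow> bool" where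
  "zariski_open n U \<longleftrightarrow> (\<exists>F \<subseteq> poly_funs n. U = {p \<in> configs n. \<exists>f\<in>F. f p \<noteq> 0})"

definition generically :: "nat \<Rightarrow> ((nat \<Rightarrow> 'a::comm_ring_1 ^ 'd) \<Rightarrow> bool) \<Rightarrow> bool" where
  "generically n P \<longleftrightarrow> (\<exists>U. zariski_open n U \<and> U \<noteq> {} \<and> (\<forall>p\<in>U. P p))"


section \<open>Rigidity\<close>

definition rigid_framework :: "nat \<Rightarrow> nat set set \<Rightarrow> (nat \<Rightarrow> real ^ 'd) \<Rightarrow> bool" where
  "rigid_framework n E p \<longleftrightarrow>
    (\<forall>\<gamma> :: real \<Rightarrow> nat \<Rightarrow> real ^ 'd.
       (\<forall>i\<in>{1..n}. continuous_on {0..1} (\<lambda>t. \<gamma> t i) \<and> \<gamma> 0 i = p i) \<and>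
       (\<forall>t\<in>{0..1}. \<forall>i j. {i, j} \<in> E \<longrightarrow> dist (\<gamma> t i) (\<gamma> t j) = dist (p i) (p j))
     \<longrightarrow> (\<forall>t\<in>{0..1}. \<exists>T :: real ^ 'd \<Rightarrow> real ^ 'd.
            (\<forall>x y. dist (T x) (T y) = dist x y) \<and> (\<forall>i\<in>{1..n}. \<gamma> t i = T (p i))))"

definition rigid :: "'d::finite itself \<Rightarrow> nat \<Rightarrow> nat set set \<Rightarrow> bool" where
  "rigid _ n E \<longleftrightarrow> generically n (\<lambda>p :: nat \<Rightarrow> real ^ 'd. rigid_framework n E p)"

definition minimally_rigid :: "'d::finite itself \<Rightarrow> nat \<Rightarrow> nat set set \<Rightarrow> bool" where
  "minimally_rigid d n E \<longleftrightarrow> rigid d n E \<and> (\<forall>e\<in>E. \<not> rigid d n (E - {e}))"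


section \<open>Realisation numbers\<close>

text \<open>For an edge \<open>e = {i, j}\<close>, the two endpoints are \<open>Min e\<close> and \<open>Max e\<close>; the summand does
  not depend on which is which.\<close>

definition edge_map :: "nat set set \<Rightarrow> (nat \<Rightarrow> complex ^ 'd) \<Rightarrow> nat set \<Rightarrow> complex" where
  "edge_map E p = (\<lambda>e\<in>E. 1 / 2 * (\<Sum>k\<in>UNIV. (p (Min e) $ k - p (Max e) $ k)\<^sup>2))"

text \<open>Note that \<^const>\<open>orthogonal_matrix\<close> over the complex numbers involves the transpose, not the
  conjugate transpose.\<close>

definition congruent_configs :: "nat \<Rightarrow> ((nat \<Rightarrow> complex ^ 'd) \<times> (nat \<Rightarrow> complex ^ 'd)) set" where
  "congruent_configs n = {(p, q). p \<in> configs n \<and> q \<in> configs n \<and>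
     (\<exists>(A :: complex ^ 'd ^ 'd) x. orthogonal_matrix A \<and> (\<forall>i\<in>{1..n}. p i = A *v q i + x))}"

definition realisations ::
    "nat \<Rightarrow> nat set set \<Rightarrow> (nat \<Rightarrow> complex ^ 'd) \<Rightarrow> (nat \<Rightarrow> complex ^ 'd) set set" where
  "realisations n E p = {q \<in> configs n. edge_map E q = edge_map E p} // congruent_configs n"

definition realisation_number :: "'d::finite itself \<Rightarrow> nat \<Rightarrow> nat set set \<Rightarrow> nat" where
  "realisation_number _ n E = (THE c. generically n (\<lambda>p :: nat \<Rightarrow> complex ^ 'd.
     finite (realisations n E p) \<and> card (realisations n E p) = c))"


section \<open>Matroids and nbc-bases\<close>

text \<open>A matroid is represented by its ground set and its circuits; the matroid axioms are not
  part of the type.\<close>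

record 'a matroid =
  ground :: "'a set"
  circuits :: "'a set set"

definition indep :: "'a matroid \<Rightarrow> 'a set \<Rightarrow> bool" where
  "indep M I \<longleftrightarrow> I \<subseteq> ground M \<and> (\<forall>C\<in>circuits M. \<not> C \<subseteq> I)"

definition basis :: "'a matroid \<Rightarrow> 'a set \<Rightarrow> bool" where
  "basis M B \<longleftrightarrow> indep M B \<and> (\<forall>I. indep M I \<and> B \<subseteq> I \<longrightarrow> I = B)"

text \<open>Here \<open>(e, f) \<in> r\<close> means that \<open>e\<close> is less than or equal to \<open>f\<close>.\<close>

definition broken_circuit :: "('a \<times> 'a) set \<Rightarrow> 'a matroid \<Rightarrow> 'a set \<Rightarrow> bool" where
  "broken_circuit r M D \<longleftrightarrow>
    (\<exists>C\<in>circuits M. \<exists>m\<in>C. (\<forall>f\<in>C. (m, f) \<in> r) \<and> D = C - {m})"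

definition nbc_basis :: "('a \<times> 'a) set \<Rightarrow> 'a matroid \<Rightarrow> 'a set \<Rightarrow> bool" where
  "nbc_basis r M B \<longleftrightarrow> basis M B \<and> (\<forall>D. broken_circuit r M D \<longrightarrow> \<not> D \<subseteq> B)"

definition nbc :: "('a \<times> 'a) set \<Rightarrow> 'a matroid \<Rightarrow> nat" where
  "nbc r M = card {B. nbc_basis r M B}"

definition cycle_edges :: "'v list \<Rightarrow> 'v set set" where
  "cycle_edges vs = {{vs ! i, vs ! (Suc i mod length vs)} | i. i < length vs}"

definition graphic_matroid :: "'v set set \<Rightarrow> 'v set matroid" where
  "graphic_matroid E = \<lparr>ground = E,
     circuits = {cycle_edges vs | vs. 3 \<le> length vs \<and> distinct vs \<and> cycle_edges vs \<subseteq> E}\<rparr>"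

end

theory Submission
  imports Defs "HOL-Computational_Algebra.Fundamental_Theorem_Algebra" "HOL-Library.Function_Algebras"
begin

text \<open>In the coordinates \<open>u = x + iy\<close>, \<open>v = x - iy\<close> the squared length of an edge \<open>ij\<close> is
  \<open>(u\<^sub>i - u\<^sub>j) (v\<^sub>i - v\<^sub>j)\<close>. Fixing the lengths, the differences of the \<open>v\<^sub>i\<close> along edges are therefore
  multiples of the reciprocals of the differences of the \<open>u\<^sub>i\<close>, and the realisations are the points of
  a linear section of the reciprocal linear space of the graph. The relations
  attached to circuits reduce every polynomial in the reciprocals to monomials supported on sets
  without broken circuits, so the space of polynomials of degree \<open>k\<close> has dimension about \<open>nbc\<close> times
  \<open>k ^ (n - 1) / (n - 1)!\<close>; comparing with the products of polynomials that separate the points of a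
  nondegenerate fibre and monomials in the defining functions shows that the fibre has at most
  \<open>nbc\<close> points. A generic fibre is nondegenerate by an algebraic version of Sard's theorem. Translations
  and rotations are removed by pinning an edge; the reflection \<open>u \<leftrightarrow> v\<close> remains, and so every
  congruence class accounts for two points.

  Minimal rigidity enters only through \<open>card E = 2 n - 3\<close> and the algebraic independence of the
  squared edge lengths. If they had transcendence degree less than \<open>2 n - 3\<close>, a generic
  framework would have a flex; conversely, \<open>2 n - 3\<close> independent edges leave only
  finitely many realisations and are rigid by themselves, so that minimality leaves no further edge.
  The number of realisations is generically constant by quantifier elimination.\<close>

section \<open>Polynomial functions\<close>

text \<open>The count works with linear algebra alone: only the leading growth of dimensions is
  compared, so errors of order \<open>k ^ (n - 2)\<close> can be discarded throughout. What makes
  this possible is that two numbers agree. A fibre is cut out by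
  \<open>card E - (n - 1) = n - 2\<close> linear dependences among the differences of
  \<open>v\<close> and by the condition of the pinned edge, hence by \<open>n - 1\<close> functions;
  a spanning tree also has \<open>n - 1\<close> edges, so both sides grow like
  \<open>k ^ (n - 1)\<close> and their leading coefficients can be compared. The main obstacle is
  that nondegeneracy is needed at every point of a fibre, not only at the generic point that was
  chosen. The Sard argument must therefore deliver a polynomial in the values of the map, not in its
  argument. Rigidity speaks of real paths and realisations are complex; algebraic independence is
  the notion that can be carried from one side to the other. Polynomials are treated as functions:
  over an infinite field nothing is lost, and restriction to a line supplies the principle of
  identity.\<close>

inductive_set pfun :: "'v set \<Rightarrow> (('v \<Rightarrow> 'a::comm_ring_1) \<Rightarrow> 'a) set" for V :: "'v set" where
  const: "(\<lambda>x. c) \<in> pfun V"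
| var: "v \<in> V \<Longrightarrow> (\<lambda>x. x v) \<in> pfun V"
| add: "f \<in> pfun V \<Longrightarrow> g \<in> pfun V \<Longrightarrow> (\<lambda>x. f x + g x) \<in> pfun V"
| mult: "f \<in> pfun V \<Longrightarrow> g \<in> pfun V \<Longrightarrow> (\<lambda>x. f x * g x) \<in> pfun V"

lemma pfun_mono: "f \<in> pfun V \<Longrightarrow> V \<subseteq> W \<Longrightarrow> f \<in> pfun W"
  by (induction rule: pfun.induct) (auto intro: pfun.intros)

lemma pfun_uminus: "f \<in> pfun V \<Longrightarrow> (\<lambda>x. - f x) \<in> pfun V"
  using pfun.mult[OF pfun.const[of "-1"], of f V] by simp

lemma pfun_diff: "f \<in> pfun V \<Longrightarrow> g \<in> pfun V \<Longrightarrow> (\<lambda>x. f x - g x) \<in> pfun V"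
  using pfun.add[OF _ pfun_uminus, of f V g] by simp

lemma pfun_sum: "(\<And>i. i \<in> I \<Longrightarrow> f i \<in> pfun V) \<Longrightarrow> (\<lambda>x. \<Sum>i\<in>I. f i x) \<in> pfun V"
  by (induction I rule: infinite_finite_induct) (auto intro: pfun.intros)

lemma pfun_prod: "(\<And>i. i \<in> I \<Longrightarrow> f i \<in> pfun V) \<Longrightarrow> (\<lambda>x. \<Prod>i\<in>I. f i x) \<in> pfun V"
  by (induction I rule: infinite_finite_induct) (auto intro: pfun.intros)

lemma pfun_power: "f \<in> pfun V \<Longrightarrow> (\<lambda>x. f x ^ k) \<in> pfun V"
  by (induction k) (auto intro: pfun.intros)

lemma pfun_subst:
  assumes "f \<in> pfun V" "\<And>v. v \<in> V \<Longrightarrow> (\<lambda>x. g x v) \<in> pfun W"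
  shows "(\<lambda>x. f (g x)) \<in> pfun W"
  using assms(1) by induction (auto intro: pfun.intros assms(2))

lemma pfun_cong: "f \<in> pfun V \<Longrightarrow> (\<And>v. v \<in> V \<Longrightarrow> x v = y v) \<Longrightarrow> f x = f y"
  by (induction rule: pfun.induct) auto

text \<open>Along a line a polynomial function of many variables becomes a polynomial in the
  parameter \<open>t\<close>. As such a polynomial has finitely many roots or is zero, this fact
  stands in for the identity theorem in several variables.\<close>

lemma pfun_line:
  fixes f :: "('v \<Rightarrow> 'a::comm_ring_1) \<Rightarrow> 'a"
  assumes "f \<in> pfun V"
  shows "\<exists>q::'a poly. \<forall>t. f (\<lambda>v. x v + t * w v) = poly q t"
  using assms
proof induction
  case (const c)
  show ?case by (rule exI[of _ "[:c:]"]) simp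
next
  case (var v)
  show ?case by (rule exI[of _ "[:x v, w v:]"]) (simp add: algebra_simps)
next
  case (add f g)
  then obtain p q where "\<forall>t. f (\<lambda>v. x v + t * w v) = poly p t" "\<forall>t. g (\<lambda>v. x v + t * w v) = poly q t"
    by blast
  then show ?case by (intro exI[of _ "p + q"]) simp
next
  case (mult f g)
  then obtain p q where "\<forall>t. f (\<lambda>v. x v + t * w v) = poly p t" "\<forall>t. g (\<lambda>v. x v + t * w v) = poly q t"
    by blast
  then show ?case by (intro exI[of _ "p * q"]) simp
qed

lemma pfun_line_nonzero:
  fixes f :: "('v \<Rightarrow> 'a::{idom,ring_char_0}) \<Rightarrow> 'a"
  assumes "f \<in> pfun V" "f (\<lambda>v. x v + s * w v) \<noteq> 0"
  shows "finite {t. f (\<lambda>v. x v + t * w v) = 0}"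
proof -
  obtain q where q: "\<forall>t. f (\<lambda>v. x v + t * w v) = poly q t" using pfun_line[OF assms(1)] by blast
  with assms(2) have "q \<noteq> 0" by auto
  with q show ?thesis using poly_roots_finite[of q] by simp
qed

text \<open>Affine space is irreducible: on the line from \<open>x\<close> (\<open>t = 0\<close>) to
  \<open>y\<close> (\<open>t = 1\<close>) neither function vanishes identically, so each excludes
  finitely many \<open>t\<close>, and an infinite field has some \<open>t\<close> left over.\<close>

lemma pfun_two_nonzero:
  fixes f g :: "('v \<Rightarrow> 'a::{idom,ring_char_0}) \<Rightarrow> 'a"
  assumes "f \<in> pfun V" "g \<in> pfun V" "f x \<noteq> 0" "g y \<noteq> 0"
  shows "\<exists>z. f z \<noteq> 0 \<and> g z \<noteq> 0"
proof -
  define w where "w = (\<lambda>v. y v - x v)"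
  have "finite {t. f (\<lambda>v. x v + t * w v) = 0}"
    by (rule pfun_line_nonzero[OF assms(1), where s = 0]) (use assms in simp)
  moreover have "finite {t. g (\<lambda>v. x v + t * w v) = 0}"
    by (rule pfun_line_nonzero[OF assms(2), where s = 1]) (use assms in \<open>simp add: w_def\<close>)
  ultimately have "finite ({t. f (\<lambda>v. x v + t * w v) = 0} \<union> {t. g (\<lambda>v. x v + t * w v) = 0})" by simp
  then obtain t where "t \<notin> {t. f (\<lambda>v. x v + t * w v) = 0} \<union> {t. g (\<lambda>v. x v + t * w v) = 0}"
    using ex_new_if_finite[OF infinite_UNIV_char_0] by blast
  then show ?thesis by auto
qed

lemma pfun_prod_nonzero:
  fixes f :: "'i \<Rightarrow> ('v \<Rightarrow> 'a::{idom,ring_char_0}) \<Rightarrow> 'a"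
  assumes "finite I" "\<And>i. i \<in> I \<Longrightarrow> f i \<in> pfun V" "\<And>i. i \<in> I \<Longrightarrow> \<exists>x. f i x \<noteq> 0"
  shows "\<exists>x. (\<Prod>i\<in>I. f i x) \<noteq> 0"
  using assms
proof (induction I)
  case (insert i I)
  then obtain x where "(\<Prod>i\<in>I. f i x) \<noteq> 0" by auto
  moreover obtain y where "f i y \<noteq> 0" using insert.prems(2)[of i] by auto
  moreover have "(\<lambda>x. \<Prod>i\<in>I. f i x) \<in> pfun V" using insert by (intro pfun_prod) auto
  ultimately obtain z where "(\<Prod>i\<in>I. f i z) \<noteq> 0 \<and> f i z \<noteq> 0"
    using pfun_two_nonzero[of "\<lambda>x. \<Prod>i\<in>I. f i x" V "f i" x y] insert by auto
  with insert show ?case by (intro exI[of _ z]) auto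
qed auto

text \<open>The coefficients of a product are summed over the whole rectangle of index pairs with
  the test \<open>i + j = k\<close>, so that they remain fixed finite sums of products of
  coefficients.\<close>

lemma sum_conv:
  fixes c c' :: "nat \<Rightarrow> 'a::comm_ring_1"
  shows "(\<Sum>k<m. c k * z ^ k) * (\<Sum>k<m'. c' k * z ^ k)
    = (\<Sum>k<m+m'. (\<Sum>i<m. \<Sum>j<m'. if i + j = k then c i * c' j else 0) * z ^ k)"
proof -
  have "(\<Sum>k<m+m'. (\<Sum>i<m. \<Sum>j<m'. if i + j = k then c i * c' j else 0) * z ^ k)
      = (\<Sum>k<m+m'. \<Sum>i<m. \<Sum>j<m'. if i + j = k then c i * c' j * z ^ k else 0)"
    by (auto simp: sum_distrib_right intro!: sum.cong)
  also have "\<dots> = (\<Sum>i<m. \<Sum>k<m+m'. \<Sum>j<m'. if i + j = k then c i * c' j * z ^ k else 0)"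
    by (rule sum.swap)
  also have "\<dots> = (\<Sum>i<m. \<Sum>j<m'. \<Sum>k<m+m'. if i + j = k then c i * c' j * z ^ k else 0)"
    by (intro sum.cong refl sum.swap)
  also have "\<dots> = (\<Sum>i<m. \<Sum>j<m'. c i * c' j * z ^ (i + j))"
    by (intro sum.cong refl) (auto simp: sum.delta)
  also have "\<dots> = (\<Sum>i<m. \<Sum>j<m'. (c i * z ^ i) * (c' j * z ^ j))"
    by (intro sum.cong refl) (simp add: power_add mult_ac)
  finally show ?thesis by (simp add: sum_product)
qed

text \<open>Sorts a polynomial function by powers of one variable. The coefficients live on
  \<open>V - {v}\<close> and so do not notice the update \<open>x(v := z)\<close>; both quantifier
  elimination and algebraic relations start from this form.\<close>

lemma pfun_expand:
  fixes f :: "('v \<Rightarrow> 'a::comm_ring_1) \<Rightarrow> 'a"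
  assumes "f \<in> pfun V"
  shows "\<exists>m c. (\<forall>k. c k \<in> pfun (V - {v})) \<and> (\<forall>x z. f (x(v := z)) = (\<Sum>k<m. c k x * z ^ k))"
  using assms
proof induction
  case (const c)
  show ?case
    by (rule exI[of _ 1], rule exI[of _ "\<lambda>k x. c"]) (auto intro: pfun.intros)
next
  case (var u)
  show ?case
  proof (cases "u = v")
    case True
    show ?thesis
      by (rule exI[of _ 2], rule exI[of _ "\<lambda>k x. if k = 1 then 1 else 0"])
        (auto intro: pfun.intros simp: True numeral_2_eq_2)
  next
    case False
    show ?thesis
      by (rule exI[of _ 1], rule exI[of _ "\<lambda>k x. x u"]) (use False var in \<open>auto intro: pfun.intros\<close>)
  qed
next
  case (add f g)
  from add.IH(1) obtain m c where
    c: "\<forall>k. c k \<in> pfun (V - {v})" "\<forall>x z. f (x(v := z)) = (\<Sum>k<m. c k x * z ^ k)" by blast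
  from add.IH(2) obtain m' c' where
    c': "\<forall>k. c' k \<in> pfun (V - {v})" "\<forall>x z. g (x(v := z)) = (\<Sum>k<m'. c' k x * z ^ k)" by blast
  define d where "d k x = (if k < m then c k x else 0) + (if k < m' then c' k x else 0)" for k x
  have "d k \<in> pfun (V - {v})" for k
    unfolding d_def using c c'
    by (cases "k < m"; cases "k < m'") (auto intro!: pfun.intros)
  moreover have "f (x(v := z)) + g (x(v := z)) = (\<Sum>k<m+m'. d k x * z ^ k)" for x z
  proof -
    have "(\<Sum>k<m. c k x * z ^ k) = (\<Sum>k<m+m'. (if k < m then c k x else 0) * z ^ k)"
      by (rule sum.mono_neutral_cong_left) auto
    moreover have "(\<Sum>k<m'. c' k x * z ^ k) = (\<Sum>k<m+m'. (if k < m' then c' k x else 0) * z ^ k)"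
      by (rule sum.mono_neutral_cong_left) auto
    ultimately show ?thesis using c c' by (simp add: d_def distrib_right sum.distrib)
  qed
  ultimately show ?case by (intro exI[of _ "m + m'"] exI[of _ d] conjI allI)
next
  case (mult f g)
  from mult.IH(1) obtain m c where
    c: "\<forall>k. c k \<in> pfun (V - {v})" "\<forall>x z. f (x(v := z)) = (\<Sum>k<m. c k x * z ^ k)" by blast
  from mult.IH(2) obtain m' c' where
    c': "\<forall>k. c' k \<in> pfun (V - {v})" "\<forall>x z. g (x(v := z)) = (\<Sum>k<m'. c' k x * z ^ k)" by blast
  define d where "d k x = (\<Sum>i<m. \<Sum>j<m'. if i + j = k then c i x * c' j x else 0)" for k x
  have "d k \<in> pfun (V - {v})" for k
  proof -
    have "(\<lambda>x. if i + j = k then c i x * c' j x else 0) \<in> pfun (V - {v})" for i j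
      using c c' by (cases "i + j = k") (auto intro!: pfun.intros)
    then show ?thesis unfolding d_def by (intro pfun_sum) auto
  qed
  moreover have "f (x(v := z)) * g (x(v := z)) = (\<Sum>k<m+m'. d k x * z ^ k)" for x z
    using c c' sum_conv[of "\<lambda>k. c k x" z m "\<lambda>k. c' k x" m'] by (simp add: d_def)
  ultimately show ?case by (intro exI[of _ "m + m'"] exI[of _ d] conjI allI)
qed

text \<open>The chain rule in its simplest case: if all arguments are stationary, so is every
  polynomial in them. Partial derivatives never have to be defined.\<close>

lemma pfun_deriv_zero:
  fixes P :: "('b \<Rightarrow> 'a::real_normed_field) \<Rightarrow> 'a"
  assumes "P \<in> pfun B" "\<And>b. b \<in> B \<Longrightarrow> ((\<lambda>t. g t b) has_field_derivative 0) (at t0)"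
  shows "((\<lambda>t. P (g t)) has_field_derivative 0) (at t0)"
  using assms(1)
proof induction
  case (add f h)
  then show ?case using DERIV_add by fastforce
next
  case (mult f h)
  then show ?case using DERIV_mult by fastforce
qed (auto intro: assms(2))

lemma pfun_continuous:
  fixes P :: "('b \<Rightarrow> 'a::real_normed_field) \<Rightarrow> 'a"
  assumes "P \<in> pfun B" "\<And>b. b \<in> B \<Longrightarrow> continuous_on S (\<lambda>t. g t b)"
  shows "continuous_on S (\<lambda>t. P (g t))"
  using assms(1) by induction (auto intro: assms(2) continuous_intros)

section \<open>Counting in function spaces\<close>

interpretation fs: vector_space "\<lambda>(c::'a::field) (f::'x \<Rightarrow> 'a) x. c * f x"
  by unfold_locales (auto simp: algebra_simps fun_eq_iff)

lemma sum_fun_apply: "(\<Sum>i\<in>I. f i) x = (\<Sum>i\<in>I. f i x)"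
  by (induction I rule: infinite_finite_induct) auto

lemma sum_fun_eq: "(\<Sum>i\<in>I. f i) = (\<lambda>x. \<Sum>i\<in>I. f i x)"
  by (rule ext) (rule sum_fun_apply)

text \<open>More members than spanning vectors force a relation. Dependence is a property of sets
  and does not see repetitions in an indexed family; two equal members are therefore treated apart,
  with coefficients 1 and -1.\<close>

lemma family_relation:
  fixes g :: "'i \<Rightarrow> 'x \<Rightarrow> 'a::field"
  assumes "finite I" "finite T" "card T < card I" "\<And>i. i \<in> I \<Longrightarrow> g i \<in> fs.span T"
  shows "\<exists>\<kappa>. (\<exists>i\<in>I. \<kappa> i \<noteq> 0) \<and> (\<forall>x. (\<Sum>i\<in>I. \<kappa> i * g i x) = 0)"
proof (cases "inj_on g I")
  case False
  then obtain i j where ij: "i \<in> I" "j \<in> I" "i \<noteq> j" "g i = g j" by (auto simp: inj_on_def)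
  define \<kappa> where "\<kappa> k = (if k = i then 1 else if k = j then -1 else 0 :: 'a)" for k
  have "(\<Sum>k\<in>I. \<kappa> k * g k x) = 0" for x
  proof -
    have "(\<Sum>k\<in>I. \<kappa> k * g k x) = (\<Sum>k\<in>{i,j}. \<kappa> k * g k x)"
      by (rule sum.mono_neutral_right) (use ij assms in \<open>auto simp: \<kappa>_def\<close>)
    also have "\<dots> = 0" using ij by (simp add: \<kappa>_def)
    finally show ?thesis .
  qed
  then show ?thesis using ij by (intro exI[of _ \<kappa>]) (auto simp: \<kappa>_def)
next
  case True
  have "fs.dependent (g ` I)"
  proof (rule ccontr)
    assume "\<not> ?thesis"
    then have "card (g ` I) \<le> card T"
      using fs.independent_span_bound[OF assms(2), of "g ` I"] assms(4) by blast
    with True assms(3) show False by (simp add: card_image)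
  qed
  then obtain u where u: "\<exists>v\<in>g ` I. u v \<noteq> 0" "(\<Sum>v\<in>g ` I. (\<lambda>x. u v * v x)) = 0"
    using fs.dependent_finite[of "g ` I"] assms(1) by auto
  have "(\<Sum>i\<in>I. u (g i) * g i x) = 0" for x
  proof -
    have "(\<Sum>v\<in>g ` I. (\<lambda>x. u v * v x)) x = (\<Sum>v\<in>g ` I. u v * v x)"
      by (rule sum_fun_apply)
    then show ?thesis using u(2) True by (simp add: sum.reindex)
  qed
  then show ?thesis using u(1) by (intro exI[of _ "\<lambda>i. u (g i)"]) auto
qed

lemma fs_span_sum:
  assumes "\<And>i. i \<in> I \<Longrightarrow> f i \<in> fs.span S"
  shows "(\<lambda>x. \<Sum>i\<in>I. c i * f i x) \<in> fs.span S"
proof -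
  have "(\<lambda>x. \<Sum>i\<in>I. c i * f i x) = (\<Sum>i\<in>I. (\<lambda>x. c i * f i x))"
    by (simp add: sum_fun_eq)
  also have "\<dots> \<in> fs.span S"
    by (intro fs.span_sum fs.span_scale assms)
  finally show ?thesis .
qed

text \<open>Each unknown \<open>v\<close> gives a column, a function on \<open>B\<close> extended by
  0, and all columns lie in the span of the unit functions \<open>T\<close>, of which there are at
  most \<open>card B\<close>. A relation among the columns is the vector \<open>w\<close>.\<close>

lemma functionals_kernel:
  fixes L :: "'b \<Rightarrow> 'v \<Rightarrow> 'a::field"
  assumes "finite V" "finite B" "card B < card V"
  shows "\<exists>w. (\<exists>v\<in>V. w v \<noteq> 0) \<and> (\<forall>b\<in>B. (\<Sum>v\<in>V. w v * L b v) = 0)"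
proof -
  define T where "T = (\<lambda>b b'. if b' = b then 1 else 0 :: 'a) ` B"
  have "(\<lambda>b. if b \<in> B then L b v else 0) \<in> fs.span T" for v
  proof -
    have "(\<lambda>b'. \<Sum>b\<in>B. L b v * (if b' = b then 1 else 0)) \<in> fs.span T"
      by (rule fs_span_sum) (auto simp: T_def intro: fs.span_base)
    also have "(\<lambda>b'. \<Sum>b\<in>B. L b v * (if b' = b then 1 else 0)) = (\<lambda>b. if b \<in> B then L b v else 0)"
      using assms by (auto simp: fun_eq_iff sum.delta if_distrib cong: if_cong)
    finally show ?thesis .
  qed
  moreover have "card T < card V" using assms card_image_le[OF assms(2)] by (auto simp: T_def intro: le_less_trans)
  ultimately obtain w where w: "\<exists>v\<in>V. w v \<noteq> 0"
      "\<forall>b. (\<Sum>v\<in>V. w v * (if b \<in> B then L b v else 0)) = 0"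
    using family_relation[of V T "\<lambda>v b. if b \<in> B then L b v else 0"] assms by (auto simp: T_def)
  have "\<forall>b\<in>B. (\<Sum>v\<in>V. w v * L b v) = 0"
  proof
    fix b assume "b \<in> B" then show "(\<Sum>v\<in>V. w v * L b v) = 0" using w(2)[rule_format, of b] by simp
  qed
  with w(1) show ?thesis by blast
qed

text \<open>Injective square systems are onto. The right-hand side \<open>y\<close> is adjoined as
  one more column with index \<open>None\<close>; the relation that then exists must involve it
  because of \<open>ker\<close>, and dividing by its coefficient solves the system.\<close>

lemma functionals_dual:
  fixes L :: "'b \<Rightarrow> 'v \<Rightarrow> 'a::field"
  assumes "finite V" "finite B" "card B = card V"
    and ker: "\<And>w. \<forall>b\<in>B. (\<Sum>v\<in>V. w v * L b v) = 0 \<Longrightarrow> \<forall>v\<in>V. w v = 0"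
  shows "\<exists>w. \<forall>b\<in>B. (\<Sum>v\<in>V. w v * L b v) = y b"
proof -
  define L' where "L' b v = (case v of None \<Rightarrow> y b | Some v \<Rightarrow> L b v)" for b v
  have "card B < card (insert None (Some ` V))"
    using assms by (subst card_insert_disjoint) (auto simp: card_image)
  then obtain w where w: "\<exists>v\<in>insert None (Some ` V). w v \<noteq> 0"
    "\<forall>b\<in>B. (\<Sum>v\<in>insert None (Some ` V). w v * L' b v) = 0"
    using functionals_kernel[of "insert None (Some ` V)" B L'] assms by auto
  have s: "w None * y b + (\<Sum>v\<in>V. w (Some v) * L b v) = 0" if "b \<in> B" for b
    using w(2)[rule_format, OF that] assms(1)
    by (subst (asm) sum.insert) (auto simp: L'_def sum.reindex)
  have n: "w None \<noteq> 0"
  proof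
    assume 0: "w None = 0"
    then have "\<forall>v\<in>V. w (Some v) = 0" using s by (intro ker) auto
    with 0 w(1) show False by auto
  qed
  have "(\<Sum>v\<in>V. (- w (Some v) / w None) * L b v) = y b" if "b \<in> B" for b
  proof -
    have "(\<Sum>v\<in>V. (- w (Some v) / w None) * L b v) = - (\<Sum>v\<in>V. w (Some v) * L b v) / w None"
      by (simp only: sum_divide_distrib sum_negf[symmetric]) simp
    also have "\<dots> = y b"
    proof -
      from s[OF that] have "- (\<Sum>v\<in>V. w (Some v) * L b v) = w None * y b"
        by (metis add.commute add_eq_0_iff)
      with n show ?thesis by simp
    qed
    finally show ?thesis .
  qed
  then show ?thesis by (intro exI[of _ "\<lambda>v. - w (Some v) / w None"] ballI)
qed

section \<open>Monomials: linear independence and spanning\<close>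

definition mon :: "'v set \<Rightarrow> ('v \<Rightarrow> nat) \<Rightarrow> ('v \<Rightarrow> 'a::comm_ring_1) \<Rightarrow> 'a" where
  "mon V \<alpha> x = (\<Prod>v\<in>V. x v ^ \<alpha> v)"

lemma mon_pfun: "mon V \<alpha> \<in> pfun V"
  unfolding mon_def by (intro pfun_prod pfun_power pfun.var)

lemma mon_add: "mon V (\<lambda>v. \<alpha> v + \<beta> v) x = mon V \<alpha> x * mon V \<beta> x"
  by (simp add: mon_def power_add prod.distrib)

lemma mon_times: "mon V \<alpha> (\<lambda>v. x v * y v) = mon V \<alpha> x * mon V \<alpha> y"
  by (simp add: mon_def power_mult_distrib prod.distrib)

text \<open>Two monomials are told apart by a variable \<open>u\<close> with different exponents.
  Scaling \<open>u\<close> by 2 multiplies the term of \<open>\<alpha>\<close> by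
  \<open>2 ^ \<alpha> u\<close>; subtracting \<open>2 ^ \<beta> u\<close> times the relation removes
  the term of \<open>\<beta>\<close>. In characteristic 0 different powers of 2 stay different, so
  no coefficient to be tested is lost.\<close>

lemma mon_indep:
  fixes \<kappa> :: "('v \<Rightarrow> nat) \<Rightarrow> 'a::field_char_0"
  assumes "finite V" "finite A" "\<And>\<alpha> \<beta>. \<alpha> \<in> A \<Longrightarrow> \<beta> \<in> A \<Longrightarrow> \<forall>v\<in>V. \<alpha> v = \<beta> v \<Longrightarrow> \<alpha> = \<beta>"
    and "\<And>x. (\<Sum>\<alpha>\<in>A. \<kappa> \<alpha> * mon V \<alpha> x) = 0"
  shows "\<forall>\<alpha>\<in>A. \<kappa> \<alpha> = 0"
  using assms(2,3,4)
proof (induction A arbitrary: \<kappa>)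
  case (insert \<beta> A)
  have A0: "\<kappa> \<alpha>0 = 0" if \<alpha>0: "\<alpha>0 \<in> A" for \<alpha>0
  proof -
    from \<alpha>0 insert have "\<alpha>0 \<noteq> \<beta>" by auto
    with insert.prems(1)[of \<alpha>0 \<beta>] \<alpha>0 obtain u where u: "\<alpha>0 u \<noteq> \<beta> u" and uV: "u \<in> V" by auto
    define y :: "'v \<Rightarrow> 'a" where "y v = (if v = u then 2 else 1)" for v
    have my: "mon V \<alpha> y = 2 ^ \<alpha> u" for \<alpha>
    proof -
      have "mon V \<alpha> y = (\<Prod>v\<in>V. if v = u then 2 ^ \<alpha> u else 1)"
        unfolding mon_def y_def by (intro prod.cong) auto
      then show ?thesis using uV assms(1) by simp
    qed
    have "(\<Sum>\<alpha>\<in>A. (\<kappa> \<alpha> * (mon V \<alpha> y - mon V \<beta> y)) * mon V \<alpha> x) = 0" for x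
    proof -
      have "(\<Sum>\<alpha>\<in>A. (\<kappa> \<alpha> * (mon V \<alpha> y - mon V \<beta> y)) * mon V \<alpha> x)
        = (\<Sum>\<alpha>\<in>insert \<beta> A. (\<kappa> \<alpha> * (mon V \<alpha> y - mon V \<beta> y)) * mon V \<alpha> x)"
        using insert by simp
      also have "\<dots> = (\<Sum>\<alpha>\<in>insert \<beta> A. \<kappa> \<alpha> * mon V \<alpha> (\<lambda>v. x v * y v)) - mon V \<beta> y * (\<Sum>\<alpha>\<in>insert \<beta> A. \<kappa> \<alpha> * mon V \<alpha> x)"
        by (simp only: sum_subtractf[symmetric] sum_distrib_left mon_times) (simp add: algebra_simps)
      also have "\<dots> = 0" by (simp only: insert.prems(2)) simp
      finally show ?thesis .
    qed
    from insert.IH[OF _ this] insert.prems(1) have "\<forall>\<alpha>\<in>A. \<kappa> \<alpha> * (mon V \<alpha> y - mon V \<beta> y) = 0" by blast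
    with \<alpha>0 have "\<kappa> \<alpha>0 * (2 ^ \<alpha>0 u - 2 ^ \<beta> u) = 0" by (simp add: my)
    moreover have "(2::'a) ^ \<alpha>0 u \<noteq> 2 ^ \<beta> u"
    proof
      assume "(2::'a) ^ \<alpha>0 u = 2 ^ \<beta> u"
      then have "of_nat (2 ^ \<alpha>0 u) = (of_nat (2 ^ \<beta> u) :: 'a)" by simp
      then have "(2::nat) ^ \<alpha>0 u = 2 ^ \<beta> u" by (simp only: of_nat_eq_iff)
      with u show False by simp
    qed
    ultimately show ?thesis by simp
  qed
  have "\<kappa> \<beta> * mon V \<beta> (\<lambda>_. 1) = 0"
    using insert.prems(2)[of "\<lambda>_. 1"] insert.hyps A0 by simp
  then have "\<kappa> \<beta> = 0" by (simp add: mon_def)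
  with A0 show ?case by auto
qed simp

lemma span_mon_mult:
  fixes f g :: "('v \<Rightarrow> 'a::field) \<Rightarrow> 'a"
  assumes de: "f \<in> fs.span (mon V ` (V \<rightarrow>\<^sub>E {..d}))" "g \<in> fs.span (mon V ` (V \<rightarrow>\<^sub>E {..e}))"
  shows "(\<lambda>x. f x * g x) \<in> fs.span (mon V ` (V \<rightarrow>\<^sub>E {..d+e}))"
proof -
  have mm: "(\<lambda>x. mon V \<alpha> x * mon V \<beta> x) \<in> fs.span (mon V ` (V \<rightarrow>\<^sub>E {..d+e}) :: (('v \<Rightarrow> 'a) \<Rightarrow> 'a) set)"
    if "\<alpha> \<in> V \<rightarrow>\<^sub>E {..d}" "\<beta> \<in> V \<rightarrow>\<^sub>E {..e}" for \<alpha> \<beta>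
  proof -
    have "(\<lambda>x. mon V \<alpha> x * mon V \<beta> x :: 'a) = mon V (\<lambda>v\<in>V. \<alpha> v + \<beta> v)"
      by (simp add: mon_def fun_eq_iff power_add prod.distrib)
    moreover have "(\<lambda>v\<in>V. \<alpha> v + \<beta> v) \<in> V \<rightarrow>\<^sub>E {..d+e}"
      using that by (auto simp: PiE_iff intro!: add_mono)
    ultimately show ?thesis by (simp only: fs.span_base imageI)
  qed
  have "(\<lambda>x. f x * mon V \<beta> x) \<in> fs.span (mon V ` (V \<rightarrow>\<^sub>E {..d+e}))" if b: "\<beta> \<in> V \<rightarrow>\<^sub>E {..e}" for \<beta>
    using de(1)
  proof (induction rule: fs.span_induct_alt)
    case base
    show ?case using fs.span_zero by (simp add: zero_fun_def)
  next
    case (step c m h)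
    then obtain \<alpha> where "\<alpha> \<in> V \<rightarrow>\<^sub>E {..d}" "m = mon V \<alpha>" by auto
    then have "(\<lambda>x. c * (m x * mon V \<beta> x)) \<in> fs.span (mon V ` (V \<rightarrow>\<^sub>E {..d+e}))"
      using mm[OF _ b] fs.span_scale by blast
    from fs.span_add[OF this step(2)] show ?case
      by (simp add: plus_fun_def algebra_simps)
  qed
  note fm = this
  show "(\<lambda>x. f x * g x) \<in> fs.span (mon V ` (V \<rightarrow>\<^sub>E {..d+e}))"
    using de(2)
  proof (induction rule: fs.span_induct_alt)
    case base
    show ?case using fs.span_zero by (simp add: zero_fun_def)
  next
    case (step c m h)
    then obtain \<alpha> where "\<alpha> \<in> V \<rightarrow>\<^sub>E {..e}" "m = mon V \<alpha>" by auto
    then have "(\<lambda>x. c * (f x * m x)) \<in> fs.span (mon V ` (V \<rightarrow>\<^sub>E {..d+e}))"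
      using fm fs.span_scale by blast
    from fs.span_add[OF this step(2)] show ?case
      by (simp add: plus_fun_def algebra_simps)
  qed
qed

lemma span_mon_mono:
  "f \<in> fs.span (mon V ` (V \<rightarrow>\<^sub>E {..d})) \<Longrightarrow> d \<le> e \<Longrightarrow> f \<in> fs.span (mon V ` (V \<rightarrow>\<^sub>E {..e}))"
  by (erule rev_subsetD[OF _ fs.span_mono]) (intro image_mono PiE_mono, auto)

text \<open>Degrees are bounded in each variable separately, so that the exponents form a box whose
  cardinality is a plain power.\<close>

lemma pfun_monomials:
  fixes f :: "('v \<Rightarrow> 'a::field) \<Rightarrow> 'a"
  assumes "f \<in> pfun V" "finite V"
  shows "\<exists>d. f \<in> fs.span (mon V ` (V \<rightarrow>\<^sub>E {..d}))"
  using assms(1)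
proof induction
  case (const c)
  have "mon V (\<lambda>v\<in>V. 0) \<in> fs.span (mon V ` (V \<rightarrow>\<^sub>E {..0}) :: (('v \<Rightarrow> 'a) \<Rightarrow> 'a) set)"
    by (intro fs.span_base imageI) auto
  moreover have "mon V (\<lambda>v\<in>V. 0) = (\<lambda>x. 1::'a)" by (simp add: mon_def fun_eq_iff)
  ultimately have "(\<lambda>x. 1) \<in> fs.span (mon V ` (V \<rightarrow>\<^sub>E {..0}) :: (('v \<Rightarrow> 'a) \<Rightarrow> 'a) set)" by (simp only:)
  from fs.span_scale[OF this, of c] show ?case by (intro exI[of _ 0]) (simp only: mult_1_right)
next
  case (var u)
  have "mon V (\<lambda>v\<in>V. if v = u then 1 else 0) \<in> fs.span (mon V ` (V \<rightarrow>\<^sub>E {..1}) :: (('v \<Rightarrow> 'a) \<Rightarrow> 'a) set)"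
    by (intro fs.span_base imageI) auto
  moreover have "mon V (\<lambda>v\<in>V. if v = u then 1 else 0) x = x u" for x :: "'v \<Rightarrow> 'a"
  proof -
    have "mon V (\<lambda>v\<in>V. if v = u then 1 else 0) x = (\<Prod>v\<in>V. if v = u then x u else 1)"
      unfolding mon_def by (intro prod.cong) auto
    then show ?thesis using var assms(2) by simp
  qed
  then have "mon V (\<lambda>v\<in>V. if v = u then 1 else 0) = (\<lambda>x. x u :: 'a)" by blast
  ultimately show ?case by (intro exI[of _ 1]) (simp only:)
next
  case (add f g)
  then obtain d e where "f \<in> fs.span (mon V ` (V \<rightarrow>\<^sub>E {..d}))" "g \<in> fs.span (mon V ` (V \<rightarrow>\<^sub>E {..e}))"
    by blast
  moreover have "fs.span (mon V ` (V \<rightarrow>\<^sub>E {..d})) \<subseteq> fs.span (mon V ` (V \<rightarrow>\<^sub>E {..d+e}) :: (('v \<Rightarrow> 'a) \<Rightarrow> 'a) set)"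
    "fs.span (mon V ` (V \<rightarrow>\<^sub>E {..e})) \<subseteq> fs.span (mon V ` (V \<rightarrow>\<^sub>E {..d+e}) :: (('v \<Rightarrow> 'a) \<Rightarrow> 'a) set)"
    by (intro fs.span_mono image_mono PiE_mono; auto)+
  ultimately have "f + g \<in> fs.span (mon V ` (V \<rightarrow>\<^sub>E {..d+e}))"
    by (intro fs.span_add) auto
  then show ?case by (auto simp: plus_fun_def)
next
  case (mult f g)
  then obtain d e where de: "f \<in> fs.span (mon V ` (V \<rightarrow>\<^sub>E {..d}))" "g \<in> fs.span (mon V ` (V \<rightarrow>\<^sub>E {..e}))"
    by blast
  from span_mon_mult[OF this] show ?case by blast
qed

section \<open>Constructible sets\<close>

inductive_set constr :: "('v \<Rightarrow> complex) set set" where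
  zero: "f \<in> pfun UNIV \<Longrightarrow> {x. f x = 0} \<in> constr"
| compl: "S \<in> constr \<Longrightarrow> - S \<in> constr"
| inter: "S \<in> constr \<Longrightarrow> T \<in> constr \<Longrightarrow> S \<inter> T \<in> constr"

lemma constr_union: "S \<in> constr \<Longrightarrow> T \<in> constr \<Longrightarrow> S \<union> T \<in> constr"
  using constr.compl[OF constr.inter[OF constr.compl constr.compl, of S T]] by simp

lemma constr_UNIV: "UNIV \<in> constr"
  using constr.zero[OF pfun.const[of 0]] by simp

lemma constr_empty: "{} \<in> constr"
  using constr.compl[OF constr_UNIV] by simp

lemma constr_Inter: "finite I \<Longrightarrow> (\<And>i. i \<in> I \<Longrightarrow> S i \<in> constr) \<Longrightarrow> {x. \<forall>i\<in>I. x \<in> S i} \<in> constr"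
proof (induction I rule: finite_induct)
  case (insert i I)
  have "{x. \<forall>i\<in>insert i I. x \<in> S i} = S i \<inter> {x. \<forall>i\<in>I. x \<in> S i}" by auto
  with insert show ?case by (auto intro: constr.inter)
qed (simp add: constr_UNIV)

lemma constr_Union: "finite I \<Longrightarrow> (\<And>i. i \<in> I \<Longrightarrow> S i \<in> constr) \<Longrightarrow> {x. \<exists>i\<in>I. x \<in> S i} \<in> constr"
proof (induction I rule: finite_induct)
  case (insert i I)
  have "{x. \<exists>i\<in>insert i I. x \<in> S i} = S i \<union> {x. \<exists>i\<in>I. x \<in> S i}" by auto
  with insert show ?case by (auto intro: constr_union)
qed (simp add: constr_empty)

lemma constr_eq: "f \<in> pfun UNIV \<Longrightarrow> g \<in> pfun UNIV \<Longrightarrow> {x. f x = g x} \<in> constr"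
  using constr.zero[OF pfun_diff[of f UNIV g]] by simp

lemma constr_neq: "f \<in> pfun UNIV \<Longrightarrow> {x. f x \<noteq> 0} \<in> constr"
  using constr.compl[OF constr.zero[of f]] by (simp add: Compl_eq)

text \<open>A constructible set is generically full or generically empty. A nonzero polynomial
  witnesses the complement of its own zero set, and for an intersection two witnesses are
  multiplied. This dichotomy is what makes a count generically constant.\<close>

lemma constr_generic:
  assumes "S \<in> constr"
  shows "\<exists>h\<in>pfun UNIV. (\<exists>x. h x \<noteq> 0) \<and> ({x. h x \<noteq> 0} \<subseteq> S \<or> {x. h x \<noteq> 0} \<subseteq> - S)"
  using assms
proof induction
  case (zero f)
  show ?case
  proof (cases "\<exists>x. f x \<noteq> 0")
    case True
    then show ?thesis using zero by (intro bexI[of _ f]) auto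
  next
    case False
    then show ?thesis by (intro bexI[of _ "\<lambda>x. 1"]) (auto intro: pfun.intros)
  qed
next
  case (inter S T)
  then obtain h k where h: "h \<in> pfun UNIV" "\<exists>x. h x \<noteq> 0" "{x. h x \<noteq> 0} \<subseteq> S \<or> {x. h x \<noteq> 0} \<subseteq> - S"
    and k: "k \<in> pfun UNIV" "\<exists>x. k x \<noteq> 0" "{x. k x \<noteq> 0} \<subseteq> T \<or> {x. k x \<noteq> 0} \<subseteq> - T"
    by blast
  from h(2) k(2) have "\<exists>x. h x * k x \<noteq> 0"
    using pfun_two_nonzero[OF h(1) k(1)] by (metis mult_eq_0_iff)
  moreover have "{x. h x * k x \<noteq> 0} \<subseteq> S \<inter> T \<or> {x. h x * k x \<noteq> 0} \<subseteq> - (S \<inter> T)"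
    using h(3) k(3) by fastforce
  ultimately show ?case using pfun.mult[OF h(1) k(1)] by (intro bexI[of _ "\<lambda>x. h x * k x"]) auto
qed auto

text \<open>A pair \<open>(m, c)\<close> encodes a polynomial in one variable \<open>z\<close> of degree less than \<open>m\<close> whose
  coefficients are functions of a parameter \<open>x\<close>.\<close>

definition upol :: "nat \<times> (nat \<Rightarrow> 'x \<Rightarrow> complex) \<Rightarrow> 'x \<Rightarrow> complex poly" where
  "upol p x = (\<Sum>k<fst p. monom (snd p k x) k)"

definition pcoeffs :: "nat \<times> (nat \<Rightarrow> ('v \<Rightarrow> complex) \<Rightarrow> complex) \<Rightarrow> bool" where
  "pcoeffs p \<longleftrightarrow> (\<forall>k. snd p k \<in> pfun UNIV)"

lemma poly_upol: "poly (upol p x) z = (\<Sum>k<fst p. snd p k x * z ^ k)"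
  by (simp add: upol_def poly_sum poly_monom)

lemma coeff_upol: "coeff (upol p x) k = (if k < fst p then snd p k x else 0)"
  by (simp add: upol_def coeff_sum sum.delta)

lemma upol_zero_iff: "upol p x = 0 \<longleftrightarrow> (\<forall>k<fst p. snd p k x = 0)"
  by (auto simp: poly_eq_iff coeff_upol)

lemma upol_Suc_zero: "c a x = 0 \<Longrightarrow> upol (Suc a, c) x = upol (a, c) x"
  by (simp add: upol_def)

text \<open>One step of pseudo-division: the leading coefficients \<open>c a\<close> and
  \<open>d b\<close> of polynomials of lengths \<open>Suc a\<close> and \<open>Suc b\<close> are
  cancelled by cross-multiplication, so that coefficients stay polynomial in the parameter. The
  result has length \<open>b\<close>, one less than the dividend.\<close>

definition preduce where
  "preduce a c b d = (b, \<lambda>k x. c a x * d k x - d b x * (if k \<ge> b - a then c (k - (b - a)) x else 0))"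

lemma pcoeffs_preduce:
  assumes "pcoeffs (m, c)" "pcoeffs (m', d)" shows "pcoeffs (preduce a c b d)"
proof -
  have "(\<lambda>x. if b - a \<le> k then c (k - (b - a)) x else 0) \<in> pfun UNIV" for k
    using assms(1) by (cases "b - a \<le> k") (auto simp: pcoeffs_def intro: pfun.const)
  then show ?thesis using assms unfolding pcoeffs_def preduce_def
    by (auto intro!: pfun_diff pfun.mult)
qed

lemma upol_preduce:
  assumes "a \<le> b"
  shows "upol (preduce a c b d) x
    = smult (c a x) (upol (Suc b, d) x) - monom (d b x) (b - a) * upol (Suc a, c) x"
proof (rule poly_eqI)
  fix k
  consider "k < b" "k \<ge> b - a" | "k < b" "k < b - a" | "k = b" | "k > b" by linarith
  then show "coeff (upol (preduce a c b d) x) k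
    = coeff (smult (c a x) (upol (Suc b, d) x) - monom (d b x) (b - a) * upol (Suc a, c) x) k"
    by cases (use assms in \<open>auto simp: coeff_upol coeff_monom_mult preduce_def\<close>)
qed

text \<open>The normal form of an existential statement in one variable: several equations but a
  single inequation, since inequations can be multiplied together.\<close>

definition elim_set where
  "elim_set F g = {x. \<exists>z. (\<forall>p\<in>set F. poly (upol p x) z = 0) \<and> poly (upol g x) z \<noteq> 0}"

text \<open>While \<open>c a x\<close> is nonzero, pseudo-division does not affect divisibility by
  \<open>upol (Suc a, c) x\<close> and shortens the dividend. Once its length is at most
  \<open>a\<close>, the degree of the divisor, divisibility means that all coefficients
  vanish.\<close>

lemma constr_not_dvd:
  assumes c: "pcoeffs (Suc a, c)" and "pcoeffs (M, e)"
  shows "{x. c a x \<noteq> 0 \<and> \<not> upol (Suc a, c) x dvd upol (M, e) x} \<in> constr"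
  using assms(2)
proof (induction M arbitrary: e rule: less_induct)
  case (less M)
  have ca: "{x. c a x \<noteq> 0} \<in> constr" using c by (intro constr_neq) (auto simp: pcoeffs_def)
  have deg: "degree (upol (Suc a, c) x) = a" if "c a x \<noteq> 0" for x
  proof (rule antisym)
    show "degree (upol (Suc a, c) x) \<le> a" by (rule degree_le) (auto simp: coeff_upol)
    show "a \<le> degree (upol (Suc a, c) x)" by (rule le_degree) (use that in \<open>auto simp: coeff_upol\<close>)
  qed
  show ?case
  proof (cases "M \<le> a")
    case True
    have "\<not> upol (Suc a, c) x dvd upol (M, e) x \<longleftrightarrow> (\<exists>k\<in>{..<M}. e k x \<noteq> 0)" if "c a x \<noteq> 0" for x
    proof -
      have "upol (M, e) x = 0" if "upol (Suc a, c) x dvd upol (M, e) x"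
      proof (rule ccontr)
        assume n: "upol (M, e) x \<noteq> 0"
        with that have "a \<le> degree (upol (M, e) x)"
          using dvd_imp_degree_le[OF that] deg[OF \<open>c a x \<noteq> 0\<close>] by simp
        moreover have "coeff (upol (M, e) x) (degree (upol (M, e) x)) \<noteq> 0" using n by simp
        ultimately show False using True by (auto simp: coeff_upol split: if_splits)
      qed
      then have "upol (Suc a, c) x dvd upol (M, e) x \<longleftrightarrow> upol (M, e) x = 0" by auto
      then show ?thesis by (auto simp: upol_zero_iff)
    qed
    then have "{x. c a x \<noteq> 0 \<and> \<not> upol (Suc a, c) x dvd upol (M, e) x}
        = {x. c a x \<noteq> 0} \<inter> {x. \<exists>k\<in>{..<M}. x \<in> {x. e k x \<noteq> 0}}" by auto
    moreover have "{x. \<exists>k\<in>{..<M}. x \<in> {x. e k x \<noteq> 0}} \<in> constr"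
      by (rule constr_Union) (use less.prems in \<open>auto simp: pcoeffs_def intro: constr_neq\<close>)
    ultimately show ?thesis using ca by (auto intro: constr.inter)
  next
    case False
    then obtain b where b: "M = Suc b" "a \<le> b" by (cases M) auto
    define r where "r = preduce a c b e"
    have r: "fst r = b" "pcoeffs r" using pcoeffs_preduce[OF c less.prems] by (auto simp: r_def preduce_def)
    have "upol (Suc a, c) x dvd upol (M, e) x \<longleftrightarrow> upol (Suc a, c) x dvd upol r x" if "c a x \<noteq> 0" for x
      unfolding r_def upol_preduce[OF b(2)] b(1)
      using that by (simp add: dvd_diff_left_iff dvd_smult_iff)
    moreover have "r = (b, snd r)" using r by (simp add: prod_eq_iff)
    ultimately have "{x. c a x \<noteq> 0 \<and> \<not> upol (Suc a, c) x dvd upol (M, e) x}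
        = {x. c a x \<noteq> 0 \<and> \<not> upol (Suc a, c) x dvd upol (b, snd r) x}"
      by (intro Collect_cong) auto
    also have "\<dots> \<in> constr" using less.IH[of b "snd r"] r b by (simp add: pcoeffs_def)
    finally show ?thesis .
  qed
qed

lemma upol_power:
  assumes "pcoeffs g"
  shows "\<exists>h. pcoeffs h \<and> (\<forall>x. upol h x = upol g x ^ n)"
proof (induction n)
  case 0
  show ?case
    by (rule exI[of _ "(1, \<lambda>k x. 1)"]) (auto simp: pcoeffs_def upol_def monom_0 intro: pfun.const)
next
  case (Suc n)
  then obtain h where h: "pcoeffs h" "\<And>x. upol h x = upol g x ^ n" by blast
  define d where "d k x = (\<Sum>i<fst g. \<Sum>j<fst h. if i + j = k then snd g i x * snd h j x else 0)" for k x
  have "d k \<in> pfun UNIV" for k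
  proof -
    have "(\<lambda>x. if i + j = k then snd g i x * snd h j x else 0) \<in> pfun UNIV" for i j
      using assms h by (cases "i + j = k") (auto intro!: pfun.intros simp: pcoeffs_def)
    then show ?thesis unfolding d_def by (intro pfun_sum) auto
  qed
  moreover have "upol (fst g + fst h, d) x = upol g x * upol h x" for x
  proof -
    have "poly (upol (fst g + fst h, d) x) z = poly (upol g x * upol h x) z" for z
      by (simp add: poly_upol sum_conv d_def)
    then show ?thesis by (subst poly_eq_poly_eq_iff[symmetric]) auto
  qed
  ultimately show ?case using h by (intro exI[of _ "(fst g + fst h, d)"]) (auto simp: pcoeffs_def)
qed

text \<open>Over the complex numbers all roots of a nonzero \<open>p\<close> are roots of
  \<open>g\<close> iff \<open>p\<close> divides \<open>g ^ degree p\<close>. Where the leading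
  coefficient vanishes the equation is shortened; elsewhere the degree is exactly \<open>a\<close>,
  which gives a uniform exponent and reduces the question to divisibility.\<close>

lemma elim_one:
  assumes "pcoeffs g" "pcoeffs (m, c)"
  shows "elim_set [(m, c)] g \<in> constr"
  using assms(2)
proof (induction m)
  case 0
  have "elim_set [(0, c)] g = {x. \<exists>k\<in>{..<fst g}. x \<in> {x. snd g k x \<noteq> 0}}"
  proof -
    have "(\<exists>z. poly (upol g x) z \<noteq> 0) \<longleftrightarrow> upol g x \<noteq> 0" for x
      using poly_all_0_iff_0 by blast
    then show ?thesis by (auto simp: elim_set_def upol_zero_iff upol_def[of "(0, c)"])
  qed
  also have "\<dots> \<in> constr"
    by (rule constr_Union) (use assms in \<open>auto simp: pcoeffs_def intro: constr_neq\<close>)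
  finally show ?case .
next
  case (Suc a)
  obtain h where h: "pcoeffs h" "\<And>x. upol h x = upol g x ^ a" using upol_power[OF assms(1)] by blast
  have ca: "c a \<in> pfun UNIV" using Suc.prems by (auto simp: pcoeffs_def)
  have eq: "(\<exists>z. poly (upol (Suc a, c) x) z = 0 \<and> poly (upol g x) z \<noteq> 0)
      \<longleftrightarrow> \<not> upol (Suc a, c) x dvd upol h x" if "c a x \<noteq> 0" for x
  proof -
    have "degree (upol (Suc a, c) x) = a"
    proof (rule antisym)
      show "degree (upol (Suc a, c) x) \<le> a" by (rule degree_le) (auto simp: coeff_upol)
      show "a \<le> degree (upol (Suc a, c) x)" by (rule le_degree) (use that in \<open>auto simp: coeff_upol\<close>)
    qed
    moreover have "upol (Suc a, c) x \<noteq> 0" using that by (auto simp: upol_zero_iff)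
    ultimately show ?thesis
      using nullstellensatz_univariate[of "upol (Suc a, c) x" "upol g x"] h(2) by auto
  qed
  have "elim_set [(Suc a, c)] g = ({x. c a x = 0} \<inter> elim_set [(a, c)] g)
      \<union> {x. c a x \<noteq> 0 \<and> \<not> upol (Suc a, c) x dvd upol (fst h, snd h) x}"
    (is "?L = ?R")
  proof (intro set_eqI)
    fix x show "x \<in> ?L \<longleftrightarrow> x \<in> ?R"
      using eq[of x] by (cases "c a x = 0") (simp_all add: elim_set_def upol_Suc_zero)
  qed
  moreover have "elim_set [(a, c)] g \<in> constr" using Suc by (simp add: pcoeffs_def)
  moreover have "{x. c a x \<noteq> 0 \<and> \<not> upol (Suc a, c) x dvd upol (fst h, snd h) x} \<in> constr"
    using constr_not_dvd[OF Suc.prems, of "fst h" "snd h"] h(1) by simp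
  ultimately show ?case using constr.zero[OF ca] by (auto intro: constr.inter constr_union)
qed

text \<open>The Euclidean algorithm with parameters: of two equations, the longer one is replaced by
  its pseudo-remainder where the leading coefficient of the shorter one is nonzero, and elsewhere
  the shorter one loses its leading term. At most one equation remains in the end.\<close>

lemma elim_set_constr:
  assumes "pcoeffs g" "\<forall>p\<in>set F. pcoeffs p"
  shows "elim_set F g \<in> constr"
  using assms(2)
\<comment> \<open>\<open>Suc\<close> makes the measure drop also when an equation of length 0 is
  discarded.\<close>
proof (induction "\<Sum>p\<leftarrow>F. Suc (fst p)" arbitrary: F rule: less_induct)
  case less
  have step: "elim_set ((Suc a, c) # (Suc b, d) # G) g \<in> constr"
    if ab: "a \<le> b" and pc: "pcoeffs (Suc a, c)" "pcoeffs (Suc b, d)" "\<forall>p\<in>set G. pcoeffs p"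
      and len: "(\<Sum>p\<leftarrow>F. Suc (fst p)) = (\<Sum>p\<leftarrow>(Suc a, c) # (Suc b, d) # G. Suc (fst p))" for a b c d G
  proof -
    define r where "r = preduce a c b d"
    have r: "fst r = b" "pcoeffs r" using pcoeffs_preduce[OF pc(1,2)] by (auto simp: r_def preduce_def)
    have eq: "(poly (upol (Suc a, c) x) z = 0 \<and> poly (upol (Suc b, d) x) z = 0)
       \<longleftrightarrow> (poly (upol (Suc a, c) x) z = 0 \<and> poly (upol r x) z = 0)" if "c a x \<noteq> 0" for x z
      unfolding r_def upol_preduce[OF ab] using that by auto
    have "elim_set ((Suc a, c) # (Suc b, d) # G) g = ({x. c a x = 0} \<inter> elim_set ((a, c) # (Suc b, d) # G) g)
      \<union> ({x. c a x \<noteq> 0} \<inter> elim_set ((Suc a, c) # r # G) g)"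
      (is "?L = ?R")
    proof (intro set_eqI)
      fix x show "x \<in> ?L \<longleftrightarrow> x \<in> ?R"
      proof (cases "c a x = 0")
        case True
        then show ?thesis by (simp add: elim_set_def upol_Suc_zero)
      next
        case False
        from eq[OF this] have "(poly (upol (Suc a, c) x) z = 0 \<and> poly (upol (Suc b, d) x) z = 0 \<and> Q)
          \<longleftrightarrow> (poly (upol (Suc a, c) x) z = 0 \<and> poly (upol r x) z = 0 \<and> Q)" for z Q by blast
        with False show ?thesis by (simp add: elim_set_def)
      qed
    qed
    moreover have "elim_set ((a, c) # (Suc b, d) # G) g \<in> constr"
      by (rule less.hyps) (use pc len in \<open>auto simp: pcoeffs_def\<close>)
    moreover have "elim_set ((Suc a, c) # r # G) g \<in> constr"
      by (rule less.hyps) (use pc len r in auto)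
    moreover have "c a \<in> pfun UNIV" using pc by (auto simp: pcoeffs_def)
    ultimately show ?thesis by (auto intro: constr.inter constr_union constr.zero constr_neq)
  qed
  show ?case
  proof (cases F)
    case Nil
    have "elim_set [] g = elim_set [(0, \<lambda>k x. 0)] g" by (auto simp: elim_set_def upol_def[of "(0, _)"])
    moreover have "pcoeffs (0, \<lambda>k x. 0)" by (auto simp: pcoeffs_def intro: pfun.const)
    ultimately show ?thesis using elim_one[OF assms(1)] Nil by metis
  next
    case (Cons p F')
    show ?thesis
    proof (cases F')
      case Nil
      then show ?thesis using Cons elim_one[OF assms(1), of "fst p" "snd p"] less.prems by simp
    next
      case (Cons q G)
      note F = \<open>F = p # F'\<close> \<open>F' = q # G\<close>
      show ?thesis
      proof (cases "fst p = 0 \<or> fst q = 0")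
        case True
        then show ?thesis
        proof
          assume "fst p = 0"
          then have "elim_set F g = elim_set (q # G) g" by (auto simp: elim_set_def F upol_def[of p])
          moreover have "elim_set (q # G) g \<in> constr"
            by (rule less.hyps) (use less.prems in \<open>auto simp: F\<close>)
          ultimately show ?thesis by simp
        next
          assume "fst q = 0"
          then have "elim_set F g = elim_set (p # G) g" by (auto simp: elim_set_def F upol_def[of q])
          moreover have "elim_set (p # G) g \<in> constr"
            by (rule less.hyps) (use less.prems in \<open>auto simp: F\<close>)
          ultimately show ?thesis by simp
        qed
      next
        case False
        then obtain a c b d where pq: "p = (Suc a, c)" "q = (Suc b, d)"
          by (metis not0_implies_Suc prod.collapse)
        show ?thesis
        proof (cases "a \<le> b")
          case True
          then show ?thesis using step[OF True, of c d G] less.prems by (simp add: F pq)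
        next
          case False
          have "elim_set F g = elim_set (q # p # G) g" by (auto simp: elim_set_def F)
          then show ?thesis using step[of b a d c G] False less.prems by (simp add: F pq)
        qed
      qed
    qed
  qed
qed

text \<open>A complement cannot be read off directly from a disjunctive form, so the induction
  carries \<open>S\<close> and \<open>- S\<close> together. Two inequations in one alternative are
  merged by multiplying them.\<close>

lemma constr_dnf:
  fixes S :: "('v \<Rightarrow> complex) set"
  assumes "S \<in> constr"
  shows "\<exists>D. finite D \<and> (\<forall>(F, g)\<in>D. finite F \<and> F \<subseteq> pfun UNIV \<and> g \<in> pfun UNIV) \<and>
    S = {x. \<exists>(F, g)\<in>D. (\<forall>f\<in>F. f x = 0) \<and> g x \<noteq> 0}"
    (is "?dnf S")
proof -
  have int: "?dnf (S \<inter> T)" if S: "?dnf S" and T: "?dnf T" for S T :: "('v \<Rightarrow> complex) set"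
  proof -
    from S obtain D where D: "finite D" "\<forall>(F, g)\<in>D. finite F \<and> F \<subseteq> pfun UNIV \<and> g \<in> pfun UNIV"
      "S = {x. \<exists>(F, g)\<in>D. (\<forall>f\<in>F. f x = 0) \<and> g x \<noteq> 0}" by blast
    from T obtain D' where D': "finite D'" "\<forall>(F, g)\<in>D'. finite F \<and> F \<subseteq> pfun UNIV \<and> g \<in> pfun UNIV"
      "T = {x. \<exists>(F, g)\<in>D'. (\<forall>f\<in>F. f x = 0) \<and> g x \<noteq> 0}" by blast
    define E where "E = (\<lambda>(p, q). (fst p \<union> fst q, \<lambda>x. snd p x * snd q x)) ` (D \<times> D')"
    have "finite E" using D D' by (simp add: E_def)
    moreover have "\<forall>(F, g)\<in>E. finite F \<and> F \<subseteq> pfun UNIV \<and> g \<in> pfun UNIV"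
      using D(2) D'(2) by (fastforce simp: E_def intro: pfun.mult)
    moreover have "S \<inter> T = {x. \<exists>(F, g)\<in>E. (\<forall>f\<in>F. f x = 0) \<and> g x \<noteq> 0}"
    proof (intro set_eqI)
      fix x
      have "x \<in> S \<inter> T \<longleftrightarrow> (\<exists>p\<in>D. \<exists>q\<in>D'. (\<forall>f\<in>fst p. f x = 0) \<and> snd p x \<noteq> 0 \<and> (\<forall>f\<in>fst q. f x = 0) \<and> snd q x \<noteq> 0)"
        unfolding D(3) D'(3) by (auto simp: case_prod_beta)
      also have "\<dots> \<longleftrightarrow> x \<in> {x. \<exists>(F, g)\<in>E. (\<forall>f\<in>F. f x = 0) \<and> g x \<noteq> 0}"
        unfolding E_def by (simp add: case_prod_beta Bex_def) (metis Un_iff)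
      finally show "x \<in> S \<inter> T \<longleftrightarrow> x \<in> {x. \<exists>(F, g)\<in>E. (\<forall>f\<in>F. f x = 0) \<and> g x \<noteq> 0}" .
    qed
    ultimately show ?thesis by blast
  qed
  have un: "?dnf (S \<union> T)" if S: "?dnf S" and T: "?dnf T" for S T :: "('v \<Rightarrow> complex) set"
  proof -
    from S obtain D where D: "finite D" "\<forall>(F, g)\<in>D. finite F \<and> F \<subseteq> pfun UNIV \<and> g \<in> pfun UNIV"
      "S = {x. \<exists>(F, g)\<in>D. (\<forall>f\<in>F. f x = 0) \<and> g x \<noteq> 0}" by blast
    from T obtain D' where D': "finite D'" "\<forall>(F, g)\<in>D'. finite F \<and> F \<subseteq> pfun UNIV \<and> g \<in> pfun UNIV"
      "T = {x. \<exists>(F, g)\<in>D'. (\<forall>f\<in>F. f x = 0) \<and> g x \<noteq> 0}" by blast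
    show ?thesis
      by (rule exI[of _ "D \<union> D'"]) (use D D' in auto)
  qed
  have eq: "?dnf {x. f x = 0}" if "f \<in> pfun UNIV" for f :: "('v \<Rightarrow> complex) \<Rightarrow> complex"
    by (rule exI[of _ "{({f}, \<lambda>x. 1)}"]) (use that in \<open>auto intro: pfun.const\<close>)
  have neq: "?dnf {x. f x \<noteq> 0}" if "f \<in> pfun UNIV" for f :: "('v \<Rightarrow> complex) \<Rightarrow> complex"
    by (rule exI[of _ "{({}, f)}"]) (use that in auto)
  have "?dnf S \<and> ?dnf (- S)" using assms
  proof induction
    case (zero f)
    have "- {x. f x = 0} = {x. f x \<noteq> 0}" by auto
    then show ?case using eq[OF zero] neq[OF zero] by simp
  next
    case (compl S)
    then show ?case by simp
  next
    case (inter S T)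
    then show ?case using int un by (simp add: Compl_Int)
  qed
  then show ?thesis by blast
qed

text \<open>Projection along one coordinate: in each alternative of the disjunctive form all
  polynomials are sorted by powers of the coordinate \<open>v\<close>, the other coordinates being
  the parameters of the elimination.\<close>

lemma constr_ex:
  assumes "S \<in> constr"
  shows "{x. \<exists>z. x(v := z) \<in> S} \<in> constr"
proof -
  obtain D where D: "finite D" "\<forall>(F, g)\<in>D. finite F \<and> F \<subseteq> pfun UNIV \<and> g \<in> pfun UNIV"
    "S = {x. \<exists>(F, g)\<in>D. (\<forall>f\<in>F. f x = 0) \<and> g x \<noteq> 0}" using constr_dnf[OF assms] by blast
  have "{x. \<exists>z. (\<forall>f\<in>F. f (x(v := z)) = 0) \<and> g (x(v := z)) \<noteq> 0} \<in> constr"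
    if Fg: "(F, g) \<in> D" for F g
  proof -
    have "\<forall>f\<in>pfun UNIV. \<exists>p. pcoeffs p \<and> (\<forall>x z. f (x(v := z)) = poly (upol p x) z)"
    proof
      fix f :: "('a \<Rightarrow> complex) \<Rightarrow> complex" assume "f \<in> pfun UNIV"
      from pfun_expand[OF this, of v] obtain m c where
        c: "\<forall>k. c k \<in> pfun (UNIV - {v})" "\<forall>x z. f (x(v := z)) = (\<Sum>k<m. c k x * z ^ k)" by blast
      have "pcoeffs (m, c)" using c(1) pfun_mono[of _ "UNIV - {v}" UNIV] by (auto simp: pcoeffs_def)
      with c(2) show "\<exists>p. pcoeffs p \<and> (\<forall>x z. f (x(v := z)) = poly (upol p x) z)"
        by (intro exI[of _ "(m, c)"]) (simp add: poly_upol)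
    qed
    then obtain P where P: "\<And>f. f \<in> pfun UNIV \<Longrightarrow> pcoeffs (P f)"
      "\<And>f x z. f \<in> pfun UNIV \<Longrightarrow> f (x(v := z)) = poly (upol (P f) x) z" by metis
    from D(2) Fg have F: "finite F" "F \<subseteq> pfun UNIV" "g \<in> pfun UNIV" by auto
    obtain fs where fs: "set fs = F" using finite_list[OF F(1)] by blast
    have "{x. \<exists>z. (\<forall>f\<in>F. f (x(v := z)) = 0) \<and> g (x(v := z)) \<noteq> 0} = elim_set (map P fs) (P g)"
      using F P(2) by (auto simp: elim_set_def fs subset_iff)
    also have "\<dots> \<in> constr" by (rule elim_set_constr) (use F P(1) fs in auto)
    finally show ?thesis .
  qed
  then have "{x. \<exists>z. (\<forall>f\<in>fst d. f (x(v := z)) = 0) \<and> snd d (x(v := z)) \<noteq> 0} \<in> constr"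
    if "d \<in> D" for d using that by (cases d) simp
  then have "{x. \<exists>d\<in>D. x \<in> {x. \<exists>z. (\<forall>f\<in>fst d. f (x(v := z)) = 0) \<and> snd d (x(v := z)) \<noteq> 0}} \<in> constr"
    by (intro constr_Union D(1))
  also have "{x. \<exists>d\<in>D. x \<in> {x. \<exists>z. (\<forall>f\<in>fst d. f (x(v := z)) = 0) \<and> snd d (x(v := z)) \<noteq> 0}}
     = {x. \<exists>z. x(v := z) \<in> S}" unfolding D(3) by (auto simp: case_prod_beta)
  finally show ?thesis .
qed

lemma constr_block_ex:
  assumes "S \<in> constr" "finite W"
  shows "{x. \<exists>y. (\<forall>v. v \<notin> W \<longrightarrow> y v = x v) \<and> y \<in> S} \<in> constr"
  using assms(2)
proof (induction W)
  case empty
  have "{x. \<exists>y. (\<forall>v. v \<notin> {} \<longrightarrow> y v = x v) \<and> y \<in> S} = S" by (auto simp: fun_eq_iff[symmetric])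
  then show ?case using assms by simp
next
  case (insert w W)
  have "{x. \<exists>y. (\<forall>v. v \<notin> insert w W \<longrightarrow> y v = x v) \<and> y \<in> S}
     = {x. \<exists>z. x(w := z) \<in> {x. \<exists>y. (\<forall>v. v \<notin> W \<longrightarrow> y v = x v) \<and> y \<in> S}}"
  proof (intro set_eqI iffI)
    fix x assume "x \<in> {x. \<exists>y. (\<forall>v. v \<notin> insert w W \<longrightarrow> y v = x v) \<and> y \<in> S}"
    then obtain y where y: "\<forall>v. v \<notin> insert w W \<longrightarrow> y v = x v" "y \<in> S" by blast
    then have "\<forall>v. v \<notin> W \<longrightarrow> y v = (x(w := y w)) v" by auto
    with y show "x \<in> {x. \<exists>z. x(w := z) \<in> {x. \<exists>y. (\<forall>v. v \<notin> W \<longrightarrow> y v = x v) \<and> y \<in> S}}" by blast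
  next
    fix x assume "x \<in> {x. \<exists>z. x(w := z) \<in> {x. \<exists>y. (\<forall>v. v \<notin> W \<longrightarrow> y v = x v) \<and> y \<in> S}}"
    then obtain z y where y: "\<forall>v. v \<notin> W \<longrightarrow> y v = (x(w := z)) v" "y \<in> S" by blast
    then have "\<forall>v. v \<notin> insert w W \<longrightarrow> y v = x v" by auto
    with y show "x \<in> {x. \<exists>y. (\<forall>v. v \<notin> insert w W \<longrightarrow> y v = x v) \<and> y \<in> S}" by blast
  qed
  then show ?case using constr_ex[OF insert.IH, of w] by simp
qed

section \<open>Algebraic independence\<close>

definition algindep :: "('b \<Rightarrow> 'x \<Rightarrow> 'a::comm_ring_1) \<Rightarrow> 'b set \<Rightarrow> bool" where
  "algindep F B \<longleftrightarrow> (\<forall>P\<in>pfun B. (\<forall>x. P (\<lambda>b. F b x) = 0) \<longrightarrow> (\<forall>y. P y = 0))"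

text \<open>The leading coefficient is nonzero as a polynomial in free arguments. That it stays
  nonzero after substituting \<open>F\<close> depends on algebraic independence of \<open>F\<close>
  on \<open>B\<close>, which is assumed where it matters.\<close>

definition alg_rel :: "('b \<Rightarrow> 'x \<Rightarrow> 'a::comm_ring_1) \<Rightarrow> 'b set \<Rightarrow> ('x \<Rightarrow> 'a) \<Rightarrow> nat \<Rightarrow>
    (nat \<Rightarrow> ('b \<Rightarrow> 'a) \<Rightarrow> 'a) \<Rightarrow> bool" where
  "alg_rel F B g D c \<longleftrightarrow> (\<forall>k. c k \<in> pfun B) \<and> (\<exists>y. c D y \<noteq> 0) \<and>
     (\<forall>x. (\<Sum>k\<le>D. c k (\<lambda>b. F b x) * g x ^ k) = 0)"

definition alg_over :: "('b \<Rightarrow> 'x \<Rightarrow> 'a::comm_ring_1) \<Rightarrow> 'b set \<Rightarrow> ('x \<Rightarrow> 'a) \<Rightarrow> bool" where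
  "alg_over F B g \<longleftrightarrow> (\<exists>D c. alg_rel F B g D c)"

lemma algindepD:
  "algindep F B \<Longrightarrow> P \<in> pfun B \<Longrightarrow> (\<And>x. P (\<lambda>b. F b x) = 0) \<Longrightarrow> P y = 0"
  unfolding algindep_def by simp

lemma algebraicI: "alg_rel F B g D c \<Longrightarrow> alg_over F B g"
  unfolding alg_over_def by (rule exI, rule exI)

lemma algindep_nonzero:
  assumes "algindep F B" "P \<in> pfun B" "P y \<noteq> 0"
  shows "\<exists>x. P (\<lambda>b. F b x) \<noteq> 0"
  using assms unfolding algindep_def by blast

lemma algindep_subset: "algindep F B \<Longrightarrow> A \<subseteq> B \<Longrightarrow> algindep F A"
  unfolding algindep_def using pfun_mono by blast

lemma algebraic_insert:
  assumes "\<not> algindep F (insert b B)" "b \<notin> B"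
  shows "alg_over F B (F b)"
proof -
  obtain P y where P: "P \<in> pfun (insert b B)" "\<And>x. P (\<lambda>b. F b x) = 0" "P y \<noteq> 0"
    using assms(1) unfolding algindep_def by blast
  from pfun_expand[OF P(1), of b] assms(2) obtain m c where
    c: "\<And>k. c k \<in> pfun B" "\<And>x z. P (x(b := z)) = (\<Sum>k<m. c k x * z ^ k)" by auto
  have Px: "P x = (\<Sum>k<m. c k x * x b ^ k)" for x
    using c(2)[of x "x b"] by simp
  define K where "K = {k. k < m \<and> (\<exists>y. c k y \<noteq> 0)}"
  have "K \<noteq> {}"
  proof
    assume "K = {}"
    then have "\<forall>k<m. c k y = 0" by (auto simp: K_def)
    with Px[of y] P(3) show False by simp
  qed
  moreover have "finite K" by (simp add: K_def)
  ultimately have D: "Max K \<in> K" "\<And>k. k \<in> K \<Longrightarrow> k \<le> Max K" by auto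
  have KD: "\<exists>y. c k y \<noteq> 0" if "k \<in> K" for k using that by (simp add: K_def)
  note KD = KD[OF D(1)]
  have "(\<Sum>k\<le>Max K. c k (\<lambda>b. F b x) * F b x ^ k) = 0" for x
  proof -
    have "(\<Sum>k\<le>Max K. c k (\<lambda>b. F b x) * F b x ^ k) = (\<Sum>k<m. c k (\<lambda>b. F b x) * F b x ^ k)"
    proof (rule sum.mono_neutral_left)
      show "{..Max K} \<subseteq> {..<m}" using D(1) by (auto simp: K_def)
      show "\<forall>i\<in>{..<m} - {..Max K}. c i (\<lambda>b. F b x) * F b x ^ i = 0"
      proof
        fix i assume i: "i \<in> {..<m} - {..Max K}"
        then have "i \<notin> K" using D(2) by auto
        with i have "c i (\<lambda>b. F b x) = 0" by (auto simp: K_def)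
        then show "c i (\<lambda>b. F b x) * F b x ^ i = 0" by simp
      qed
    qed simp
    also have "\<dots> = 0" using Px[of "\<lambda>b. F b x"] P(2)[of x] by simp
    finally show ?thesis .
  qed
  then have "alg_rel F B (F b) (Max K) c"
    unfolding alg_rel_def
    using c(1) KD by (intro conjI allI)
  then show ?thesis by (rule algebraicI)
qed

lemma algebraic_member:
  fixes F :: "'b \<Rightarrow> 'x \<Rightarrow> 'a::comm_ring_1"
  assumes "b \<in> B" shows "alg_over F B (F b)"
proof -
  define c where "c k = (if k = 0 then (\<lambda>y :: 'b \<Rightarrow> 'a. - y b) else (\<lambda>y. 1))" for k :: nat
  have "alg_rel F B (F b) 1 c"
    unfolding alg_rel_def c_def using assms by (auto intro: pfun.intros pfun_uminus)
  then show ?thesis by (rule algebraicI)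
qed

text \<open>A transcendence basis among the given functions, taken as an independent set maximal
  under inclusion; by maximality every other function becomes dependent when adjoined, hence
  algebraic.\<close>

lemma algindep_extend:
  assumes "finite S" "B \<subseteq> S" "algindep F B"
  shows "\<exists>B'. B \<subseteq> B' \<and> B' \<subseteq> S \<and> algindep F B' \<and> (\<forall>s\<in>S. alg_over F B' (F s))"
proof -
  define X where "X = {B'. B \<subseteq> B' \<and> B' \<subseteq> S \<and> algindep F B'}"
  have "finite X" "B \<in> X" using assms by (auto simp: X_def)
  from finite_has_maximal2[OF this] obtain M where M: "M \<in> X" and "\<forall>M'\<in>X. M \<subseteq> M' \<longrightarrow> M = M'"
    by (elim bexE conjE) (rule that)
  then have max: "M' \<in> X \<Longrightarrow> M \<subseteq> M' \<Longrightarrow> M = M'" for M' by simp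
  have "alg_over F M (F s)" if "s \<in> S" for s
  proof (cases "s \<in> M")
    case False
    have "\<not> algindep F (insert s M)" (is ?n)
      using max[of "insert s M"] M that False by (auto simp: X_def)
    then show ?thesis using False by (rule algebraic_insert)
  qed (rule algebraic_member)
  then show ?thesis using M by (auto simp: X_def)
qed

lemma algindep_empty: "algindep (F :: 'b \<Rightarrow> 'x \<Rightarrow> 'a::comm_ring_1) {}"
  unfolding algindep_def
proof (intro ballI impI allI)
  fix P :: "('b \<Rightarrow> 'a) \<Rightarrow> 'a" and y assume "P \<in> pfun {}" "\<forall>x. P (\<lambda>b. F b x) = 0"
  then show "P y = 0" using pfun_cong[of P "{}" y "\<lambda>b. F b undefined"] by auto
qed

section \<open>Transcendence degree is at most the number of variables\<close>

lemma mon_comp_span: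
  fixes F :: "'b \<Rightarrow> ('v \<Rightarrow> 'a::field) \<Rightarrow> 'a"
  assumes "finite B" "\<And>b. b \<in> B \<Longrightarrow> F b \<in> fs.span (mon V ` (V \<rightarrow>\<^sub>E {..d}))" "\<And>b. b \<in> B \<Longrightarrow> \<alpha> b \<le> k"
  shows "(\<lambda>x. mon B \<alpha> (\<lambda>b. F b x)) \<in> fs.span (mon V ` (V \<rightarrow>\<^sub>E {..d * k * card B}))"
proof -
  have one: "(\<lambda>x. 1) \<in> fs.span (mon V ` (V \<rightarrow>\<^sub>E {..0}) :: (('v \<Rightarrow> 'a) \<Rightarrow> 'a) set)"
  proof -
    have "mon V (\<lambda>v\<in>V. 0) = (\<lambda>x. 1::'a)" by (simp add: mon_def fun_eq_iff)
    moreover have "(mon V (\<lambda>v\<in>V. 0) :: ('v \<Rightarrow> 'a) \<Rightarrow> 'a) \<in> fs.span (mon V ` (V \<rightarrow>\<^sub>E {..0}))"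
      by (intro fs.span_base imageI) auto
    ultimately show ?thesis by (simp only:)
  qed
  have pow: "(\<lambda>x. F b x ^ j) \<in> fs.span (mon V ` (V \<rightarrow>\<^sub>E {..d * j}))" if "b \<in> B" for b j
  proof (induction j)
    case (Suc j)
    from span_mon_mult[OF assms(2)[OF that] this] show ?case by simp
  qed (simp only: power_0 mult_0_right one)
  have "(\<lambda>x. \<Prod>b\<in>A. F b x ^ \<alpha> b) \<in> fs.span (mon V ` (V \<rightarrow>\<^sub>E {..d * k * card A}))" if "A \<subseteq> B" for A
    using finite_subset[OF that assms(1)] that
  proof (induction A)
    case (insert b A)
    have "(\<lambda>x. F b x ^ \<alpha> b) \<in> fs.span (mon V ` (V \<rightarrow>\<^sub>E {..d * k}))"
      using insert.prems assms(3) by (intro span_mon_mono[OF pow]) auto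
    from span_mon_mult[OF this insert.IH] insert show ?case by (simp add: algebra_simps)
  qed (simp only: prod.empty card.empty mult_0_right one)
  from this[of B] show ?thesis unfolding mon_def by simp
qed

lemma power_dominates: "\<exists>k::nat. (d * k * m + 1) ^ n < (k + 1) ^ Suc n"
proof
  \<comment> \<open>This \<open>k\<close> absorbs the constant factor \<open>(d * m + 1) ^ n\<close>
    and leaves \<open>k * (k + 1) ^ n\<close>.\<close>
  define k where "k = (d * m + 1) ^ n"
  have "(d * k * m + 1) ^ n \<le> ((d * m + 1) * (k + 1)) ^ n"
    by (rule power_mono) (auto simp: algebra_simps)
  also have "\<dots> = k * (k + 1) ^ n"
    by (simp only: power_mult_distrib k_def[symmetric])
  also have "\<dots> < (k + 1) * (k + 1) ^ n" by simp
  finally show "(d * k * m + 1) ^ n < (k + 1) ^ Suc n" by simp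
qed

text \<open>There are \<open>(k + 1) ^ card B\<close> monomials of degree at most \<open>k\<close>
  in each of the functions, but they lie in a space of dimension at most
  \<open>(d * k * card B + 1) ^ card V\<close>. For large \<open>k\<close> the smaller exponent
  loses, and by independence of monomials the resulting linear relation is a nonzero
  polynomial.\<close>

lemma not_algindep_card:
  fixes F :: "'b \<Rightarrow> ('v \<Rightarrow> 'a::field_char_0) \<Rightarrow> 'a"
  assumes "finite V" "finite B" "card V < card B" "\<And>b. b \<in> B \<Longrightarrow> F b \<in> pfun V"
  shows "\<not> algindep F B"
proof
  assume ind: "algindep F B"
  from assms(4) have "\<forall>b\<in>B. \<exists>d. F b \<in> fs.span (mon V ` (V \<rightarrow>\<^sub>E {..d}))"
    using pfun_monomials[OF _ assms(1)] by blast
  then obtain D where D: "\<And>b. b \<in> B \<Longrightarrow> F b \<in> fs.span (mon V ` (V \<rightarrow>\<^sub>E {..D b}))" by metis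
  define d where "d = (\<Sum>b\<in>B. D b)"
  have d: "F b \<in> fs.span (mon V ` (V \<rightarrow>\<^sub>E {..d}))" if "b \<in> B" for b
    using span_mon_mono[OF D[OF that]] that assms(2) by (simp add: d_def member_le_sum)
  obtain k where k: "(d * k * card B + 1) ^ card V < (k + 1) ^ Suc (card V)"
    using power_dominates by blast
  define I where "I = B \<rightarrow>\<^sub>E {..k}"
  define T :: "(('v \<Rightarrow> 'a) \<Rightarrow> 'a) set" where "T = mon V ` (V \<rightarrow>\<^sub>E {..d * k * card B})"
  have fin: "finite I" "finite T" using assms by (auto simp: I_def T_def intro: finite_PiE)
  have "card T \<le> card (V \<rightarrow>\<^sub>E {..d * k * card B})"
    unfolding T_def by (rule card_image_le) (use assms in \<open>auto intro: finite_PiE\<close>)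
  also have "\<dots> = (d * k * card B + 1) ^ card V" using assms by (simp add: card_funcsetE)
  also have "\<dots> < (k + 1) ^ Suc (card V)" by (rule k)
  also have "\<dots> \<le> (k + 1) ^ card B" using assms(3) by (intro power_increasing) auto
  also have "\<dots> = card I" using assms by (simp add: I_def card_funcsetE)
  finally have "card T < card I" .
  moreover have "(\<lambda>x. mon B \<alpha> (\<lambda>b. F b x)) \<in> fs.span T" if "\<alpha> \<in> I" for \<alpha>
    unfolding T_def by (rule mon_comp_span) (use that d assms in \<open>auto simp: I_def\<close>)
  ultimately obtain \<kappa> where \<kappa>: "\<exists>\<alpha>\<in>I. \<kappa> \<alpha> \<noteq> 0" "\<And>x. (\<Sum>\<alpha>\<in>I. \<kappa> \<alpha> * mon B \<alpha> (\<lambda>b. F b x)) = 0"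
    using family_relation[OF fin, of "\<lambda>\<alpha> x. mon B \<alpha> (\<lambda>b. F b x)"] by auto
  define P where "P y = (\<Sum>\<alpha>\<in>I. \<kappa> \<alpha> * mon B \<alpha> y)" for y
  have "P \<in> pfun B" unfolding P_def by (intro pfun_sum pfun.mult pfun.const mon_pfun)
  then have "P y = 0" for y
    by (rule algindepD[OF ind]) (simp add: P_def \<kappa>(2))
  then have z: "(\<Sum>\<alpha>\<in>I. \<kappa> \<alpha> * mon B \<alpha> y) = 0" for y unfolding P_def .
  have "\<alpha> = \<beta>" if "\<alpha> \<in> I" "\<beta> \<in> I" "\<forall>b\<in>B. \<alpha> b = \<beta> b" for \<alpha> \<beta>
    using that unfolding I_def by (auto intro: PiE_ext)
  from mon_indep[OF assms(2) fin(1) this z] have "\<forall>\<alpha>\<in>I. \<kappa> \<alpha> = 0" .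
  with \<kappa>(1) show False by blast
qed

lemma algindep_card_le:
  fixes F :: "'b \<Rightarrow> ('v \<Rightarrow> 'a::field_char_0) \<Rightarrow> 'a"
  assumes "finite V" "algindep F B" "finite B" "\<And>b. b \<in> B \<Longrightarrow> F b \<in> pfun V"
  shows "card B \<le> card V"
  using not_algindep_card[of V B F] assms by force

text \<open>Adjoining \<open>g\<close> under the new index \<open>None\<close> makes more functions
  than variables, so the enlarged family is dependent; the relation over the tagged indices is then
  renamed to one over \<open>B\<close>.\<close>

lemma algebraic_of_card:
  fixes F :: "'b \<Rightarrow> ('v \<Rightarrow> 'a::field_char_0) \<Rightarrow> 'a"
  assumes "finite V" "algindep F B" "finite B" "\<And>b. b \<in> B \<Longrightarrow> F b \<in> pfun V" "card B = card V" "g \<in> pfun V"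
  shows "alg_over F B g"
proof -
  define F' where "F' = case_option g F"
  have "card (insert None (Some ` B)) = Suc (card B)"
    using assms by (subst card_insert_disjoint) (auto simp: card_image)
  then have "\<not> algindep F' (insert None (Some ` B))"
    by (intro not_algindep_card[OF assms(1)]) (use assms in \<open>auto simp: F'_def\<close>)
  then have "alg_over F' (Some ` B) (F' None)" by (rule algebraic_insert) auto
  then obtain D c where c: "\<And>k. c k \<in> pfun (Some ` B)" "\<exists>y. c D y \<noteq> 0"
    "\<And>x. (\<Sum>k\<le>D. c k (\<lambda>b. F' b x) * F' None x ^ k) = 0"
    unfolding alg_over_def alg_rel_def by blast
  define c' where "c' k y = c k (case_option 0 y)" for k y
  have "c' k \<in> pfun B" for k
    unfolding c'_def by (rule pfun_subst[OF c(1)]) (auto intro: pfun.var)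
  moreover have "c k y = c' k (\<lambda>b. y (Some b))" for k y
    unfolding c'_def by (rule pfun_cong[OF c(1)]) auto
  ultimately have "alg_rel F B g D c'"
    unfolding alg_rel_def using c(2,3) by (auto simp: F'_def)
  then show ?thesis by (rule algebraicI)
qed

text \<open>On a fibre of \<open>F\<close> the coefficients of the relation are constants, so the
  values of \<open>g\<close> are roots of one fixed polynomial, which is nonzero wherever the
  leading coefficient \<open>h\<close> is.\<close>

lemma algebraic_finite_values:
  fixes F :: "'b \<Rightarrow> 'x \<Rightarrow> 'a::{idom}"
  assumes "alg_over F B g"
  shows "\<exists>h\<in>pfun B. (\<exists>y. h y \<noteq> 0) \<and>
    (\<forall>x. h (\<lambda>b. F b x) \<noteq> 0 \<longrightarrow> finite (g ` {x'. \<forall>b\<in>B. F b x' = F b x}))"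
proof -
  obtain D c where c: "\<And>k. c k \<in> pfun B" "\<exists>y. c D y \<noteq> 0"
    "\<And>x. (\<Sum>k\<le>D. c k (\<lambda>b. F b x) * g x ^ k) = 0"
    using assms unfolding alg_over_def alg_rel_def by blast
  have "finite (g ` {x'. \<forall>b\<in>B. F b x' = F b x})" if "c D (\<lambda>b. F b x) \<noteq> 0" for x
  proof -
    define q where "q = (\<Sum>k\<le>D. monom (c k (\<lambda>b. F b x)) k)"
    have "coeff q D \<noteq> 0" using that by (simp add: q_def coeff_sum sum.delta)
    then have "q \<noteq> 0" by auto
    moreover have "poly q (g x') = 0" if "\<forall>b\<in>B. F b x' = F b x" for x'
    proof -
      have "c k (\<lambda>b. F b x') = c k (\<lambda>b. F b x)" for k
        by (rule pfun_cong[OF c(1)]) (use that in auto)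
      then show ?thesis using c(3)[of x'] by (simp add: q_def poly_sum poly_monom)
    qed
    ultimately show ?thesis
      by (intro finite_subset[OF _ poly_roots_finite[of q]]) auto
  qed
  then show ?thesis using c(2) by (intro bexI[OF _ c(1)[of D]] conjI allI impI)
qed

lemma minimal_alg_rel:
  assumes "alg_over F B g"
  shows "\<exists>D c. alg_rel F B g D c \<and> (\<forall>D' c'. D' < D \<longrightarrow> \<not> alg_rel F B g D' c')"
proof -
  define D where "D = (LEAST D. \<exists>c. alg_rel F B g D c)"
  have "\<exists>c. alg_rel F B g D c" using assms unfolding alg_over_def D_def by (rule LeastI_ex)
  moreover have "\<not> (\<exists>c. alg_rel F B g D' c)" if "D' < D" for D'
    using not_less_Least[OF that[unfolded D_def]] .
  ultimately show ?thesis by blast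
qed

text \<open>In a relation of least degree the derivative with respect to \<open>g\<close> cannot
  vanish identically, as it would be a relation of smaller degree; characteristic 0 keeps its
  leading coefficient nonzero. Degree 0 is excluded by independence.\<close>

lemma algebraic_separable:
  fixes F :: "'b \<Rightarrow> 'x \<Rightarrow> 'a::field_char_0"
  assumes "alg_over F B g" "algindep F B"
  shows "\<exists>D c. alg_rel F B g D c \<and> (\<exists>x. (\<Sum>k<D. of_nat (Suc k) * c (Suc k) (\<lambda>b. F b x) * g x ^ k) \<noteq> 0)"
proof -
  obtain D c where c: "alg_rel F B g D c" and min: "\<And>D' c'. D' < D \<Longrightarrow> \<not> alg_rel F B g D' c'"
    using minimal_alg_rel[OF assms(1)] by blast
  have "\<exists>x. (\<Sum>k<D. of_nat (Suc k) * c (Suc k) (\<lambda>b. F b x) * g x ^ k) \<noteq> 0"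
  proof (rule ccontr)
    assume n: "\<not> ?thesis"
    show False
    proof (cases D)
      case 0
      then have "\<And>x. c 0 (\<lambda>b. F b x) = 0" "c 0 \<in> pfun B" and y: "\<exists>y. c 0 y \<noteq> 0"
        using c unfolding alg_rel_def by auto
      with algindepD[OF assms(2), of "c 0"] have "c 0 y = 0" for y by simp
      with y show False by simp
    next
      case (Suc E)
      define c' where "c' k y = of_nat (Suc k) * c (Suc k) y" for k y
      obtain y where y: "c D y \<noteq> 0" using c unfolding alg_rel_def by blast
      have "c' E y \<noteq> 0" using y Suc by (simp add: c'_def del: of_nat_Suc)
      moreover have "c' k \<in> pfun B" for k
        unfolding c'_def using c unfolding alg_rel_def by (auto intro: pfun.intros)
      moreover have "(\<Sum>k\<le>E. c' k (\<lambda>b. F b x) * g x ^ k) = 0" for x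
        using n Suc by (simp add: c'_def lessThan_Suc_atMost del: of_nat_Suc)
      ultimately have "alg_rel F B g E c'" unfolding alg_rel_def by (intro conjI allI exI)
      with min[of E] Suc show False by blast
    qed
  qed
  with c show ?thesis by blast
qed

text \<open>In a relation of least degree the constant coefficient is nonzero, as otherwise a factor
  \<open>g\<close> could be cancelled. Where \<open>g\<close> vanishes only this coefficient is
  left, so \<open>F\<close> sends the hypersurface \<open>g = 0\<close> into the hypersurface
  \<open>P = 0\<close>.\<close>

lemma algebraic_const_coeff:
  fixes F :: "'b \<Rightarrow> ('v \<Rightarrow> 'a::field_char_0) \<Rightarrow> 'a"
  assumes "alg_over F B g" "\<And>b. b \<in> B \<Longrightarrow> F b \<in> pfun V" "g \<in> pfun V" "g x0 \<noteq> 0"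
  shows "\<exists>P\<in>pfun B. (\<exists>y. P y \<noteq> 0) \<and> (\<forall>x. g x = 0 \<longrightarrow> P (\<lambda>b. F b x) = 0)"
proof -
  obtain D c where c: "alg_rel F B g D c" and min: "\<And>D' c'. D' < D \<Longrightarrow> \<not> alg_rel F B g D' c'"
    using minimal_alg_rel[OF assms(1)] by blast
  have cp: "c k \<in> pfun B" for k using c unfolding alg_rel_def by blast
  have rel: "(\<Sum>k\<le>D. c k (\<lambda>b. F b x) * g x ^ k) = 0" for x using c unfolding alg_rel_def by blast
  have "\<exists>y. c 0 y \<noteq> 0"
  proof (rule ccontr)
    assume n: "\<not> ?thesis"
    then obtain E where E: "D = Suc E" using c unfolding alg_rel_def by (cases D) auto
    define S where "S x = (\<Sum>k\<le>E. c (Suc k) (\<lambda>b. F b x) * g x ^ k)" for x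
    have "S \<in> pfun V" unfolding S_def
      by (intro pfun_sum pfun.mult pfun_power assms(3) pfun_subst[OF cp]) (auto intro: assms)
    moreover have "g x * S x = 0" for x
      using rel[of x] n unfolding E sum.atMost_Suc_shift
      by (simp add: S_def sum_distrib_left mult_ac)
    ultimately have "S x = 0" for x
      using pfun_two_nonzero[OF assms(3), of S x0 x] assms(4) by (metis mult_eq_0_iff)
    then have "alg_rel F B g E (\<lambda>k. c (Suc k))"
      using c cp unfolding alg_rel_def E S_def by blast
    with min E show False by blast
  qed
  moreover have "c 0 (\<lambda>b. F b x) = 0" if "g x = 0" for x
  proof -
    have "(\<Sum>k\<le>D. c k (\<lambda>b. F b x) * g x ^ k) = (\<Sum>k\<in>{0}. c k (\<lambda>b. F b x) * g x ^ k)"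
      by (rule sum.mono_neutral_right) (use that in \<open>auto simp: power_0_left\<close>)
    then show ?thesis using rel[of x] by simp
  qed
  ultimately show ?thesis using cp by blast
qed

section \<open>Jacobians and an algebraic form of Sard's theorem\<close>

abbreviation dzero :: "('v \<Rightarrow> 'a::real_normed_field) \<Rightarrow> ('v \<Rightarrow> 'a) \<Rightarrow> (('v \<Rightarrow> 'a) \<Rightarrow> 'a) \<Rightarrow> bool" where
  "dzero z w f \<equiv> ((\<lambda>t. f (\<lambda>v. z v + t * w v)) has_field_derivative 0) (at 0)"

text \<open>If no \<open>F b\<close> changes to first order along \<open>w\<close>, differentiating
  the algebraic relation of the coordinate \<open>x v\<close> leaves \<open>w v\<close> times its
  derivative in that coordinate. Separable relations make this factor a nonzero polynomial, and
  \<open>h\<close> is the product of these factors.\<close>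

lemma jacobian_kernel_trivial:
  fixes F :: "'b \<Rightarrow> ('v \<Rightarrow> 'a::{real_normed_field}) \<Rightarrow> 'a"
  assumes "finite V" "algindep F B" "\<And>b. b \<in> B \<Longrightarrow> F b \<in> pfun V"
    and "\<And>v. v \<in> V \<Longrightarrow> alg_over F B (\<lambda>x. x v)"
  shows "\<exists>h\<in>pfun V. (\<exists>x. h x \<noteq> 0) \<and>
    (\<forall>z w. h z \<noteq> 0 \<longrightarrow> (\<forall>b\<in>B. dzero z w (F b)) \<longrightarrow> (\<forall>v\<in>V. w v = 0))"
proof -
  define Q where "Q v D c \<longleftrightarrow> alg_rel F B (\<lambda>x. x v) D c \<and>
     (\<exists>x. (\<Sum>k<D. of_nat (Suc k) * c (Suc k) (\<lambda>b. F b x) * x v ^ k) \<noteq> 0)" for v D c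
  have "\<forall>v\<in>V. \<exists>D c. Q v D c"
    unfolding Q_def using algebraic_separable[OF assms(4) assms(2)] by simp
  then obtain D c where "\<forall>v\<in>V. Q v (D v) (c v)"
    unfolding bchoice_iff by (elim exE)
  then have Dc: "alg_rel F B (\<lambda>x. x v) (D v) (c v)"
    "\<exists>x. (\<Sum>k<D v. of_nat (Suc k) * c v (Suc k) (\<lambda>b. F b x) * x v ^ k) \<noteq> 0" if "v \<in> V" for v
    using that by (simp_all add: Q_def)
  define g where "g v x = (\<Sum>k<D v. of_nat (Suc k) * c v (Suc k) (\<lambda>b. F b x) * x v ^ k)" for v x
  define h where "h x = (\<Prod>v\<in>V. g v x)" for x
  have cp: "c v k \<in> pfun B" if "v \<in> V" for v k using Dc(1)[OF that] unfolding alg_rel_def by blast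
  have gp: "g v \<in> pfun V" if "v \<in> V" for v
    unfolding g_def
    by (intro pfun_sum pfun.mult pfun.const pfun_power pfun.var that pfun_subst[OF cp[OF that]]) (auto intro: assms)
  have "h \<in> pfun V" unfolding h_def by (intro pfun_prod gp)
  moreover have "\<exists>x. h x \<noteq> 0" unfolding h_def
    by (rule pfun_prod_nonzero[OF assms(1) gp]) (use Dc(2) in \<open>auto simp: g_def\<close>)
  moreover have "w v = 0" if hz: "h z \<noteq> 0" and d: "\<forall>b\<in>B. dzero z w (F b)" and v: "v \<in> V" for z w v
  proof -
    have gz: "g v z \<noteq> 0" using hz v assms(1) by (auto simp: h_def)
    have "((\<lambda>t. \<Sum>k\<le>D v. c v k (\<lambda>b. F b (\<lambda>v. z v + t * w v)) * (z v + t * w v) ^ k) has_field_derivative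
        (\<Sum>k\<le>D v. 0 * (z v + 0 * w v) ^ k + of_nat k * (z v + 0 * w v) ^ (k - 1) * w v * c v k (\<lambda>b. F b (\<lambda>v. z v + 0 * w v)))) (at 0)"
    proof (intro DERIV_sum DERIV_mult)
      fix k
      show "((\<lambda>t. c v k (\<lambda>b. F b (\<lambda>v. z v + t * w v))) has_field_derivative 0) (at 0)"
        by (rule pfun_deriv_zero[OF cp[OF v]]) (use d in auto)
      show "((\<lambda>t. (z v + t * w v) ^ k) has_field_derivative of_nat k * (z v + 0 * w v) ^ (k - 1) * w v) (at 0)"
        by (auto intro!: derivative_eq_intros)
    qed
    moreover have "(\<lambda>t. \<Sum>k\<le>D v. c v k (\<lambda>b. F b (\<lambda>v. z v + t * w v)) * (z v + t * w v) ^ k) = (\<lambda>t. 0)"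
      using Dc(1)[OF v] unfolding alg_rel_def by (auto simp: fun_eq_iff)
    ultimately have "(\<Sum>k\<le>D v. of_nat k * z v ^ (k - 1) * w v * c v k (\<lambda>b. F b z)) = 0"
      using DERIV_unique[OF _ DERIV_const] by fastforce
    moreover have "(\<Sum>k\<le>D v. of_nat k * z v ^ (k - 1) * w v * c v k (\<lambda>b. F b z)) = w v * g v z"
      unfolding g_def
    proof (cases "D v")
      case (Suc E)
      show "(\<Sum>k\<le>D v. of_nat k * z v ^ (k - 1) * w v * c v k (\<lambda>b. F b z)) =
        w v * (\<Sum>k<D v. of_nat (Suc k) * c v (Suc k) (\<lambda>b. F b z) * z v ^ k)"
        unfolding Suc sum.atMost_Suc_shift sum_distrib_left lessThan_Suc_atMost
        by (simp del: of_nat_Suc) (intro sum.cong refl, simp add: mult_ac del: of_nat_Suc)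
    qed simp
    ultimately show ?thesis using gz by simp
  qed
  ultimately show ?thesis by blast
qed

text \<open>Degenerate points lie on a hypersurface \<open>h = 0\<close>, whose image is contained
  in \<open>P = 0\<close>. As \<open>P\<close> is tested at the value of the map, it clears all
  points of a fibre at once.\<close>

lemma algebraic_sard:
  fixes F :: "'b \<Rightarrow> ('v \<Rightarrow> 'a::{real_normed_field}) \<Rightarrow> 'a"
  assumes "finite V" "algindep F B" "finite B" "\<And>b. b \<in> B \<Longrightarrow> F b \<in> pfun V" "card B = card V"
  shows "\<exists>P\<in>pfun B. (\<exists>y. P y \<noteq> 0) \<and>
    (\<forall>z w. P (\<lambda>b. F b z) \<noteq> 0 \<longrightarrow> (\<forall>b\<in>B. dzero z w (F b)) \<longrightarrow> (\<forall>v\<in>V. w v = 0))"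
proof -
  have "alg_over F B (\<lambda>x. x v)" if "v \<in> V" for v
    by (rule algebraic_of_card[OF assms]) (use that in \<open>auto intro: pfun.var\<close>)
  then obtain h x0 where h: "h \<in> pfun V" "h x0 \<noteq> 0"
    "\<forall>z w. h z \<noteq> 0 \<longrightarrow> (\<forall>b\<in>B. dzero z w (F b)) \<longrightarrow> (\<forall>v\<in>V. w v = 0)"
    using jacobian_kernel_trivial[OF assms(1,2,4)] by blast
  obtain P where P: "P \<in> pfun B" "\<exists>y. P y \<noteq> 0" "\<forall>x. h x = 0 \<longrightarrow> P (\<lambda>b. F b x) = 0"
    using algebraic_const_coeff[OF algebraic_of_card[OF assms h(1)] assms(4) h(1,2)] by blast
  show ?thesis using P h(3) by blast
qed

section \<open>Flexes of real frameworks\<close>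

text \<open>Banach's fixed point theorem with a parameter \<open>t\<close>, in the sup norm on
  \<open>B\<close>. The contraction factor 1/2 and the bound \<open>r / 2\<close> at the origin keep
  all iterates within \<open>r\<close>, and convergence uniform in \<open>t\<close> makes the fixed
  point continuous in \<open>t\<close>.\<close>

lemma contraction_path:
  fixes G :: "real \<Rightarrow> ('b \<Rightarrow> real) \<Rightarrow> 'b \<Rightarrow> real"
  assumes finB: "finite B" and r: "r > 0"
    and G0: "\<And>t b. t \<in> T \<Longrightarrow> b \<in> B \<Longrightarrow> \<bar>G t (\<lambda>_. 0) b\<bar> \<le> r / 2"
    and Lip: "\<And>t s s' \<eta> b. t \<in> T \<Longrightarrow> b \<in> B \<Longrightarrow> \<forall>b\<in>B. \<bar>s b\<bar> \<le> r \<Longrightarrow> \<forall>b\<in>B. \<bar>s' b\<bar> \<le> r \<Longrightarrow>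
      \<forall>b\<in>B. \<bar>s b - s' b\<bar> \<le> \<eta> \<Longrightarrow> \<bar>G t s b - G t s' b\<bar> \<le> \<eta> / 2"
    and cont: "\<And>s b. b \<in> B \<Longrightarrow> (\<And>b. b \<in> B \<Longrightarrow> continuous_on T (\<lambda>t. s t b)) \<Longrightarrow>
      continuous_on T (\<lambda>t. G t (s t) b)"
  shows "\<exists>s. (\<forall>b\<in>B. continuous_on T (\<lambda>t. s t b)) \<and> (\<forall>t\<in>T. \<forall>b\<in>B. s t b = G t (s t) b \<and> \<bar>s t b\<bar> \<le> r)"
proof -
  define S where "S n t = ((G t) ^^ n) (\<lambda>_. 0)" for n t
  have S0: "S 0 t b = 0" for t b by (simp add: S_def)
  have SS: "S (Suc n) t = G t (S n t)" for n t by (simp add: S_def)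
  have bd: "(\<forall>b\<in>B. \<bar>S n t b\<bar> \<le> r * (1 - (1/2)^n)) \<and> (\<forall>b\<in>B. \<bar>S (Suc n) t b - S n t b\<bar> \<le> (r/2) * (1/2)^n)"
    if t: "t \<in> T" for n t
  proof (induction n)
    case 0
    have "S 0 t = (\<lambda>_. 0)" by (simp add: S_def)
    then have "S (Suc 0) t b - S 0 t b = G t (\<lambda>_. 0) b" for b by (simp add: SS)
    then show ?case using G0[OF t] by (simp add: S0)
  next
    case (Suc n)
    have a: "\<bar>S (Suc n) t b\<bar> \<le> r * (1 - (1/2)^Suc n)" if "b \<in> B" for b
    proof -
      have "\<bar>S (Suc n) t b\<bar> \<le> \<bar>S n t b\<bar> + \<bar>S (Suc n) t b - S n t b\<bar>" by linarith
      also have "\<dots> \<le> r * (1 - (1/2)^n) + (r/2) * (1/2)^n" using Suc that by (intro add_mono) auto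
      also have "\<dots> = r * (1 - (1/2)^Suc n)" by (simp add: field_simps)
      finally show ?thesis .
    qed
    have le: "r * (1 - (1/2)^m) \<le> r" for m :: nat using r by (simp add: mult_left_le)
    have "\<bar>S (Suc (Suc n)) t b - S (Suc n) t b\<bar> \<le> (r/2) * (1/2)^n / 2" if "b \<in> B" for b
      unfolding SS[of "Suc n"] SS[of n]
    proof (rule Lip[OF t that])
      show "\<forall>b\<in>B. \<bar>G t (S n t) b\<bar> \<le> r" using a le order_trans unfolding SS[symmetric] by blast
      show "\<forall>b\<in>B. \<bar>S n t b\<bar> \<le> r" using Suc le order_trans by blast
      show "\<forall>b\<in>B. \<bar>G t (S n t) b - S n t b\<bar> \<le> (r/2) * (1/2)^n" using Suc unfolding SS[symmetric] by simp
    qed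
    with a show ?case by simp
  qed
  \<comment> \<open>The limit of the iterates is written as the telescoping series of their
    increments, so that the Weierstrass test applies.\<close>
  define s where "s t b = (\<Sum>i. S (Suc i) t b - S i t b)" for t b
  have ul: "uniform_limit T (\<lambda>n t. S n t b) (\<lambda>t. s t b) sequentially" if "b \<in> B" for b
  proof -
    have "uniform_limit T (\<lambda>n t. \<Sum>i<n. S (Suc i) t b - S i t b) (\<lambda>t. \<Sum>i. S (Suc i) t b - S i t b) sequentially"
    proof (rule Weierstrass_m_test)
      show "norm (S (Suc n) t b - S n t b) \<le> (r/2) * (1/2)^n" if "t \<in> T" for n t
        using bd[OF that, of n] \<open>b \<in> B\<close> by simp
      show "summable (\<lambda>n. (r/2) * (1/2::real)^n)" by (intro summable_mult summable_geometric) simp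
    qed
    moreover have "(\<Sum>i<n. S (Suc i) t b - S i t b) = S n t b" for n t
      by (induction n) (simp_all add: S0)
    ultimately show ?thesis by (simp add: s_def)
  qed
  have lim: "(\<lambda>n. S n t b) \<longlonglongrightarrow> s t b" if "b \<in> B" "t \<in> T" for b t
    using tendsto_uniform_limitI[OF ul[OF that(1)] that(2)] .
  have contS: "continuous_on T (\<lambda>t. S n t b)" if "b \<in> B" for n b
    using that
  proof (induction n arbitrary: b)
    case (Suc n)
    then show ?case unfolding SS by (intro cont) auto
  qed (simp add: S0)
  have conts: "continuous_on T (\<lambda>t. s t b)" if "b \<in> B" for b
    by (rule uniform_limit_theorem[OF _ ul[OF that]]) (use contS[OF that] in auto)
  have sr: "\<bar>s t b\<bar> \<le> r" if "b \<in> B" "t \<in> T" for b t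
  proof -
    have "\<bar>S n t b\<bar> \<le> r" for n
    proof -
      have "r * (1 - (1/2)^n) \<le> r" using r by (simp add: mult_left_le)
      then show ?thesis using bd[OF that(2), of n] that(1) by fastforce
    qed
    then show ?thesis
      using LIMSEQ_le_const2[OF tendsto_rabs[OF lim[OF that]]] by blast
  qed
  have Sr: "\<forall>b\<in>B. \<bar>S n t b\<bar> \<le> r" if "t \<in> T" for n t
  proof
    fix b assume "b \<in> B"
    have "r * (1 - (1/2)^n) \<le> r" using r by (simp add: mult_left_le)
    then show "\<bar>S n t b\<bar> \<le> r" using bd[OF that, of n] \<open>b \<in> B\<close> by fastforce
  qed
  have fix_pt: "s t b = G t (s t) b" if b: "b \<in> B" and t: "t \<in> T" for b t
  proof -
    define \<eta> where "\<eta> n = (\<Sum>b\<in>B. \<bar>S n t b - s t b\<bar>)" for n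
    have "\<eta> \<longlonglongrightarrow> (\<Sum>b\<in>B. \<bar>s t b - s t b\<bar>)" unfolding \<eta>_def
      by (intro tendsto_sum tendsto_rabs tendsto_diff lim tendsto_const t)
    then have \<eta>0: "(\<lambda>n. \<eta> n / 2) \<longlonglongrightarrow> 0" by (auto intro: tendsto_divide_zero)
    have "\<bar>S (Suc n) t b - G t (s t) b\<bar> \<le> \<eta> n / 2" for n
      unfolding SS
    proof (rule Lip[OF t b Sr[OF t]])
      show "\<forall>b\<in>B. \<bar>s t b\<bar> \<le> r" using sr t by simp
      show "\<forall>b\<in>B. \<bar>S n t b - s t b\<bar> \<le> \<eta> n"
        unfolding \<eta>_def
      proof
        fix b assume "b \<in> B"
        then show "\<bar>S n t b - s t b\<bar> \<le> (\<Sum>b\<in>B. \<bar>S n t b - s t b\<bar>)"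
          using member_le_sum[of b B "\<lambda>b. \<bar>S n t b - s t b\<bar>"] finB by simp
      qed
    qed
    then have "(\<lambda>n. S (Suc n) t b - G t (s t) b) \<longlonglongrightarrow> 0"
      by (intro Lim_null_comparison[OF _ \<eta>0]) (simp add: eventually_sequentiallyI)
    then have "(\<lambda>n. S (Suc n) t b) \<longlonglongrightarrow> G t (s t) b" by (simp add: LIM_zero_iff)
    with LIMSEQ_Suc[OF lim[OF b t]] show ?thesis using LIMSEQ_unique by blast
  qed
  show ?thesis
    by (rule exI[of _ s]) (use conts fix_pt sr in simp)
qed

text \<open>An inverse function theorem for maps that are linear up to a remainder of quadratic
  size. With vectors \<open>W b\<close> dual to the differentials \<open>L b\<close>, prescribing
  the values of \<open>F\<close> at the point \<open>p\<close> displaced by \<open>comb s\<close>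
  means that \<open>s b\<close> equals the target minus \<open>Q b (comb s)\<close>, a contraction
  for small \<open>s\<close>. Only the value at \<open>z\<close> is made to move.\<close>

lemma quadratic_flex:
  fixes F :: "'b \<Rightarrow> ('v \<Rightarrow> real) \<Rightarrow> real"
  assumes fin: "finite V" "finite B" "card B = card V"
    and exp: "\<And>b w. b \<in> B \<Longrightarrow> F b (\<lambda>v. p v + w v) = F b p + (\<Sum>v\<in>V. w v * L b v) + Q b w"
    and Q0: "\<And>b. b \<in> B \<Longrightarrow> Q b (\<lambda>_. 0) = 0"
    and Qlip: "\<And>b w w' r \<eta>. b \<in> B \<Longrightarrow> \<forall>v\<in>V. \<bar>w v\<bar> \<le> r \<and> \<bar>w' v\<bar> \<le> r \<and> \<bar>w v - w' v\<bar> \<le> \<eta> \<Longrightarrow>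
      \<bar>Q b w - Q b w'\<bar> \<le> 16 * r * \<eta>"
    and Qcont: "\<And>b w. b \<in> B \<Longrightarrow> (\<And>v. v \<in> V \<Longrightarrow> continuous_on {0..1::real} (\<lambda>t. w t v)) \<Longrightarrow>
      continuous_on {0..1} (\<lambda>t. Q b (w t))"
    and ker: "\<And>w. \<forall>b\<in>B. (\<Sum>v\<in>V. w v * L b v) = 0 \<Longrightarrow> \<forall>v\<in>V. w v = 0"
    and z: "z \<in> B"
  shows "\<exists>\<gamma> \<delta>. \<delta> \<noteq> 0 \<and> (\<forall>v. continuous_on {0..1::real} (\<lambda>t. \<gamma> t v)) \<and> \<gamma> 0 = p \<and>
    (\<forall>t\<in>{0..1}. \<forall>b\<in>B. F b (\<gamma> t) = F b p + (if b = z then t * \<delta> else 0))"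
proof -
  have "\<forall>b\<in>B. \<exists>w. \<forall>b'\<in>B. (\<Sum>v\<in>V. w v * L b' v) = (if b' = b then 1 else 0)"
    using functionals_dual[OF fin ker] by simp
  then obtain W where W: "\<forall>b\<in>B. \<forall>b'\<in>B. (\<Sum>v\<in>V. W b v * L b' v) = (if b' = b then 1 else 0)"
    unfolding bchoice_iff by (elim exE)
  \<comment> \<open>The coordinates of \<open>comb s\<close> are at most \<open>M\<close> times the
    size of \<open>s\<close>; the summand 1 keeps \<open>M\<close> positive.\<close>
  define M where "M = 1 + (\<Sum>b\<in>B. \<Sum>v\<in>V. \<bar>W b v\<bar>)"
  have M1: "M \<ge> 1" unfolding M_def by (simp add: sum_nonneg)
  define comb where "comb s v = (\<Sum>b\<in>B. s b * W b v)" for s v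
  have comb_diff: "comb s v - comb s' v = comb (\<lambda>b. s b - s' b) v" for s s' v
    by (simp add: comb_def sum_subtractf left_diff_distrib)
  have comb_le: "\<bar>comb s v\<bar> \<le> M * \<eta>" if v: "v \<in> V" and s: "\<forall>b\<in>B. \<bar>s b\<bar> \<le> \<eta>" and "\<eta> \<ge> 0" for s v \<eta>
  proof -
    have "\<bar>comb s v\<bar> \<le> (\<Sum>b\<in>B. \<bar>s b * W b v\<bar>)" unfolding comb_def by (rule sum_abs)
    also have "\<dots> \<le> (\<Sum>b\<in>B. \<eta> * (\<Sum>v\<in>V. \<bar>W b v\<bar>))"
    proof (rule sum_mono)
      fix b assume b: "b \<in> B"
      have "\<bar>W b v\<bar> \<le> (\<Sum>v\<in>V. \<bar>W b v\<bar>)" by (rule member_le_sum) (use v fin in auto)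
      then show "\<bar>s b * W b v\<bar> \<le> \<eta> * (\<Sum>v\<in>V. \<bar>W b v\<bar>)"
        using s b that unfolding abs_mult by (intro mult_mono) auto
    qed
    also have "\<dots> = (M - 1) * \<eta>" by (simp add: M_def sum_distrib_left mult.commute)
    also have "\<dots> \<le> M * \<eta>" using that by (simp add: mult_right_mono)
    finally show ?thesis .
  qed
  \<comment> \<open>With this radius the Lipschitz constant \<open>16 * (M * r) * M\<close> of the
    remainder becomes 1/2.\<close>
  define r where "r = 1 / (32 * M\<^sup>2)"
  have r: "r > 0" using M1 by (simp add: r_def)
  define G where "G t s b = (if b = z then t * (r/2) else 0) - Q b (comb s)" for t s b
  have comb0: "comb (\<lambda>_. 0) = (\<lambda>_. 0)" by (rule ext) (simp add: comb_def)
  have Lip: "\<bar>G t s b - G t s' b\<bar> \<le> \<eta> / 2"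
    if "t \<in> {0..1}" "b \<in> B" "\<forall>b\<in>B. \<bar>s b\<bar> \<le> r" "\<forall>b\<in>B. \<bar>s' b\<bar> \<le> r" "\<forall>b\<in>B. \<bar>s b - s' b\<bar> \<le> \<eta>" for t s s' \<eta> b
  proof -
    have \<eta>: "\<eta> \<ge> 0" using that(2,5) abs_ge_zero order_trans by blast
    have "\<bar>Q b (comb s) - Q b (comb s')\<bar> \<le> 16 * (M * r) * (M * \<eta>)"
      using that r \<eta> by (intro Qlip) (auto simp: comb_diff intro!: comb_le)
    also have "\<dots> = \<eta> / 2" using M1 by (simp add: r_def power2_eq_square field_simps)
    finally show ?thesis by (simp add: G_def abs_minus_commute)
  qed
  have "\<exists>s. (\<forall>b\<in>B. continuous_on {0..1} (\<lambda>t. s t b)) \<and> (\<forall>t\<in>{0..1}. \<forall>b\<in>B. s t b = G t (s t) b \<and> \<bar>s t b\<bar> \<le> r)"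
  proof (rule contraction_path[OF fin(2) r _ Lip])
    show "\<bar>G t (\<lambda>_. 0) b\<bar> \<le> r / 2" if "t \<in> {0..1}" "b \<in> B" for t b
      using that r by (simp add: G_def comb0 Q0 abs_mult mult_left_le_one_le)
    show "continuous_on {0..1} (\<lambda>t. G t (s t) b)"
      if "b \<in> B" "\<And>b. b \<in> B \<Longrightarrow> continuous_on {0..1} (\<lambda>t. s t b)" for s b
    proof -
      have "continuous_on {0..1} (\<lambda>t. Q b (comb (s t)))"
        by (rule Qcont[OF that(1)]) (use that in \<open>auto simp: comb_def intro!: continuous_intros\<close>)
      then show ?thesis unfolding G_def by (cases "b = z") (auto intro!: continuous_intros)
    qed
  qed
  then obtain s where s': "\<forall>b\<in>B. continuous_on {0..1} (\<lambda>t. s t b)"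
    "\<forall>t\<in>{0..1}. \<forall>b\<in>B. s t b = G t (s t) b \<and> \<bar>s t b\<bar> \<le> r" by (elim exE conjE)
  have s: "\<And>b. b \<in> B \<Longrightarrow> continuous_on {0..1} (\<lambda>t. s t b)"
    "\<And>t b. t \<in> {0..1} \<Longrightarrow> b \<in> B \<Longrightarrow> s t b = G t (s t) b"
    "\<And>t b. t \<in> {0..1} \<Longrightarrow> b \<in> B \<Longrightarrow> \<bar>s t b\<bar> \<le> r"
    by (rule bspec[OF s'(1)], assumption, rule conjunct1[OF bspec[OF bspec[OF s'(2)]]], assumption+,
      rule conjunct2[OF bspec[OF bspec[OF s'(2)]]], assumption+)
  \<comment> \<open>For \<open>t = 0\<close> the zero vector is a fixed point too; comparing at the
    largest coordinate of \<open>s 0\<close> shows that the two coincide, so the path starts at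
    \<open>p\<close>.\<close>
  have s0: "s 0 b = 0" if b: "b \<in> B" for b
  proof -
    have "finite ((\<lambda>b. \<bar>s 0 b\<bar>) ` B)" "(\<lambda>b. \<bar>s 0 b\<bar>) ` B \<noteq> {}" using fin z by auto
    from Max_in[OF this] obtain b0 where b0: "b0 \<in> B" "Max ((\<lambda>b. \<bar>s 0 b\<bar>) ` B) = \<bar>s 0 b0\<bar>" by auto
    then have mx: "\<forall>b\<in>B. \<bar>s 0 b - 0\<bar> \<le> \<bar>s 0 b0\<bar>" using Max_ge[of "(\<lambda>b. \<bar>s 0 b\<bar>) ` B"] fin by auto
    have "\<bar>G 0 (s 0) b0 - G 0 (\<lambda>_. 0) b0\<bar> \<le> \<bar>s 0 b0\<bar> / 2"
      by (rule Lip[OF _ b0(1) _ _ mx]) (use s(3)[of 0] r in auto)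
    moreover have "G 0 (\<lambda>_. 0) b0 = 0" using b0 Q0 by (simp add: G_def comb0)
    ultimately have "s 0 b0 = 0" using s(2)[of 0 b0] b0 by simp
    then show ?thesis using mx b by auto
  qed
  define \<gamma> where "\<gamma> t = (\<lambda>v. p v + comb (s t) v)" for t
  have "continuous_on {0..1} (\<lambda>t. \<gamma> t v)" for v
    unfolding \<gamma>_def comb_def using s(1) by (auto intro!: continuous_intros)
  moreover have "\<gamma> 0 = p" using s0 by (simp add: \<gamma>_def comb_def)
  moreover have "F b (\<gamma> t) = F b p + (if b = z then t * (r/2) else 0)" if t: "t \<in> {0..1}" and b: "b \<in> B" for t b
  proof -
    have "(\<Sum>v\<in>V. comb (s t) v * L b v) = (\<Sum>v\<in>V. \<Sum>b'\<in>B. s t b' * (W b' v * L b v))"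
      by (simp add: comb_def sum_distrib_right mult.assoc)
    also have "\<dots> = (\<Sum>b'\<in>B. \<Sum>v\<in>V. s t b' * (W b' v * L b v))" by (rule sum.swap)
    also have "\<dots> = (\<Sum>b'\<in>B. s t b' * (if b = b' then 1 else 0))"
      using W b by (intro sum.cong refl) (simp add: sum_distrib_left[symmetric])
    also have "\<dots> = s t b" using fin b by (simp add: if_distrib cong: if_cong)
    finally have "F b (\<gamma> t) = F b p + s t b + Q b (comb (s t))"
      unfolding \<gamma>_def exp[OF b] by simp
    then show ?thesis using s(2)[OF t b] by (simp add: G_def)
  qed
  moreover have "r / 2 \<noteq> 0" using r by simp
  ultimately show ?thesis by (intro exI[of _ \<gamma>] exI[of _ "r/2"]) simp
qed

section \<open>Plane configurations as vectors of coordinates\<close>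

definition verts :: "nat \<Rightarrow> (nat \<times> 2) set" where
  "verts n = {1..n} \<times> UNIV"

lemma finite_verts: "finite (verts n)" and card_verts: "card (verts n) = 2 * n"
  by (simp_all add: verts_def card_cartesian_product)

definition sqd :: "nat set \<Rightarrow> (nat \<times> 2 \<Rightarrow> 'a::comm_ring_1) \<Rightarrow> 'a" where
  "sqd e x = (\<Sum>k\<in>UNIV. (x (Min e, k) - x (Max e, k))\<^sup>2)"

lemma sqd_pair: "sqd {i, j} x = (x (i,1) - x (j,1))\<^sup>2 + (x (i,2) - x (j,2))\<^sup>2"
  by (cases "i \<le> j") (auto simp: sqd_def sum_2 min_def max_def power2_commute)

lemma simple_graph_edge:
  assumes "simple_graph n E" "e \<in> E"
  obtains i j where "e = {i, j}" "i \<in> {1..n}" "j \<in> {1..n}" "i < j" "Min e = i" "Max e = j"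
proof -
  have e: "e \<subseteq> {1..n}" "card e = 2" using assms by (auto simp: simple_graph_def)
  then obtain a b where ab: "e = {a, b}" "a \<noteq> b" by (auto simp: card_2_iff)
  have "e = {min a b, max a b}" using ab by (auto simp: min_def max_def)
  moreover have "Min e = min a b" "Max e = max a b" using ab by auto
  moreover have "min a b < max a b" using ab(2) by auto
  ultimately show ?thesis using e that[of "min a b" "max a b"] by auto
qed

lemma finite_simple_graph: "simple_graph n E \<Longrightarrow> finite E"
  by (rule finite_subset[of _ "Pow {1..n}"]) (auto simp: simple_graph_def)

lemma sqd_pfun: "simple_graph n E \<Longrightarrow> e \<in> E \<Longrightarrow> sqd e \<in> pfun (verts n)"
proof (erule simple_graph_edge, assumption)
  fix i j assume "i \<in> {1..n}" "j \<in> {1..n}" "Min e = i" "Max e = j"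
  then show "sqd e \<in> pfun (verts n)"
    unfolding sqd_def by (intro pfun_sum pfun_power pfun_diff pfun.var) (auto simp: verts_def)
qed

definition coords :: "(nat \<Rightarrow> 'a ^ 2) \<Rightarrow> nat \<times> 2 \<Rightarrow> 'a" where
  "coords p = (\<lambda>(i, k). p i $ k)"

definition config :: "nat \<Rightarrow> (nat \<times> 2 \<Rightarrow> 'a) \<Rightarrow> nat \<Rightarrow> 'a ^ 2" where
  "config n x = (\<lambda>i\<in>{1..n}. \<chi> k. x (i, k))"

lemma config_in: "config n x \<in> configs n" by (simp add: config_def configs_def)

lemma coords_config: "v \<in> verts n \<Longrightarrow> coords (config n x) v = x v"
  by (auto simp: coords_def config_def verts_def)

lemma poly_funs_imp_pfun:
  fixes f :: "(nat \<Rightarrow> 'a::comm_ring_1 ^ 2) \<Rightarrow> 'a"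
  assumes "f \<in> poly_funs n"
  shows "\<exists>g\<in>pfun (verts n). \<forall>p. f p = g (coords p)"
  using assms
proof induction
  case (const c)
  show ?case by (rule bexI[of _ "\<lambda>x. c"]) (auto intro: pfun.const)
next
  case (coord i k)
  show ?case by (rule bexI[of _ "\<lambda>x. x (i, k)"]) (use coord in \<open>auto simp: verts_def coords_def intro: pfun.var\<close>)
next
  case (add f g)
  then obtain f' g' where "f' \<in> pfun (verts n)" "\<forall>p. f p = f' (coords p)" "g' \<in> pfun (verts n)" "\<forall>p. g p = g' (coords p)"
    by (elim bexE)
  then show ?case by (intro bexI[of _ "\<lambda>x. f' x + g' x"]) (auto intro: pfun.add)
next
  case (mult f g)
  then obtain f' g' where "f' \<in> pfun (verts n)" "\<forall>p. f p = f' (coords p)" "g' \<in> pfun (verts n)" "\<forall>p. g p = g' (coords p)"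
    by (elim bexE)
  then show ?case by (intro bexI[of _ "\<lambda>x. f' x * g' x"]) (auto intro: pfun.mult)
qed

lemma pfun_imp_poly_funs:
  fixes g :: "(nat \<times> 2 \<Rightarrow> 'a::comm_ring_1) \<Rightarrow> 'a"
  assumes "g \<in> pfun (verts n)"
  shows "(\<lambda>p. g (coords p)) \<in> poly_funs n"
  using assms
  by induction (auto simp: coords_def verts_def intro: poly_funs.intros)

lemma generically_pfunI:
  fixes P :: "(nat \<Rightarrow> 'a::comm_ring_1 ^ 2) \<Rightarrow> bool"
  assumes "h \<in> pfun (verts n)" "h x \<noteq> 0" "\<And>p. p \<in> configs n \<Longrightarrow> h (coords p) \<noteq> 0 \<Longrightarrow> P p"
  shows "generically n P"
proof -
  define U where "U = {p \<in> configs n. h (coords p) \<noteq> 0}"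
  have "zariski_open n U" unfolding zariski_open_def
    by (rule exI[of _ "{\<lambda>p. h (coords p)}"]) (use pfun_imp_poly_funs[OF assms(1)] in \<open>auto simp: U_def\<close>)
  moreover have "config n x \<in> U"
    using assms(2) pfun_cong[OF assms(1), of "coords (config n x)" x]
    by (simp add: U_def config_in coords_config)
  moreover have "\<forall>p\<in>U. P p" using assms(3) by (simp add: U_def)
  ultimately show ?thesis unfolding generically_def by (intro exI[of _ U]) auto
qed

text \<open>A point of a Zariski open set is separated from its complement by one polynomial, so a
  generic property can always be handled through a single nonzero polynomial in the
  coordinates.\<close>

lemma generically_pfunD:
  fixes P :: "(nat \<Rightarrow> 'a::comm_ring_1 ^ 2) \<Rightarrow> bool"
  assumes "generically n P"
  obtains h x where "h \<in> pfun (verts n)" "h x \<noteq> 0" "\<And>p. p \<in> configs n \<Longrightarrow> h (coords p) \<noteq> 0 \<Longrightarrow> P p"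
proof -
  obtain U where U: "zariski_open n U" "U \<noteq> {}" "\<forall>p\<in>U. P p"
    using assms unfolding generically_def by (elim exE conjE)
  from U(1) obtain F where F: "F \<subseteq> poly_funs n" "U = {p \<in> configs n. \<exists>f\<in>F. f p \<noteq> 0}"
    unfolding zariski_open_def by (elim exE conjE)
  from U(2) obtain p0 where "p0 \<in> U" by auto
  then obtain f where f: "f \<in> F" "p0 \<in> configs n" "f p0 \<noteq> 0"
    unfolding F(2) mem_Collect_eq by (elim bexE conjE)
  from poly_funs_imp_pfun[OF subsetD[OF F(1) f(1)]]
  obtain h where h: "h \<in> pfun (verts n)" "\<forall>p. f p = h (coords p)" by (elim bexE)
  show ?thesis
  proof (rule that[OF h(1)])
    show "h (coords p0) \<noteq> 0" using f h by simp
    show "P p" if "p \<in> configs n" "h (coords p) \<noteq> 0" for p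
    proof -
      have "f p \<noteq> 0" using that h(2) by simp
      then have "p \<in> U" using that(1) f(1) F(2) by auto
      then show ?thesis using U(3) by simp
    qed
  qed
qed

text \<open>Squared lengths and plain coordinates in one family. The coordinates serve twice: three
  of them are pins, and all of them together allow an independent set to be completed to one of size
  \<open>2 * n\<close>.\<close>

abbreviation dfam :: "nat set + nat \<times> 2 \<Rightarrow> (nat \<times> 2 \<Rightarrow> 'a::comm_ring_1) \<Rightarrow> 'a" where
  "dfam \<equiv> case_sum sqd (\<lambda>v x. x v)"

lemma continuous_finite_values_const:
  fixes g :: "real \<Rightarrow> real"
  assumes "continuous_on {0..1} g" "finite A" "\<And>t. t \<in> {0..1} \<Longrightarrow> g t \<in> A" "t \<in> {0..1}"
  shows "g t = g 0"
proof -
  have "g constant_on {0..1}"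
    by (rule continuous_finite_range_constant)
      (use assms in \<open>auto intro: finite_subset[of _ A]\<close>)
  then show ?thesis using assms(4) by (auto simp: constant_on_def)
qed

section \<open>Recovering a framework from dot and cross products\<close>

definition crs :: "nat \<Rightarrow> nat \<Rightarrow> nat \<Rightarrow> (nat \<times> 2 \<Rightarrow> real) \<Rightarrow> real" where
  "crs a b i x = (x (i,1) - x (a,1)) * (x (b,2) - x (a,2)) - (x (i,2) - x (a,2)) * (x (b,1) - x (a,1))"

definition dt :: "nat \<Rightarrow> nat \<Rightarrow> nat \<Rightarrow> (nat \<times> 2 \<Rightarrow> real) \<Rightarrow> real" where
  "dt a b i x = (x (i,1) - x (a,1)) * (x (b,1) - x (a,1)) + (x (i,2) - x (a,2)) * (x (b,2) - x (a,2))"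

lemma dt_sqd: "2 * dt a b i x = sqd {a,i} x + sqd {a,b} x - sqd {b,i} x"
  by (simp add: dt_def sqd_pair power2_eq_square algebra_simps)

lemma crs_dt_sqd: "(crs a b i x)\<^sup>2 + (dt a b i x)\<^sup>2 = sqd {a,i} x * sqd {a,b} x"
  by (simp add: dt_def crs_def sqd_pair power2_eq_square algebra_simps)

text \<open>The distances determine the dot product and the square of the cross product. Only the
  sign of the latter is open, and a continuous function with finitely many possible values is
  constant.\<close>

lemma crs_const:
  fixes \<gamma> :: "real \<Rightarrow> nat \<times> 2 \<Rightarrow> real"
  assumes "\<And>v. v \<in> verts n \<Longrightarrow> continuous_on {0..1} (\<lambda>t. \<gamma> t v)"
    and "\<And>t i j. t \<in> {0..1} \<Longrightarrow> i \<in> {1..n} \<Longrightarrow> j \<in> {1..n} \<Longrightarrow> sqd {i,j} (\<gamma> t) = sqd {i,j} (\<gamma> 0)"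
    and abi: "a \<in> {1..n}" "b \<in> {1..n}" "i \<in> {1..n}" and t: "t \<in> {0..1}"
  shows "crs a b i (\<gamma> t) = crs a b i (\<gamma> 0)"
proof -
  define c where "c = sqd {a,i} (\<gamma> 0) * sqd {a,b} (\<gamma> 0) - (dt a b i (\<gamma> 0))\<^sup>2"
  have d: "dt a b i (\<gamma> t) = dt a b i (\<gamma> 0)" if "t \<in> {0..1}" for t
    using dt_sqd[of a b i "\<gamma> t"] dt_sqd[of a b i "\<gamma> 0"] assms(2)[OF that] abi by simp
  have sq: "(crs a b i (\<gamma> t))\<^sup>2 = c" if "t \<in> {0..1}" for t
  proof -
    have "(crs a b i (\<gamma> t))\<^sup>2 = sqd {a,i} (\<gamma> t) * sqd {a,b} (\<gamma> t) - (dt a b i (\<gamma> t))\<^sup>2"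
      using crs_dt_sqd[of a b i "\<gamma> t"] by linarith
    then show ?thesis
      by (simp only: d[OF that] assms(2)[OF that abi(1,3)] assms(2)[OF that abi(1,2)] c_def)
  qed
  show ?thesis
  proof (rule continuous_finite_values_const[of "\<lambda>t. crs a b i (\<gamma> t)" "{sqrt c, - sqrt c}"])
    show "continuous_on {0..1} (\<lambda>t. crs a b i (\<gamma> t))"
      unfolding crs_def using abi by (intro continuous_intros assms(1)) (auto simp: verts_def)
    show "crs a b i (\<gamma> t) \<in> {sqrt c, - sqrt c}" if "t \<in> {0..1}" for t
      using sq[OF that] real_sqrt_abs[of "crs a b i (\<gamma> t)"] by auto
  qed (use t in auto)
qed

text \<open>In complex notation, the vector from \<open>a\<close> to \<open>i\<close> times the
  conjugate of the vector from \<open>a\<close> to \<open>b\<close> is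
  \<open>dt - \<i> * crs\<close>; multiplying by the second vector gives both equations.\<close>

lemma from_dt_crs:
  "(x (i,1) - x (a,1)) * sqd {a,b} x = dt a b i x * (x (b,1) - x (a,1)) + crs a b i x * (x (b,2) - x (a,2))"
  "(x (i,2) - x (a,2)) * sqd {a,b} x = dt a b i x * (x (b,2) - x (a,2)) - crs a b i x * (x (b,1) - x (a,1))"
  by (simp_all add: dt_def crs_def sqd_pair power2_eq_square algebra_simps)

text \<open>Three pinned coordinates remove the rigid motions: vertex 1 is fixed, the free
  coordinate of vertex 2 has at most two possible values and stays put by continuity, and every
  vertex is recovered from its dot and cross products with the segment from 1 to 2.\<close>

lemma pinned_const:
  fixes \<gamma> :: "real \<Rightarrow> nat \<times> 2 \<Rightarrow> real"
  assumes cont: "\<And>v. v \<in> verts n \<Longrightarrow> continuous_on {0..1} (\<lambda>t. \<gamma> t v)"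
    and dist: "\<And>t i j. t \<in> {0..1} \<Longrightarrow> i \<in> {1..n} \<Longrightarrow> j \<in> {1..n} \<Longrightarrow> sqd {i,j} (\<gamma> t) = sqd {i,j} (\<gamma> 0)"
    and pin: "\<And>t. t \<in> {0..1} \<Longrightarrow> \<gamma> t (1,1) = \<gamma> 0 (1,1) \<and> \<gamma> t (1,2) = \<gamma> 0 (1,2) \<and> \<gamma> t (2,1) = \<gamma> 0 (2,1)"
    and nz: "sqd {1,2} (\<gamma> 0) \<noteq> 0" and n: "n \<ge> 2" and t: "t \<in> {0..1}" and v: "v \<in> verts n"
  shows "\<gamma> t v = \<gamma> 0 v"
proof -
  have V: "(1,k) \<in> verts n" "(2,k) \<in> verts n" for k using n by (auto simp: verts_def)
  define c where "c = (\<gamma> 0 (2,2) - \<gamma> 0 (1,2))\<^sup>2"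
  have "(\<gamma> t (2,2) - \<gamma> 0 (1,2))\<^sup>2 = c" if "t \<in> {0..1}" for t
    using dist[OF that, of 1 2] n pin[OF that] by (simp add: sqd_pair c_def power2_commute)
  then have "\<gamma> t (2,2) \<in> {\<gamma> 0 (1,2) + sqrt c, \<gamma> 0 (1,2) - sqrt c}" if "t \<in> {0..1}" for t
    using real_sqrt_abs[of "\<gamma> t (2,2) - \<gamma> 0 (1,2)"] that by fastforce
  then have p22: "\<gamma> t (2,2) = \<gamma> 0 (2,2)"
    by (intro continuous_finite_values_const[OF cont[OF V(2)] _ _ t, of "{\<gamma> 0 (1,2) + sqrt c, \<gamma> 0 (1,2) - sqrt c}"]) auto
  obtain i k where vi: "v = (i, k)" "i \<in> {1..n}" using v by (auto simp: verts_def)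
  have d: "dt 1 2 i (\<gamma> t) = dt 1 2 i (\<gamma> 0)"
    using dt_sqd[of 1 2 i "\<gamma> t"] dt_sqd[of 1 2 i "\<gamma> 0"] dist[OF t] vi n by simp
  have c: "crs 1 2 i (\<gamma> t) = crs 1 2 i (\<gamma> 0)"
    by (rule crs_const[OF cont dist]) (use t vi n in auto)
  have s: "sqd {1,2} (\<gamma> t) = sqd {1,2} (\<gamma> 0)" using dist[OF t] n by simp
  have "(\<gamma> t (i,1) - \<gamma> t (1,1)) * sqd {1,2} (\<gamma> 0) = (\<gamma> 0 (i,1) - \<gamma> 0 (1,1)) * sqd {1,2} (\<gamma> 0)"
    using from_dt_crs(1)[of "\<gamma> t" i 1 2] from_dt_crs(1)[of "\<gamma> 0" i 1 2] d c s p22 pin[OF t] by simp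
  then have 1: "\<gamma> t (i,1) = \<gamma> 0 (i,1)" using nz pin[OF t] by simp
  have "(\<gamma> t (i,2) - \<gamma> t (1,2)) * sqd {1,2} (\<gamma> 0) = (\<gamma> 0 (i,2) - \<gamma> 0 (1,2)) * sqd {1,2} (\<gamma> 0)"
    using from_dt_crs(2)[of "\<gamma> t" i 1 2] from_dt_crs(2)[of "\<gamma> 0" i 1 2] d c s p22 pin[OF t] by simp
  then have 2: "\<gamma> t (i,2) = \<gamma> 0 (i,2)" using nz pin[OF t] by simp
  have "k = 1 \<or> k = 2" using exhaust_2 by blast
  with 1 2 vi show ?thesis by auto
qed

text \<open>The coefficient of the coordinate \<open>v\<close> in the differential at
  \<open>p\<close>; for an edge it is an entry of the rigidity matrix, up to the factor 2.\<close>

definition dlin :: "(nat \<times> 2 \<Rightarrow> 'a::comm_ring_1) \<Rightarrow> nat set + nat \<times> 2 \<Rightarrow> nat \<times> 2 \<Rightarrow> 'a" where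
  "dlin p b v = (case b of
     Inl e \<Rightarrow> \<Sum>k\<in>UNIV. 2 * (p (Min e, k) - p (Max e, k)) *
       ((if v = (Min e, k) then 1 else 0) - (if v = (Max e, k) then 1 else 0))
   | Inr u \<Rightarrow> if v = u then 1 else 0)"

text \<open>A squared length is its own quadratic part, and a coordinate has none; the expansion
  below therefore stops exactly at second order.\<close>

definition dquad :: "nat set + nat \<times> 2 \<Rightarrow> (nat \<times> 2 \<Rightarrow> 'a::comm_ring_1) \<Rightarrow> 'a" where
  "dquad = case_sum sqd (\<lambda>_ _. 0)"

lemma dfam_expand:
  assumes "simple_graph n E" "b \<in> Inl ` E \<union> Inr ` verts n"
  shows "dfam b (\<lambda>v. p v + w v) = dfam b p + (\<Sum>v\<in>verts n. w v * dlin p b v) + dquad b w"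
  using assms(2)
proof
  assume "b \<in> Inl ` E"
  then obtain e where e: "b = Inl e" "e \<in> E" by auto
  obtain i j where ij: "i \<in> {1..n}" "j \<in> {1..n}" "Min e = i" "Max e = j"
    using simple_graph_edge[OF assms(1) e(2)] by metis
  have V: "(i,k) \<in> verts n" "(j,k) \<in> verts n" for k using ij by (auto simp: verts_def)
  have "(\<Sum>v\<in>verts n. w v * dlin p b v)
     = (\<Sum>v\<in>verts n. \<Sum>k\<in>UNIV. 2 * (p (i, k) - p (j, k)) * ((if v = (i, k) then w v else 0) - (if v = (j, k) then w v else 0)))"
    unfolding dlin_def e ij sum.case sum_distrib_left
    by (intro sum.cong refl) (auto simp: algebra_simps)
  also have "\<dots> = (\<Sum>k\<in>UNIV. \<Sum>v\<in>verts n. 2 * (p (i, k) - p (j, k)) * ((if v = (i, k) then w v else 0) - (if v = (j, k) then w v else 0)))"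
    by (rule sum.swap)
  also have "\<dots> = (\<Sum>k\<in>UNIV. 2 * (p (i, k) - p (j, k)) * (w (i, k) - w (j, k)))"
    by (simp only: sum_distrib_left[symmetric] sum_subtractf sum.delta finite_verts V if_True)
  finally show ?thesis
    by (simp add: e ij dquad_def sqd_def sum.distrib[symmetric] power2_eq_square algebra_simps)
next
  assume "b \<in> Inr ` verts n"
  then obtain u where u: "b = Inr u" "u \<in> verts n" by auto
  have "(\<Sum>v\<in>verts n. w v * dlin p b v) = (\<Sum>v\<in>verts n. if v = u then w v else 0)"
    unfolding dlin_def u by (intro sum.cong) auto
  also have "\<dots> = w u" using u finite_verts by simp
  finally show ?thesis by (simp add: u dquad_def)
qed

lemma dquad_scale: "dquad b (\<lambda>v. t * w v) = t\<^sup>2 * dquad b w"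
  by (cases b) (simp_all add: dquad_def sqd_def sum_distrib_left power2_eq_square algebra_simps)

lemma dfam_dzero:
  fixes p w :: "nat \<times> 2 \<Rightarrow> 'a::real_normed_field"
  assumes "simple_graph n E" "b \<in> Inl ` E \<union> Inr ` verts n" "(\<Sum>v\<in>verts n. w v * dlin p b v) = 0"
  shows "dzero p w (dfam b)"
proof -
  have "dfam b (\<lambda>v. p v + t * w v) = dfam b p + t\<^sup>2 * dquad b w" for t
    unfolding dfam_expand[OF assms(1,2)] dquad_scale
    using assms(3) by (simp add: mult.assoc sum_distrib_left[symmetric])
  then have "(\<lambda>t. dfam b (\<lambda>v. p v + t * w v)) = (\<lambda>t. dfam b p + t\<^sup>2 * dquad b w)" by blast
  then show ?thesis by (auto intro!: derivative_eq_intros)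
qed

lemma dfam_pfun:
  assumes "simple_graph n E" "b \<in> Inl ` E \<union> Inr ` verts n"
  shows "dfam b \<in> pfun (verts n)"
  using assms(2) sqd_pfun[OF assms(1)] by (auto intro: pfun.var)

text \<open>In each of the two coordinates a difference of squares factors into at most
  \<open>2 * \<eta>\<close> times \<open>4 * r\<close>, whence the constant 16.\<close>

lemma dquad_lip:
  fixes w w' :: "nat \<times> 2 \<Rightarrow> real"
  assumes "simple_graph n E" "b \<in> Inl ` E \<union> Inr ` verts n"
    and w: "\<forall>v\<in>verts n. \<bar>w v\<bar> \<le> r \<and> \<bar>w' v\<bar> \<le> r \<and> \<bar>w v - w' v\<bar> \<le> \<eta>"
    and n: "n \<ge> 1"
  shows "\<bar>dquad b w - dquad b w'\<bar> \<le> 16 * r * \<eta>"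
proof -
  have "(1, 1) \<in> verts n" using n by (simp add: verts_def)
  then have r: "r \<ge> 0" "\<eta> \<ge> 0" using w by force+
  show ?thesis
    using assms(2)
  proof
    assume "b \<in> Inl ` E"
    then obtain e where e: "b = Inl e" "e \<in> E" by auto
    obtain i j where ij: "i \<in> {1..n}" "j \<in> {1..n}" "Min e = i" "Max e = j"
      using simple_graph_edge[OF assms(1) e(2)] by metis
    have k: "\<bar>(w (i,k) - w (j,k))\<^sup>2 - (w' (i,k) - w' (j,k))\<^sup>2\<bar> \<le> (2 * \<eta>) * (4 * r)" for k
    proof -
      have V: "(i,k) \<in> verts n" "(j,k) \<in> verts n" using ij by (auto simp: verts_def)
      have "\<bar>(w (i,k) - w (j,k)) - (w' (i,k) - w' (j,k))\<bar> \<le> 2 * \<eta>"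
        using w[rule_format, OF V(1)] w[rule_format, OF V(2)] by linarith
      moreover have "\<bar>(w (i,k) - w (j,k)) + (w' (i,k) - w' (j,k))\<bar> \<le> 4 * r"
        using w[rule_format, OF V(1)] w[rule_format, OF V(2)] by linarith
      moreover have "(w (i,k) - w (j,k))\<^sup>2 - (w' (i,k) - w' (j,k))\<^sup>2
         = ((w (i,k) - w (j,k)) - (w' (i,k) - w' (j,k))) * ((w (i,k) - w (j,k)) + (w' (i,k) - w' (j,k)))"
        by (simp add: power2_eq_square algebra_simps)
      ultimately show ?thesis using r by (simp only: abs_mult) (intro mult_mono, auto)
    qed
    have "\<bar>dquad b w - dquad b w'\<bar> \<le> (2 * \<eta>) * (4 * r) + (2 * \<eta>) * (4 * r)"
      using k[of 1] k[of 2] by (simp add: e ij dquad_def sqd_def sum_2)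
    then show ?thesis by (simp add: mult_ac)
  next
    assume "b \<in> Inr ` verts n"
    then show ?thesis using r by (auto simp: dquad_def)
  qed
qed

lemma dist_sqd: "(dist (p i) (p j))\<^sup>2 = sqd {i, j} (coords p)" for p :: "nat \<Rightarrow> real ^ 2"
  by (simp add: dist_vec_def L2_set_def sum_2 sqd_pair coords_def dist_real_def)

lemma sqd_cong: "(\<And>v. v \<in> verts n \<Longrightarrow> x v = y v) \<Longrightarrow> i \<in> {1..n} \<Longrightarrow> j \<in> {1..n} \<Longrightarrow> sqd {i, j} x = sqd {i, j} y"
  by (simp add: sqd_pair verts_def)

text \<open>\<open>A\<close> is a maximal independent set of edge lengths and pins, and
  \<open>B\<close>, of size \<open>2 * n\<close>, a maximal extension of it inside the whole family.
  An element \<open>z\<close> of \<open>B\<close> outside \<open>A\<close> could be moved while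
  \<open>A\<close> stays fixed; edge lengths and pins, being algebraic over \<open>A\<close>, then
  take finitely many values and are constant along the path. By rigidity and the pins the path
  stands still, a contradiction. So \<open>A\<close> has size \<open>2 * n\<close>, and at most
  three of its elements are pins.\<close>

theorem rigid_imp_algindep:
  assumes sg: "simple_graph n E" and n: "n \<ge> 2" and rig: "rigid TYPE(2) n E"
  shows "\<exists>E'\<subseteq>E. algindep (sqd :: nat set \<Rightarrow> (nat \<times> 2 \<Rightarrow> real) \<Rightarrow> real) E' \<and> 2 * n \<le> card E' + 3"
proof -
  define D :: "nat set + nat \<times> 2 \<Rightarrow> (nat \<times> 2 \<Rightarrow> real) \<Rightarrow> real" where "D = dfam"
  define pins :: "(nat \<times> 2) set" where "pins = {(1,1), (1,2), (2,1)}"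
  have pinsV: "pins \<subseteq> verts n" using n by (auto simp: pins_def verts_def)
  have finE: "finite E" by (rule finite_simple_graph[OF sg])
  define S2 where "S2 = (Inl ` E \<union> Inr ` pins :: (nat set + nat \<times> 2) set)"
  define S3 where "S3 = (Inl ` E \<union> Inr ` verts n :: (nat set + nat \<times> 2) set)"
  have S23: "S2 \<subseteq> S3" using pinsV by (auto simp: S2_def S3_def)
  have finS: "finite S3" "finite S2" using finE finite_verts finite_subset[OF S23] by (auto simp: S3_def)
  obtain A where A: "A \<subseteq> S2" "algindep D A" "\<forall>s\<in>S2. alg_over D A (D s)"
    using algindep_extend[OF finS(2) empty_subsetI algindep_empty, of D] by (elim exE conjE)
  obtain B where B: "A \<subseteq> B" "B \<subseteq> S3" "algindep D B" "\<forall>s\<in>S3. alg_over D B (D s)"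
    using algindep_extend[OF finS(1) subset_trans[OF A(1) S23] A(2)] by (elim exE conjE)
  have finB: "finite B" "finite A" by (rule finite_subset[OF B(2) finS(1)], rule finite_subset[OF A(1) finS(2)])
  have Dp: "D b \<in> pfun (verts n)" if "b \<in> S3" for b
    using dfam_pfun[OF sg, of b] that unfolding D_def S3_def .
  have algc: "alg_over D B (\<lambda>x. x v)" if "v \<in> verts n" for v
    using B(4)[rule_format, of "Inr v"] that by (simp add: S3_def D_def)
  have "\<exists>h\<in>pfun (verts n). (\<exists>x. h x \<noteq> 0) \<and>
    (\<forall>z w. h z \<noteq> 0 \<longrightarrow> (\<forall>b\<in>B. dzero z w (D b)) \<longrightarrow> (\<forall>v\<in>verts n. w v = 0))"
    by (rule jacobian_kernel_trivial[OF finite_verts B(3) Dp[OF subsetD[OF B(2)]] algc])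
  then obtain h x0 where h: "h \<in> pfun (verts n)" "h x0 \<noteq> 0"
    "\<forall>z w. h z \<noteq> 0 \<longrightarrow> (\<forall>b\<in>B. dzero z w (D b)) \<longrightarrow> (\<forall>v\<in>verts n. w v = 0)"
    by (elim bexE exE conjE)
  have ker: "\<forall>v\<in>verts n. w v = 0"
    if "h z \<noteq> 0" "\<forall>b\<in>B. (\<Sum>v\<in>verts n. w v * dlin z b v) = 0" for z w
  proof -
    have "dzero z w (D b)" if b: "b \<in> B" for b
      unfolding D_def
      by (rule dfam_dzero[OF sg]) (use b B(2) \<open>\<forall>b\<in>B. (\<Sum>v\<in>verts n. w v * dlin z b v) = 0\<close> in \<open>auto simp: S3_def\<close>)
    then show ?thesis using h(3)[rule_format, of z w] that(1) by simp
  qed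
  \<comment> \<open>Independence allows at most \<open>2 * n\<close> functions, and a trivial common
    kernel of their differentials at one point requires as many.\<close>
  have cardB: "card B = card (verts n)"
  proof (rule antisym)
    show "card B \<le> card (verts n)"
      by (rule algindep_card_le[OF finite_verts B(3) finB(1)]) (use Dp B(2) in auto)
    show "card (verts n) \<le> card B"
    proof (rule ccontr)
      assume "\<not> ?thesis"
      then have "card B < card (verts n)" by simp
      from functionals_kernel[OF finite_verts finB(1) this, of "dlin x0"]
      obtain w where w: "\<exists>v\<in>verts n. w v \<noteq> 0" "\<forall>b\<in>B. (\<Sum>v\<in>verts n. w v * dlin x0 b v) = 0"
        by (elim exE conjE)
      from ker[OF h(2) w(2)] w(1) show False by simp
    qed
  qed
  have "B \<subseteq> A"
  proof (rule ccontr)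
    assume "\<not> B \<subseteq> A"
    then obtain z where z: "z \<in> B" "z \<notin> A" by blast
    obtain f0 y0 where f0: "f0 \<in> pfun (verts n)" "f0 y0 \<noteq> 0"
      "\<And>p. p \<in> configs n \<Longrightarrow> f0 (coords p) \<noteq> 0 \<Longrightarrow> rigid_framework n E (p :: nat \<Rightarrow> real ^ 2)"
      by (rule generically_pfunD[OF rig[unfolded rigid_def]]) (rule that)
    have "\<forall>s\<in>S2. \<exists>g. g \<in> pfun A \<and> (\<exists>y. g y \<noteq> 0) \<and>
        (\<forall>x. g (\<lambda>b. D b x) \<noteq> 0 \<longrightarrow> finite (D s ` {x'. \<forall>b\<in>A. D b x' = D b x}))"
    proof
      fix s assume "s \<in> S2"
      from algebraic_finite_values[OF A(3)[rule_format, OF this]]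
      show "\<exists>g. g \<in> pfun A \<and> (\<exists>y. g y \<noteq> 0) \<and>
        (\<forall>x. g (\<lambda>b. D b x) \<noteq> 0 \<longrightarrow> finite (D s ` {x'. \<forall>b\<in>A. D b x' = D b x}))"
        by (simp only: Bex_def)
    qed
    then obtain g where g: "\<forall>s\<in>S2. g s \<in> pfun A \<and> (\<exists>y. g s y \<noteq> 0) \<and>
        (\<forall>x. g s (\<lambda>b. D b x) \<noteq> 0 \<longrightarrow> finite (D s ` {x'. \<forall>b\<in>A. D b x' = D b x}))"
      unfolding bchoice_iff by (elim exE)
    \<comment> \<open>\<open>None\<close> collects the conditions on the point itself:
      nondegenerate, rigid, vertices 1 and 2 distinct. \<open>Some s\<close> is the leading
      coefficient that makes the values of \<open>s\<close> finite in number. All are nonzero at one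
      common point \<open>x1\<close>.\<close>
    define P where "P i = (case i of None \<Rightarrow> (\<lambda>x. h x * f0 x * sqd {1,2} x) | Some s \<Rightarrow> (\<lambda>x. g s (\<lambda>b. D b x)))" for i
    have "sqd {1,2} \<in> pfun (verts n)"
      by (rule sqd_pfun[of n "{{1,2}}"]) (use n in \<open>auto simp: simple_graph_def\<close>)
    moreover have "sqd {1,2} (\<lambda>v. if v = (1,1) then 1 else 0 :: real) \<noteq> 0" by (simp add: sqd_pair)
    ultimately have s12: "sqd {1,2} \<in> pfun (verts n)" "\<exists>x. sqd {1,2} x \<noteq> (0::real)" by auto
    have "\<exists>x. (\<Prod>i\<in>insert None (Some ` S2). P i x) \<noteq> 0"
    proof (rule pfun_prod_nonzero[where V = "verts n"])
      fix i assume i: "i \<in> insert None (Some ` S2)"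
      show "P i \<in> pfun (verts n)"
      proof (cases i)
        case None
        have "(\<lambda>x. h x * f0 x * sqd {1,2} x) \<in> pfun (verts n)"
          by (intro pfun.mult h(1) f0(1) s12(1))
        then show ?thesis by (simp add: P_def None)
      next
        case (Some s)
        then have "s \<in> S2" using i by auto
        from bspec[OF g this] have "g s \<in> pfun A" by simp
        then have "(\<lambda>x. g s (\<lambda>b. D b x)) \<in> pfun (verts n)"
          by (rule pfun_subst) (use Dp A(1) S23 in auto)
        then show ?thesis by (simp add: P_def Some)
      qed
      show "\<exists>x. P i x \<noteq> 0"
      proof (cases i)
        case None
        obtain y1 where y1: "h y1 * f0 y1 \<noteq> 0"
          using pfun_two_nonzero[of h "verts n" f0 x0 y0, OF h(1) f0(1) h(2) f0(2)] by auto
        obtain y2 :: "nat \<times> 2 \<Rightarrow> real" where y2: "sqd {1,2} y2 \<noteq> 0" using s12 by blast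
        have "(\<lambda>x. h x * f0 x) \<in> pfun (verts n)" by (intro pfun.mult h(1) f0(1))
        from pfun_two_nonzero[OF this s12(1), of y1 y2] y1 y2
        obtain y3 where "h y3 * f0 y3 \<noteq> 0 \<and> sqd {1,2} y3 \<noteq> 0" by auto
        then have "P None y3 \<noteq> 0" by (simp add: P_def)
        then show ?thesis unfolding None by (rule exI[of _ y3])
      next
        case (Some s)
        then have "s \<in> S2" using i by auto
        from bspec[OF g this] have "g s \<in> pfun A" "\<exists>y. g s y \<noteq> 0" by simp_all
        then obtain y where y: "g s \<in> pfun A" "g s y \<noteq> 0" by (elim exE)
        then show ?thesis using algindep_nonzero[of D A "g s" y, OF A(2) y] by (simp add: P_def Some)
      qed
    qed (use finS in auto)
    then obtain x1 where "(\<Prod>i\<in>insert None (Some ` S2). P i x1) \<noteq> 0" by blast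
    then have x1: "P i x1 \<noteq> 0" if "i \<in> insert None (Some ` S2)" for i
      using that finS by (auto simp: prod_zero_iff)
    have x1h: "h x1 \<noteq> 0" "f0 x1 \<noteq> 0" "sqd {1,2} x1 \<noteq> 0" using x1[of None] by (auto simp: P_def)
    have x1g: "finite (D s ` {x'. \<forall>b\<in>A. D b x' = D b x1})" if s: "s \<in> S2" for s
    proof -
      have "g s (\<lambda>b. D b x1) \<noteq> 0" using x1[of "Some s"] s by (simp add: P_def)
      then show ?thesis using bspec[OF g s] by simp
    qed
    have "\<exists>\<gamma> \<delta>. \<delta> \<noteq> 0 \<and> (\<forall>v. continuous_on {0..1::real} (\<lambda>t. \<gamma> t v)) \<and> \<gamma> 0 = x1 \<and>
      (\<forall>t\<in>{0..1}. \<forall>b\<in>B. D b (\<gamma> t) = D b x1 + (if b = z then t * \<delta> else 0))"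
    proof (rule quadratic_flex[OF finite_verts finB(1) cardB _ _ _ _ _ z(1)])
      fix b assume b: "b \<in> B"
      then have b': "b \<in> Inl ` E \<union> Inr ` verts n" using B(2) by (auto simp: S3_def)
      show "D b (\<lambda>v. x1 v + w v) = D b x1 + (\<Sum>v\<in>verts n. w v * dlin x1 b v) + dquad b w" for w
        unfolding D_def by (rule dfam_expand[OF sg b'])
      show "dquad b (\<lambda>_. 0) = (0::real)" by (cases b) (simp_all add: dquad_def sqd_def)
      show "\<bar>dquad b w - dquad b w'\<bar> \<le> 16 * r * \<eta>"
        if "\<forall>v\<in>verts n. \<bar>w v\<bar> \<le> r \<and> \<bar>w' v\<bar> \<le> r \<and> \<bar>w v - w' v\<bar> \<le> \<eta>" for w w' :: "nat \<times> 2 \<Rightarrow> real" and r \<eta>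
        by (rule dquad_lip[OF sg b' that]) (use n in simp)
      show "continuous_on {0..1} (\<lambda>t. dquad b (w t))"
        if "\<And>v. v \<in> verts n \<Longrightarrow> continuous_on {0..1} (\<lambda>t. w t v)" for w :: "real \<Rightarrow> nat \<times> 2 \<Rightarrow> real"
      proof (cases b)
        case (Inl e)
        then have "e \<in> E" using b' by auto
        from pfun_continuous[OF sqd_pfun[OF sg this] that] show ?thesis by (simp add: Inl dquad_def)
      qed (simp add: dquad_def)
    next
      show "\<forall>v\<in>verts n. w v = 0" if "\<forall>b\<in>B. (\<Sum>v\<in>verts n. w v * dlin x1 b v) = 0" for w
        by (rule ker[OF x1h(1) that])
    qed
    then obtain \<gamma> \<delta> where \<gamma>': "\<delta> \<noteq> 0" "\<forall>v. continuous_on {0..1::real} (\<lambda>t. \<gamma> t v)" "\<gamma> 0 = x1"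
      "\<forall>t\<in>{0..1}. \<forall>b\<in>B. D b (\<gamma> t) = D b x1 + (if b = z then t * \<delta> else 0)"
      by (elim exE conjE)
    have \<gamma>4: "D b (\<gamma> t) = D b x1 + (if b = z then t * \<delta> else 0)" if "t \<in> {0..1}" "b \<in> B" for t b
      using \<gamma>'(4) that by blast
    note \<gamma> = \<gamma>'(1) spec[OF \<gamma>'(2)] \<gamma>'(3) \<gamma>4
    have fixA: "\<forall>b\<in>A. D b (\<gamma> t) = D b x1" if "t \<in> {0..1}" for t
      using \<gamma>(4)[OF that] z(2) B(1) by auto
    \<comment> \<open>What is algebraic over the fixed functions has only finitely many values along
      the path, so it cannot move continuously.\<close>
    have fixS: "D s (\<gamma> t) = D s x1" if s: "s \<in> S2" and t: "t \<in> {0..1}" for s t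
    proof -
      have "D s (\<gamma> t) = D s (\<gamma> 0)"
      proof (rule continuous_finite_values_const[of "\<lambda>t. D s (\<gamma> t)", OF _ x1g[OF s] _ t])
        show "continuous_on {0..1} (\<lambda>t. D s (\<gamma> t))"
          by (rule pfun_continuous[OF Dp]) (use s S23 \<gamma>(2) in auto)
        show "D s (\<gamma> t) \<in> D s ` {x'. \<forall>b\<in>A. D b x' = D b x1}" if "t \<in> {0..1}" for t
          using fixA[OF that] by blast
      qed
      then show ?thesis by (simp add: \<gamma>(3))
    qed
    define p where "p = config n x1"
    define path where "path t = config n (\<gamma> t)" for t
    have cp: "coords p v = x1 v" "coords (path t) v = \<gamma> t v" if "v \<in> verts n" for v t
      using that by (simp_all add: p_def path_def coords_config)
    have "rigid_framework n E p"
    proof (rule f0(3))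
      show "p \<in> configs n" by (simp add: p_def config_in)
      show "f0 (coords p) \<noteq> 0" using x1h(2) pfun_cong[OF f0(1), of "coords p" x1] cp by simp
    qed
    moreover have "\<forall>i\<in>{1..n}. continuous_on {0..1} (\<lambda>t. path t i) \<and> path 0 i = p i"
    proof (intro ballI conjI)
      fix i assume i: "i \<in> {1..n}"
      show "path 0 i = p i" by (simp add: path_def p_def \<gamma>(3))
      have "path t i = (\<chi> k. \<gamma> t (i, k))" for t using i by (simp add: path_def config_def)
      then show "continuous_on {0..1} (\<lambda>t. path t i)"
        by (simp only:) (rule continuous_on_vec_lambda, rule \<gamma>(2))
    qed
    moreover have "\<forall>t\<in>{0..1}. \<forall>i j. {i, j} \<in> E \<longrightarrow> dist (path t i) (path t j) = dist (p i) (p j)"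
    proof (intro ballI allI impI)
      fix t i j assume t: "t \<in> {0..1::real}" and e: "{i, j} \<in> E"
      then have ij: "i \<in> {1..n}" "j \<in> {1..n}" using sg by (auto simp: simple_graph_def)
      have "Inl {i, j} \<in> S2" using e by (simp add: S2_def)
      from fixS[OF this t] have "sqd {i,j} (\<gamma> t) = sqd {i,j} x1" by (simp add: D_def)
      then have "sqd {i,j} (coords (path t)) = sqd {i,j} (coords p)"
        using sqd_cong[of n "coords (path t)" "\<gamma> t" i j] sqd_cong[of n "coords p" x1 i j] ij cp by simp
      then show "dist (path t i) (path t j) = dist (p i) (p j)" by (simp add: dist_sqd[symmetric])
    qed
    ultimately have iso: "\<forall>t\<in>{0..1}. \<exists>T :: real ^ 2 \<Rightarrow> real ^ 2.
            (\<forall>x y. dist (T x) (T y) = dist x y) \<and> (\<forall>i\<in>{1..n}. path t i = T (p i))"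
      unfolding rigid_framework_def by blast
    have all: "sqd {i,j} (\<gamma> t) = sqd {i,j} (\<gamma> 0)" if t: "t \<in> {0..1}" and ij: "i \<in> {1..n}" "j \<in> {1..n}" for t i j
    proof -
      from iso t have "dist (path t i) (path t j) = dist (p i) (p j)" using ij by metis
      then have "sqd {i,j} (coords (path t)) = sqd {i,j} (coords p)" by (simp add: dist_sqd[symmetric])
      then show ?thesis
        using sqd_cong[of n "coords (path t)" "\<gamma> t" i j] sqd_cong[of n "coords p" x1 i j] ij cp \<gamma>(3) by simp
    qed
    have const: "\<gamma> 1 v = \<gamma> 0 v" if "v \<in> verts n" for v
    proof (rule pinned_const[OF \<gamma>(2) all _ _ n _ that])
      fix t :: real assume "t \<in> {0..1}"
      from fixS[OF _ this] show "\<gamma> t (1,1) = \<gamma> 0 (1,1) \<and> \<gamma> t (1,2) = \<gamma> 0 (1,2) \<and> \<gamma> t (2,1) = \<gamma> 0 (2,1)"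
        unfolding \<gamma>(3) by (force simp: S2_def pins_def D_def)
    qed (use x1h \<gamma>(3) in auto)
    have "D z (\<gamma> 1) = D z (\<gamma> 0)"
      by (rule pfun_cong[OF Dp const]) (use z B(2) in auto)
    with \<gamma>(4)[OF _ z(1), of 1] \<gamma>(1,3) show False by simp
  qed
  then have AB: "A = B" using B(1) by blast
  define E' where "E' = {e. Inl e \<in> A}"
  have E'E: "E' \<subseteq> E" using A(1) by (auto simp: E'_def S2_def)
  have "A \<subseteq> Inl ` E' \<union> Inr ` pins" using A(1) by (auto simp: E'_def S2_def)
  then have "card A \<le> card (Inl ` E' \<union> Inr ` pins :: (nat set + nat \<times> 2) set)"
    by (intro card_mono) (use finite_subset[OF E'E finE] in \<open>auto simp: pins_def\<close>)
  also have "\<dots> \<le> card (Inl ` E' :: (nat set + nat \<times> 2) set) + card (Inr ` pins :: (nat set + nat \<times> 2) set)" by (rule card_Un_le)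
  also have "\<dots> \<le> card E' + 3"
  proof -
    have "card pins = 3" by (simp add: pins_def)
    then show ?thesis by (simp add: card_image)
  qed
  finally have "2 * n \<le> card E' + 3" using AB cardB card_verts by simp
  moreover have "algindep (sqd :: nat set \<Rightarrow> (nat \<times> 2 \<Rightarrow> real) \<Rightarrow> real) E'"
    unfolding algindep_def
  proof (intro ballI impI allI)
    fix P :: "(nat set \<Rightarrow> real) \<Rightarrow> real" and y
    assume P: "P \<in> pfun E'" "\<forall>x. P (\<lambda>b. sqd b x) = 0"
    have "(\<lambda>y. P (\<lambda>e. y (Inl e))) \<in> pfun A"
      by (rule pfun_subst[OF P(1)]) (auto simp: E'_def intro: pfun.var)
    from algindepD[OF A(2) this, of "\<lambda>b. case_sum y (\<lambda>_. 0) b"] P(2) show "P y = 0"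
      by (simp add: D_def)
  qed
  ultimately show ?thesis using E'E by blast
qed

section \<open>Forests and broken circuits\<close>

text \<open>The start \<open>v\<close> of a longest path is a leaf. Another edge at \<open>v\<close>
  would lead either to a new vertex, making the path longer, or back to a vertex at position
  \<open>j \<ge> 2\<close>, closing a cycle.\<close>

lemma forest_leaf:
  assumes "finite S" "S \<noteq> {}" "\<And>e. e \<in> S \<Longrightarrow> card e = 2"
    and acyc: "\<And>vs. 3 \<le> length vs \<Longrightarrow> distinct vs \<Longrightarrow> \<not> cycle_edges vs \<subseteq> S"
  shows "\<exists>v e. {e \<in> S. v \<in> e} = {e}"
proof -
  define path where "path vs \<longleftrightarrow> distinct vs \<and> 2 \<le> length vs \<and> (\<forall>i. Suc i < length vs \<longrightarrow> {vs ! i, vs ! Suc i} \<in> S)" for vs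
  obtain e where e: "e \<in> S" using assms(2) by blast
  obtain a b where ab: "e = {a, b}" "a \<noteq> b" using assms(3)[OF e] by (auto simp: card_2_iff)
  have p0: "path [a, b]" using ab e by (auto simp: path_def)
  have bd: "length vs \<le> card (\<Union>S)" if "path vs" for vs
  proof -
    have fin: "finite (\<Union>S)"
    proof (rule finite_Union[OF assms(1)])
      fix e assume "e \<in> S"
      then show "finite e" using assms(3)[of e] by (intro card_ge_0_finite) simp
    qed
    have "set vs \<subseteq> \<Union>S"
    proof
      fix x assume "x \<in> set vs"
      then obtain i where i: "i < length vs" "vs ! i = x" by (auto simp: in_set_conv_nth)
      show "x \<in> \<Union>S"
      proof (cases "Suc i < length vs")
        case True
        then have "{vs ! i, vs ! Suc i} \<in> S" using that by (simp add: path_def)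
        with i show ?thesis by auto
      next
        case False
        moreover have "2 \<le> length vs" using that by (simp add: path_def)
        ultimately obtain j where "i = Suc j" by (cases i) auto
        then have "{vs ! j, vs ! i} \<in> S" using that i by (auto simp: path_def)
        with i show ?thesis by auto
      qed
    qed
    then have "card (set vs) \<le> card (\<Union>S)" using fin by (rule card_mono[rotated])
    then show ?thesis using that by (simp add: path_def distinct_card)
  qed
  have "\<forall>vs. path vs \<longrightarrow> length vs < Suc (card (\<Union>S))"
    by (intro allI impI le_imp_less_Suc bd)
  from ex_has_greatest_nat[of path "[a, b]" length, OF p0 this]
  obtain vs where vs: "path vs" and mx: "\<forall>ws. path ws \<longrightarrow> length ws \<le> length vs"
    by (elim exE conjE)
  define v where "v = vs ! 0"
  have len: "2 \<le> length vs" "distinct vs" "\<And>i. Suc i < length vs \<Longrightarrow> {vs ! i, vs ! Suc i} \<in> S"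
    using vs by (auto simp: path_def)
  have "f = {v, vs ! 1}" if f: "f \<in> S" "v \<in> f" for f
  proof -
    obtain w where w: "f = {v, w}" "w \<noteq> v"
      using assms(3)[OF f(1)] f(2) by (auto simp: card_2_iff)
    have "w \<in> set vs"
    proof (rule ccontr)
      assume "w \<notin> set vs"
      moreover have "{(w # vs) ! i, (w # vs) ! Suc i} \<in> S" if "Suc i < length (w # vs)" for i
        using that len(3) f(1) w(1) by (cases i) (auto simp: v_def insert_commute)
      ultimately have "path (w # vs)" using len by (auto simp: path_def)
      with mx have "length (w # vs) \<le> length vs" by (simp only:)
      then show False by simp
    qed
    then obtain j where j: "j < length vs" "w = vs ! j" by (auto simp: in_set_conv_nth)
    then have j0: "j \<noteq> 0" using w(2) by (cases j) (auto simp: v_def)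
    have "j < 2"
    proof (rule ccontr)
      assume "\<not> j < 2"
      define c where "c = take (Suc j) vs"
      have c: "length c = Suc j" "distinct c" using j len by (auto simp: c_def)
      have "{c ! i, c ! (Suc i mod length c)} \<in> S" if "i < length c" for i
      proof (cases "i = j")
        case True
        then show ?thesis using f w j c by (simp add: c_def v_def insert_commute)
      next
        case False
        then show ?thesis using that j len(3)[of i] c by (simp add: c_def)
      qed
      then have "cycle_edges c \<subseteq> S" by (auto simp: cycle_edges_def)
      moreover have "3 \<le> length c" using \<open>\<not> j < 2\<close> c by simp
      ultimately show False using acyc c by blast
    qed
    with j0 have "j = 1" by simp
    then show ?thesis using w j by simp
  qed
  moreover have "{v, vs ! 1} \<in> S" using len(3)[of 0] len(1) by (simp add: v_def)
  ultimately have "{e \<in> S. v \<in> e} = {{v, vs ! 1}}" by blast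
  then show ?thesis by blast
qed

text \<open>Deleting a leaf takes away one vertex and one edge, which preserves the strict
  inequality down to the case without edges.\<close>

lemma forest_card:
  assumes "finite W" "W \<noteq> {}" "\<Union>S \<subseteq> W" "\<And>e. e \<in> S \<Longrightarrow> card e = 2"
    and "\<And>vs. 3 \<le> length vs \<Longrightarrow> distinct vs \<Longrightarrow> \<not> cycle_edges vs \<subseteq> S"
  shows "card S < card W"
  using assms
proof (induction "card W" arbitrary: W S rule: less_induct)
  case less
  have "S \<subseteq> Pow W" using less.prems(3) by auto
  then have fS: "finite S" using less.prems(1) finite_subset by blast
  show ?case
  proof (cases "S = {}")
    case True
    then show ?thesis using less.prems by (simp add: card_gt_0_iff)
  next
    case False
    obtain v e where ve: "{e \<in> S. v \<in> e} = {e}"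
      using forest_leaf[OF fS False less.prems(4,5)] by blast
    then have e: "e \<in> S" "v \<in> e" by auto
    have "card (S - {e}) < card (W - {v})"
    proof (rule less.hyps)
      show "card (W - {v}) < card W" using e less.prems(1,3) by (intro psubset_card_mono) auto
      obtain w where "w \<in> e" "w \<noteq> v" using less.prems(4)[OF e(1)] e(2) by (auto simp: card_2_iff)
      then show "W - {v} \<noteq> {}" using e less.prems(3) by auto
      show "\<Union> (S - {e}) \<subseteq> W - {v}" using ve less.prems(3) by auto
      show "\<not> cycle_edges vs \<subseteq> S - {e}" if "3 \<le> length vs" "distinct vs" for vs
        using less.prems(5)[OF that] by auto
    qed (use less.prems in auto)
    moreover have "v \<in> W" using e less.prems(3) by auto
    ultimately show ?thesis using e fS less.prems(1)
      by (simp add: card_Diff_singleton)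
  qed
qed

lemma indep_graphic_iff:
  "indep (graphic_matroid E) S \<longleftrightarrow> S \<subseteq> E \<and> (\<forall>vs. 3 \<le> length vs \<longrightarrow> distinct vs \<longrightarrow> \<not> cycle_edges vs \<subseteq> S)"
proof
  assume "indep (graphic_matroid E) S"
  then have S: "S \<subseteq> E" and *: "\<And>C. C \<in> circuits (graphic_matroid E) \<Longrightarrow> \<not> C \<subseteq> S"
    by (auto simp: indep_def graphic_matroid_def)
  have "\<not> cycle_edges vs \<subseteq> S" if "3 \<le> length vs" "distinct vs" for vs
  proof
    assume "cycle_edges vs \<subseteq> S"
    moreover from this S have "cycle_edges vs \<in> circuits (graphic_matroid E)"
      using that by (auto simp: graphic_matroid_def)
    ultimately show False using * by blast
  qed
  with S show "S \<subseteq> E \<and> (\<forall>vs. 3 \<le> length vs \<longrightarrow> distinct vs \<longrightarrow> \<not> cycle_edges vs \<subseteq> S)" by blast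
qed (auto simp: indep_def graphic_matroid_def)

lemma indep_graphic_card:
  assumes "simple_graph n E" "n \<ge> 1" "indep (graphic_matroid E) S"
  shows "card S < n"
proof -
  have "card S < card {1..n}"
    by (rule forest_card) (use assms in \<open>auto simp: indep_graphic_iff simple_graph_def\<close>)
  then show ?thesis by simp
qed

lemma basis_graphic:
  assumes "simple_graph n E" "n \<ge> 1" "indep (graphic_matroid E) S" "card S = n - 1"
  shows "basis (graphic_matroid E) S"
  unfolding basis_def
proof (intro conjI allI impI)
  fix I assume I: "indep (graphic_matroid E) I \<and> S \<subseteq> I"
  then have "I \<subseteq> E" by (simp add: indep_graphic_iff)
  then have "finite I" using finite_simple_graph[OF assms(1)] finite_subset by blast
  moreover have "card I \<le> card S" using indep_graphic_card[OF assms(1,2)] I assms(2,4) by fastforce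
  ultimately show "I = S" using I card_seteq by blast
qed (use assms in simp)

text \<open>The condition on broken circuits for arbitrary sets, since supports of monomials need
  not be bases.\<close>

definition nbc_free :: "('a \<times> 'a) set \<Rightarrow> 'a matroid \<Rightarrow> 'a set \<Rightarrow> bool" where
  "nbc_free r M S \<longleftrightarrow> (\<forall>D. broken_circuit r M D \<longrightarrow> \<not> D \<subseteq> S)"

lemma linear_order_min:
  assumes "linear_order_on E r" "finite C" "C \<noteq> {}" "C \<subseteq> E"
  shows "\<exists>m\<in>C. \<forall>f\<in>C. (m, f) \<in> r"
  using assms(2,3,4)
proof (induction C rule: finite_ne_induct)
  case (singleton x)
  then show ?case using assms(1) by (auto simp: order_on_defs refl_on_def)
next
  case (insert x F)
  then obtain m where m: "m \<in> F" "\<forall>f\<in>F. (m, f) \<in> r" by auto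
  have x: "(x, x) \<in> r" using assms(1) insert.prems by (auto simp: order_on_defs refl_on_def)
  have tr: "trans r" using assms(1) by (auto simp: order_on_defs)
  have "x \<noteq> m" using m insert by auto
  then have "(x, m) \<in> r \<or> (m, x) \<in> r"
    using assms(1) m insert.prems by (auto simp: order_on_defs total_on_def)
  then show ?case
  proof
    assume "(x, m) \<in> r"
    then have "\<forall>f\<in>insert x F. (x, f) \<in> r" using m x tr by (auto dest: transD)
    then show ?thesis by blast
  next
    assume "(m, x) \<in> r"
    then show ?thesis using m by (intro bexI[of _ m]) auto
  qed
qed

text \<open>A circuit inside \<open>S\<close> would bring along its broken circuit; circuits are
  finite and nonempty, so the least element exists.\<close>

lemma nbc_free_indep:
  assumes "linear_order_on E r" "S \<subseteq> E" "nbc_free r (graphic_matroid E) S"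
  shows "indep (graphic_matroid E) S"
  unfolding indep_def
proof (intro conjI ballI notI)
  show "S \<subseteq> ground (graphic_matroid E)" using assms by (simp add: graphic_matroid_def)
  fix C assume C: "C \<in> circuits (graphic_matroid E)" "C \<subseteq> S"
  then obtain vs where vs: "C = cycle_edges vs" "3 \<le> length vs" by (auto simp: graphic_matroid_def)
  have "C = (\<lambda>i. {vs ! i, vs ! (Suc i mod length vs)}) ` {..<length vs}"
    unfolding vs(1) cycle_edges_def by auto
  then have "finite C" "C \<noteq> {}" using vs(2) by (auto simp: lessThan_empty_iff)
  from linear_order_min[OF assms(1) this] C(2) assms(2)
  obtain m where "m \<in> C" "\<forall>f\<in>C. (m, f) \<in> r" by blast
  then have "broken_circuit r (graphic_matroid E) (C - {m})"
    using C(1) unfolding broken_circuit_def by blast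
  then show False using assms(3) C(2) unfolding nbc_free_def by blast
qed

section \<open>Counting monomials\<close>

text \<open>Exponents vanish off \<open>S\<close>, so that each monomial has a single exponent
  function. The total degree is bounded because this is the degree that the circuit relations
  preserve.\<close>

definition Gam :: "'e set \<Rightarrow> nat \<Rightarrow> ('e \<Rightarrow> nat) set" where
  "Gam S d = {\<gamma>. (\<forall>e. e \<notin> S \<longrightarrow> \<gamma> e = 0) \<and> sum \<gamma> S \<le> d}"

lemma Gam_card_le:
  assumes "finite S" shows "finite (Gam S d) \<and> card (Gam S d) \<le> (d + 1) ^ card S"
proof -
  have inj: "inj_on (\<lambda>\<gamma>. restrict \<gamma> S) (Gam S d)"
  proof (rule inj_onI)
    fix \<gamma> \<gamma>' assume g: "\<gamma> \<in> Gam S d" "\<gamma>' \<in> Gam S d" "restrict \<gamma> S = restrict \<gamma>' S"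
    show "\<gamma> = \<gamma>'"
    proof
      fix e show "\<gamma> e = \<gamma>' e"
      proof (cases "e \<in> S")
        case True
        then show ?thesis using fun_cong[OF g(3), of e] by simp
      qed (use g in \<open>auto simp: Gam_def\<close>)
    qed
  qed
  have sub: "(\<lambda>\<gamma>. restrict \<gamma> S) ` Gam S d \<subseteq> S \<rightarrow>\<^sub>E {..d}"
  proof
    fix x assume "x \<in> (\<lambda>\<gamma>. restrict \<gamma> S) ` Gam S d"
    then obtain \<gamma> where \<gamma>: "x = restrict \<gamma> S" "sum \<gamma> S \<le> d" by (auto simp: Gam_def)
    have "\<gamma> e \<le> d" if "e \<in> S" for e
      using member_le_sum[of e S \<gamma>] that assms \<gamma>(2) by simp
    then show "x \<in> S \<rightarrow>\<^sub>E {..d}" by (auto simp: \<gamma>(1))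
  qed
  have fin: "finite (S \<rightarrow>\<^sub>E {..d})" using assms by (simp add: finite_PiE)
  have "finite (Gam S d)" using inj sub fin finite_imageD finite_subset by blast
  moreover have "card (Gam S d) \<le> card (S \<rightarrow>\<^sub>E {..d})"
    using card_inj_on_le[OF inj sub fin] .
  ultimately show ?thesis using assms by (simp add: card_funcsetE)
qed

lemmas finite_Gam = Gam_card_le[THEN conjunct1]

lemma Gam_card_ge:
  assumes "finite S" shows "(j + 1) ^ card S \<le> card (Gam S (card S * j))"
proof -
  define h where "h \<gamma> = (\<lambda>e. if e \<in> S then \<gamma> e else 0)" for \<gamma> :: "'a \<Rightarrow> nat"
  have "inj_on h (S \<rightarrow>\<^sub>E {..j})"
  proof (rule inj_onI)
    fix \<gamma> \<gamma>' assume g: "\<gamma> \<in> S \<rightarrow>\<^sub>E {..j}" "\<gamma>' \<in> S \<rightarrow>\<^sub>E {..j}" "h \<gamma> = h \<gamma>'"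
    show "\<gamma> = \<gamma>'"
    proof (rule PiE_ext[OF g(1,2)])
      fix e assume "e \<in> S" then show "\<gamma> e = \<gamma>' e" using fun_cong[OF g(3), of e] by (simp add: h_def)
    qed
  qed
  moreover have "h ` (S \<rightarrow>\<^sub>E {..j}) \<subseteq> Gam S (card S * j)"
  proof
    fix x assume "x \<in> h ` (S \<rightarrow>\<^sub>E {..j})"
    then obtain \<gamma> where \<gamma>: "x = h \<gamma>" "\<gamma> \<in> S \<rightarrow>\<^sub>E {..j}" by auto
    have "sum x S = sum \<gamma> S" unfolding \<gamma>(1) by (rule sum.cong) (auto simp: h_def)
    also have "\<dots> \<le> of_nat (card S) * j" by (rule sum_bounded_above) (use \<gamma>(2) in auto)
    finally show "x \<in> Gam S (card S * j)" by (auto simp: Gam_def \<gamma>(1) h_def)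
  qed
  ultimately have "card (S \<rightarrow>\<^sub>E {..j}) \<le> card (Gam S (card S * j))"
    by (rule card_inj_on_le) (rule finite_Gam[OF assms])
  then show ?thesis using assms by (simp add: card_funcsetE)
qed

lemma Gam_card_cong:
  assumes "finite S" "finite S'" "card S = card S'"
  shows "card (Gam S d) \<le> card (Gam S' d)"
proof -
  obtain h where h: "bij_betw h S' S" using assms finite_same_card_bij by metis
  define H where "H \<gamma> = (\<lambda>e. if e \<in> S' then \<gamma> (h e) else 0)" for \<gamma> :: "'a \<Rightarrow> nat"
  have "inj_on H (Gam S d)"
  proof (rule inj_onI)
    fix \<gamma> \<gamma>' assume g: "\<gamma> \<in> Gam S d" "\<gamma>' \<in> Gam S d" "H \<gamma> = H \<gamma>'"
    show "\<gamma> = \<gamma>'"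
    proof
      fix e show "\<gamma> e = \<gamma>' e"
      proof (cases "e \<in> S")
        case True
        then obtain e' where "e' \<in> S'" "e = h e'" using h by (auto simp: bij_betw_def)
        then show ?thesis using fun_cong[OF g(3), of e'] by (simp add: H_def)
      qed (use g in \<open>auto simp: Gam_def\<close>)
    qed
  qed
  moreover have "H ` Gam S d \<subseteq> Gam S' d"
  proof
    fix x assume "x \<in> H ` Gam S d"
    then obtain \<gamma> where \<gamma>: "x = H \<gamma>" "sum \<gamma> S \<le> d" by (auto simp: Gam_def)
    have "sum x S' = sum (\<lambda>e. \<gamma> (h e)) S'" unfolding \<gamma>(1) by (rule sum.cong) (auto simp: H_def)
    also have "\<dots> = sum \<gamma> S" by (rule sum.reindex_bij_betw[OF h])
    finally show "x \<in> Gam S' d" using \<gamma> by (auto simp: Gam_def H_def)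
  qed
  ultimately show ?thesis by (rule card_inj_on_le) (rule finite_Gam[OF assms(2)])
qed

text \<open>What is added has total degree exactly \<open>Suc d\<close>. Such an exponent function
  is determined by its entries off a chosen \<open>s\<close>, so there are fewer of them by one
  order of growth.\<close>

lemma Gam_card_Suc:
  assumes "finite S" "S \<noteq> {}"
  shows "card (Gam S (Suc d)) \<le> card (Gam S d) + (d + 2) ^ (card S - 1)"
proof -
  obtain s where s: "s \<in> S" using assms by blast
  define Q where "Q = {\<gamma> \<in> Gam S (Suc d). sum \<gamma> S = Suc d}"
  have "Gam S (Suc d) = Gam S d \<union> Q" by (auto simp: Gam_def Q_def)
  then have "card (Gam S (Suc d)) \<le> card (Gam S d) + card Q" by (simp add: card_Un_le)
  moreover have "card Q \<le> card (Gam (S - {s}) (Suc d))"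
  proof (rule card_inj_on_le)
    define h where "h \<gamma> = \<gamma>(s := 0)" for \<gamma> :: "'a \<Rightarrow> nat"
    have S': "sum (h \<gamma>) (S - {s}) = sum \<gamma> S - \<gamma> s" for \<gamma>
    proof -
      have "sum (h \<gamma>) (S - {s}) = sum \<gamma> (S - {s})" by (rule sum.cong) (auto simp: h_def)
      then show ?thesis using s assms(1) by (simp add: sum.remove)
    qed
    have le: "\<gamma> s \<le> sum \<gamma> S" for \<gamma> :: "'a \<Rightarrow> nat" using member_le_sum[of s S \<gamma>] s assms by simp
    show "inj_on h Q"
    proof (rule inj_onI)
      fix \<gamma> \<gamma>' assume g: "\<gamma> \<in> Q" "\<gamma>' \<in> Q" "h \<gamma> = h \<gamma>'"
      have "sum \<gamma> S - \<gamma> s = sum \<gamma>' S - \<gamma>' s" using S'[of \<gamma>] S'[of \<gamma>'] g(3) by simp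
      then have "\<gamma> s = \<gamma>' s" using g le[of \<gamma>] le[of \<gamma>'] by (simp add: Q_def)
      then show "\<gamma> = \<gamma>'" using g(3) unfolding h_def by (metis fun_upd_triv fun_upd_upd)
    qed
    show "h ` Q \<subseteq> Gam (S - {s}) (Suc d)"
    proof
      fix x assume "x \<in> h ` Q"
      then obtain \<gamma> where \<gamma>: "x = h \<gamma>" "\<gamma> \<in> Q" by auto
      have "sum x (S - {s}) \<le> Suc d" using S'[of \<gamma>] \<gamma> by (simp add: Q_def)
      moreover have "x e = 0" if "e \<notin> S - {s}" for e using that \<gamma> by (auto simp: h_def Q_def Gam_def)
      ultimately show "x \<in> Gam (S - {s}) (Suc d)" by (simp add: Gam_def)
    qed
    show "finite (Gam (S - {s}) (Suc d))" using finite_Gam assms by blast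
  qed
  moreover have "card (Gam (S - {s}) (Suc d)) \<le> (d + 2) ^ (card S - 1)"
    using Gam_card_le[of "S - {s}" "Suc d"] assms s by (simp add: card_Diff_singleton)
  ultimately show ?thesis by linarith
qed

lemma Gam_card_add:
  assumes "finite S" "S \<noteq> {}"
  shows "card (Gam S (k + l)) \<le> card (Gam S k) + l * (k + l + 1) ^ (card S - 1)"
proof (induction l)
  case (Suc l)
  have "card (Gam S (k + Suc l)) \<le> card (Gam S (k + l)) + (k + l + 2) ^ (card S - 1)"
    using Gam_card_Suc[OF assms, of "k + l"] by simp
  also have "\<dots> \<le> card (Gam S k) + l * (k + l + 1) ^ (card S - 1) + (k + l + 2) ^ (card S - 1)"
    using Suc by simp
  also have "l * (k + l + 1) ^ (card S - 1) \<le> l * (k + l + 2) ^ (card S - 1)"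
    by (intro mult_left_mono power_mono) auto
  finally show ?case by simp
qed simp

text \<open>\<open>b\<close> grows at least like \<open>k ^ N\<close>, and shifting its argument by
  the constant \<open>l\<close> costs only order \<open>N - 1\<close>. If \<open>m < K\<close>, the
  main inequality leaves at least one \<open>b k\<close> that is bounded by order
  \<open>N - 1\<close>, contradicting the lower bound.\<close>

lemma growth_comparison:
  fixes b :: "nat \<Rightarrow> nat" and N :: nat
  assumes N: "N \<ge> 1"
    and low: "\<And>j. (j + 1) ^ N \<le> b (N * j)"
    and inc: "\<And>k. b (k + l) \<le> b k + l * (k + l + 1) ^ (N - 1)"
    and main: "\<And>k. K * b k \<le> m * b (k + l) + C * (k + l + 1) ^ (N - 1)"
  shows "K \<le> m"
proof (rule ccontr)
  assume "\<not> K \<le> m"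
  then have K: "Suc m \<le> K" by simp
  define C' where "C' = m * l + C"
  have up: "b k \<le> C' * (k + l + 1) ^ (N - 1)" for k
  proof -
    have "Suc m * b k \<le> K * b k" using K by (intro mult_right_mono) auto
    also have "\<dots> \<le> m * b (k + l) + C * (k + l + 1) ^ (N - 1)" by (rule main)
    also have "m * b (k + l) \<le> m * (b k + l * (k + l + 1) ^ (N - 1))"
      by (intro mult_left_mono inc) auto
    finally show ?thesis by (simp add: C'_def algebra_simps)
  qed
  \<comment> \<open>Chosen so that the upper bound for \<open>b (N * q)\<close> becomes
    \<open>q * (q + 1) ^ (N - 1)\<close>, just short of \<open>(q + 1) ^ N\<close>.\<close>
  define q where "q = C' * (N + l + 1) ^ (N - 1)"
  have "(q + 1) ^ N \<le> b (N * q)" by (rule low)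
  also have "\<dots> \<le> C' * (N * q + l + 1) ^ (N - 1)" by (rule up)
  also have "\<dots> \<le> C' * ((N + l + 1) * (q + 1)) ^ (N - 1)"
    by (intro mult_left_mono power_mono) (auto simp: algebra_simps)
  also have "\<dots> = q * (q + 1) ^ (N - 1)"
    by (simp only: power_mult_distrib mult.assoc[symmetric] q_def[symmetric])
  also have "\<dots> < (q + 1) * (q + 1) ^ (N - 1)" by simp
  also have "\<dots> = (q + 1) ^ N" using N by (cases N) auto
  finally show False by simp
qed

section \<open>Reciprocals of edge functionals\<close>

definition el :: "nat set \<Rightarrow> (nat \<Rightarrow> complex) \<Rightarrow> complex" where
  "el e x = x (Min e) - x (Max e)"

text \<open>The reciprocals are set to zero simultaneously wherever one of the functionals vanishes, so
  that the circuit relations hold everywhere.\<close>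

definition rc :: "nat set set \<Rightarrow> nat set \<Rightarrow> (nat \<Rightarrow> complex) \<Rightarrow> complex" where
  "rc E e x = (if \<forall>f\<in>E. el f x \<noteq> 0 then 1 / el e x else 0)"

definition rmon :: "nat set set \<Rightarrow> (nat set \<Rightarrow> nat) \<Rightarrow> (nat \<Rightarrow> complex) \<Rightarrow> complex" where
  "rmon E \<gamma> x = mon E \<gamma> (\<lambda>e. rc E e x)"

text \<open>The polynomials of degree at most \<open>d\<close> in the reciprocals, as functions of
  \<open>x\<close>: a filtration of the coordinate ring of the reciprocal linear space.\<close>

definition rsp :: "nat set set \<Rightarrow> nat \<Rightarrow> ((nat \<Rightarrow> complex) \<Rightarrow> complex) set" where
  "rsp E d = fs.span (rmon E ` Gam E d)"

lemma el_pair: "el {i, j} x = (if i \<le> j then x i - x j else x j - x i)"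
  by (auto simp: el_def min_def max_def)

lemma el_linear: "el e (\<lambda>i. x i + t * d i) = el e x + t * el e d" "el e (\<lambda>i. x i - y i) = el e x - el e y"
  by (simp_all add: el_def algebra_simps)

lemma el_sum: "el e (\<lambda>i. \<Sum>f\<in>T. c f * D f i) = (\<Sum>f\<in>T. c f * el e (D f))"
  by (simp add: el_def sum_subtractf[symmetric] algebra_simps)

lemma Gam_add: "\<gamma> \<in> Gam S d \<Longrightarrow> \<gamma>' \<in> Gam S d' \<Longrightarrow> (\<lambda>e. \<gamma> e + \<gamma>' e) \<in> Gam S (d + d')"
  by (auto simp: Gam_def sum.distrib)

lemma Gam_mono: "d \<le> d' \<Longrightarrow> Gam S d \<subseteq> Gam S d'"
  by (auto simp: Gam_def)

lemma rsp_mono: "f \<in> rsp E d \<Longrightarrow> d \<le> d' \<Longrightarrow> f \<in> rsp E d'"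
  unfolding rsp_def by (erule rev_subsetD[OF _ fs.span_mono]) (intro image_mono Gam_mono)

lemma rsp_add: "f \<in> rsp E d \<Longrightarrow> g \<in> rsp E d \<Longrightarrow> (\<lambda>x. f x + g x) \<in> rsp E d"
  unfolding rsp_def using fs.span_add[of f _ g] by (simp add: plus_fun_def)

lemma rsp_scale: "f \<in> rsp E d \<Longrightarrow> (\<lambda>x. c * f x) \<in> rsp E d"
  unfolding rsp_def by (rule fs.span_scale)

lemma rsp_sum: "(\<And>i. i \<in> I \<Longrightarrow> f i \<in> rsp E d) \<Longrightarrow> (\<lambda>x. \<Sum>i\<in>I. c i * f i x) \<in> rsp E d"
  unfolding rsp_def by (rule fs_span_sum)

lemma rsp_mult:
  assumes f: "f \<in> rsp E d" and g: "g \<in> rsp E d'"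
  shows "(\<lambda>x. f x * g x) \<in> rsp E (d + d')"
proof -
  have zero: "(\<lambda>x. 0) \<in> fs.span (rmon E ` Gam E (d + d'))" using fs.span_zero by (simp add: zero_fun_def)
  have mm: "(\<lambda>x. rmon E \<gamma> x * rmon E \<gamma>' x) \<in> fs.span (rmon E ` Gam E (d + d'))"
    if "\<gamma> \<in> Gam E d" "\<gamma>' \<in> Gam E d'" for \<gamma> \<gamma>'
  proof -
    have "(\<lambda>x. rmon E \<gamma> x * rmon E \<gamma>' x) = rmon E (\<lambda>e. \<gamma> e + \<gamma>' e)"
      by (simp add: rmon_def mon_add fun_eq_iff)
    moreover have "rmon E (\<lambda>e. \<gamma> e + \<gamma>' e) \<in> fs.span (rmon E ` Gam E (d + d'))"
      by (intro fs.span_base imageI Gam_add that)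
    ultimately show ?thesis by (simp only:)
  qed
  have fm: "(\<lambda>x. f x * rmon E \<gamma>' x) \<in> fs.span (rmon E ` Gam E (d + d'))" if b: "\<gamma>' \<in> Gam E d'" for \<gamma>'
    using f unfolding rsp_def
  proof (induction rule: fs.span_induct_alt)
    case base
    show ?case using zero by simp
  next
    case (step c m h)
    then obtain \<gamma> where \<gamma>: "\<gamma> \<in> Gam E d" "m = rmon E \<gamma>" by auto
    from fs.span_add[OF fs.span_scale[OF mm[OF \<gamma>(1) b], of c] step(2)] show ?case
      by (simp add: plus_fun_def \<gamma>(2) algebra_simps)
  qed
  show ?thesis
    using g unfolding rsp_def
  proof (induction rule: fs.span_induct_alt)
    case base
    show ?case using zero by simp
  next
    case (step c m h)
    then obtain \<gamma> where \<gamma>: "\<gamma> \<in> Gam E d'" "m = rmon E \<gamma>" by auto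
    from fs.span_add[OF fs.span_scale[OF fm[OF \<gamma>(1)], of c] step(2)] show ?case
      by (simp add: plus_fun_def \<gamma>(2) algebra_simps)
  qed
qed

lemma rsp_const: "(\<lambda>x. c) \<in> rsp E 0"
proof -
  have "rmon E (\<lambda>e. 0) \<in> rsp E 0" unfolding rsp_def by (intro fs.span_base imageI) (simp add: Gam_def)
  moreover have "rmon E (\<lambda>e. 0) = (\<lambda>x. 1)" by (simp add: rmon_def mon_def fun_eq_iff)
  ultimately have "(\<lambda>x. 1) \<in> rsp E 0" by (simp only:)
  from rsp_scale[OF this, of c] show ?thesis by simp
qed

lemma rmon_indicator:
  assumes "finite E" "S \<subseteq> E"
  shows "rmon E (\<lambda>e. if e \<in> S then 1 else 0) x = (\<Prod>e\<in>S. rc E e x)"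
  unfolding rmon_def mon_def using assms by (intro prod.mono_neutral_cong_right) auto

lemma rsp_rc:
  assumes "finite E" "e \<in> E" shows "rc E e \<in> rsp E 1"
proof -
  have "rmon E (\<lambda>f. if f \<in> {e} then 1 else 0) \<in> rsp E 1"
    unfolding rsp_def by (intro fs.span_base imageI) (use assms in \<open>auto simp: Gam_def\<close>)
  moreover have "rmon E (\<lambda>f. if f \<in> {e} then 1 else 0) = rc E e"
    using rmon_indicator[OF assms(1), of "{e}"] assms by (simp add: fun_eq_iff)
  ultimately show ?thesis by (simp only:)
qed

lemma rsp_power: "f \<in> rsp E 1 \<Longrightarrow> (\<lambda>x. f x ^ k) \<in> rsp E k"
proof (induction k)
  case (Suc k)
  from rsp_mult[OF Suc.prems Suc.IH[OF Suc.prems]] show ?case by simp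
qed (use rsp_const[of 1] in simp)

lemma rsp_prod: "finite I \<Longrightarrow> (\<And>i. i \<in> I \<Longrightarrow> f i \<in> rsp E (d i)) \<Longrightarrow> (\<lambda>x. \<Prod>i\<in>I. f i x) \<in> rsp E (\<Sum>i\<in>I. d i)"
proof (induction I rule: finite_induct)
  case (insert i I)
  from rsp_mult[OF insert.prems[of i] insert.IH] insert show ?case by simp
qed (use rsp_const[of 1] in simp)

lemma rsp_mon:
  assumes "finite I" "\<And>i. i \<in> I \<Longrightarrow> \<Phi> i \<in> rsp E 1" "\<alpha> \<in> Gam I k"
  shows "(\<lambda>x. mon I \<alpha> (\<lambda>i. \<Phi> i x)) \<in> rsp E k"
proof -
  have "(\<lambda>x. \<Prod>i\<in>I. \<Phi> i x ^ \<alpha> i) \<in> rsp E (\<Sum>i\<in>I. \<alpha> i)"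
    by (rule rsp_prod[OF assms(1)]) (rule rsp_power[OF assms(2)])
  then show ?thesis using assms(3) by (auto simp: mon_def Gam_def intro: rsp_mono)
qed

text \<open>Once round the cycle the differences telescope; \<open>s\<close> records whether an edge
  is traversed from its smaller to its larger endpoint. Length at least 3 makes edges at different
  positions different, so that the sign is a function of the edge.\<close>

lemma cycle_relation:
  assumes len: "3 \<le> length vs" and dist: "distinct vs"
  shows "\<exists>s. (\<forall>e\<in>cycle_edges vs. s e * s e = 1) \<and> (\<forall>x. (\<Sum>e\<in>cycle_edges vs. s e * el e x) = 0)"
proof -
  define L where "L = length vs"
  define g where "g i = {vs ! i, vs ! (Suc i mod L)}" for i
  have C: "cycle_edges vs = g ` {..<L}" by (auto simp: cycle_edges_def g_def L_def)
  have modS: "Suc i mod L = (if Suc i = L then 0 else Suc i)" if "i < L" for i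
    using that by auto
  have modlt: "Suc i mod L < L" for i using len unfolding L_def by (intro mod_less_divisor) linarith
  have inj: "inj_on g {..<L}"
  proof (rule inj_onI)
    fix i j assume ij: "i \<in> {..<L}" "j \<in> {..<L}" "g i = g j"
    have nth: "vs ! k = vs ! k' \<longleftrightarrow> k = k'" if "k < L" "k' < L" for k k'
      using dist that by (simp add: L_def nth_eq_iff_index_eq)
    have "(vs ! i = vs ! j \<and> vs ! (Suc i mod L) = vs ! (Suc j mod L)) \<or>
        (vs ! i = vs ! (Suc j mod L) \<and> vs ! (Suc i mod L) = vs ! j)"
      using ij(3) unfolding g_def by (simp add: doubleton_eq_iff)
    then show "i = j"
    proof
      assume "vs ! i = vs ! (Suc j mod L) \<and> vs ! (Suc i mod L) = vs ! j"
      moreover have "vs ! i = vs ! (Suc j mod L) \<longleftrightarrow> i = Suc j mod L"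
        by (rule nth) (use ij modlt in simp_all)
      moreover have "vs ! (Suc i mod L) = vs ! j \<longleftrightarrow> Suc i mod L = j"
        by (rule nth) (use ij modlt in simp_all)
      ultimately have c: "i = Suc j mod L \<and> Suc i mod L = j" by blast
      have si: "(Suc j = L \<and> i = 0) \<or> i = Suc j"
        using conjunct1[OF c] modS[of j] ij(2) by (cases "Suc j = L") simp_all
      have sj: "(Suc i = L \<and> j = 0) \<or> j = Suc i"
        using conjunct2[OF c] modS[of i] ij(1) by (cases "Suc i = L") simp_all
      have "3 \<le> L" using len by (simp add: L_def)
      with si sj show ?thesis by (elim disjE conjE) linarith+
    next
      assume "vs ! i = vs ! j \<and> vs ! (Suc i mod L) = vs ! (Suc j mod L)"
      then show ?thesis using nth[of i j] ij by simp
    qed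
  qed
  define \<sigma> where "\<sigma> i = (if vs ! i \<le> vs ! (Suc i mod L) then 1 else - 1 :: complex)" for i
  define s where "s e = \<sigma> (the_inv_into {..<L} g e)" for e
  have s: "s (g i) = \<sigma> i" if "i < L" for i
    using the_inv_into_f_f[OF inj, of i] that by (simp add: s_def)
  have "(\<Sum>e\<in>cycle_edges vs. s e * el e x) = 0" for x
  proof -
    have "(\<Sum>e\<in>cycle_edges vs. s e * el e x) = (\<Sum>i<L. s (g i) * el (g i) x)"
      unfolding C by (simp add: sum.reindex[OF inj])
    also have "\<dots> = (\<Sum>i<L. x (vs ! i) - x (vs ! (Suc i mod L)))"
    proof (intro sum.cong refl)
      fix i assume "i \<in> {..<L}"
      then have "s (g i) = \<sigma> i" using s by simp
      then show "s (g i) * el (g i) x = x (vs ! i) - x (vs ! (Suc i mod L))"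
        by (simp only: \<sigma>_def) (simp add: g_def el_pair)
    qed
    also have "\<dots> = (\<Sum>i<L. x (vs ! i)) - (\<Sum>i<L. x (vs ! (Suc i mod L)))" by (rule sum_subtractf)
    also have "(\<Sum>i<L. x (vs ! (Suc i mod L))) = (\<Sum>i<L. x (vs ! i))"
    proof -
      obtain m where m: "L = Suc m" using len by (cases L) (auto simp: L_def)
      have "(\<Sum>i<L. x (vs ! (Suc i mod L))) = (\<Sum>i<m. x (vs ! Suc i)) + x (vs ! 0)"
        unfolding m by simp
      also have "\<dots> = (\<Sum>i<L. x (vs ! i))" unfolding m by (subst sum.lessThan_Suc_shift) simp
      finally show ?thesis .
    qed
    finally show ?thesis by simp
  qed
  moreover have "\<forall>e\<in>cycle_edges vs. s e * s e = 1" unfolding C by (auto simp: s \<sigma>_def)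
  ultimately show ?thesis by blast
qed

text \<open>Multiplying the linear relation of the cycle by the product of all reciprocals over
  \<open>C\<close> cancels one factor in each term. Where some functional vanishes all
  \<open>rc\<close> are zero, and both sides vanish because no product is empty.\<close>

lemma circuit_product_relation:
  assumes len: "3 \<le> length vs" "distinct vs" "C = cycle_edges vs" "C \<subseteq> E" "m \<in> C"
  shows "\<exists>c. \<forall>x. (\<Prod>f\<in>C - {m}. rc E f x) = (\<Sum>e\<in>C - {m}. c e * (\<Prod>f\<in>C - {e}. rc E f x))"
proof -
  obtain s where s: "\<forall>e\<in>C. s e * s e = 1" "\<forall>x. (\<Sum>e\<in>C. s e * el e x) = 0"
    using cycle_relation[OF len(1,2)] unfolding len(3) by (elim exE conjE)
  note s1 = bspec[OF s(1)] and s0 = spec[OF s(2)]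
  have Cimg: "C = (\<lambda>i. {vs ! i, vs ! (Suc i mod length vs)}) ` {..<length vs}"
    unfolding len(3) cycle_edges_def by auto
  have fin: "finite C" unfolding Cimg by simp
  have ne: "C - {e} \<noteq> {}" for e
  proof
    assume ee: "C - {e} = {}"
    have "{vs ! i, vs ! (Suc i mod length vs)} \<in> C" if "i < length vs" for i
      unfolding Cimg by (rule image_eqI[OF refl]) (use that in simp)
    note inC = this
    have l: "0 < length vs" "1 < length vs" using len(1) by linarith+
    have l': "Suc 0 mod length vs = 1" "Suc 1 mod length vs = 2" using len(1) by auto
    have "{vs ! 0, vs ! 1} \<in> C" "{vs ! 1, vs ! 2} \<in> C"
      using inC[OF l(1)] inC[OF l(2)] unfolding l' by simp_all
    with ee have "{vs ! 0, vs ! 1} = {vs ! 1, vs ! 2}" by blast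
    then have "vs ! 0 = vs ! 1 \<or> vs ! 0 = vs ! 2" by (simp add: doubleton_eq_iff) blast
    moreover have "vs ! 0 \<noteq> vs ! 1"
      using nth_eq_iff_index_eq[OF len(2) l] by simp
    moreover have "vs ! 0 \<noteq> vs ! 2"
      using len(1) nth_eq_iff_index_eq[OF len(2) l(1), of 2] by simp
    ultimately show False by simp
  qed
  have "(\<Prod>f\<in>C - {m}. rc E f x) = (\<Sum>e\<in>C - {m}. (- s m * s e) * (\<Prod>f\<in>C - {e}. rc E f x))" for x
  proof (cases "\<forall>f\<in>E. el f x \<noteq> 0")
    case True
    define P where "P = (\<Prod>f\<in>C. rc E f x)"
    have P: "el e x * P = (\<Prod>f\<in>C - {e}. rc E f x)" if "e \<in> C" for e
    proof -
      have "P = rc E e x * (\<Prod>f\<in>C - {e}. rc E f x)" unfolding P_def by (rule prod.remove[OF fin that])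
      moreover have "el e x * rc E e x = 1" using True that len(4) by (auto simp: rc_def)
      ultimately show ?thesis by (simp add: mult.assoc[symmetric])
    qed
    have "0 = (\<Sum>e\<in>C. s e * el e x) * P" by (simp add: s0)
    also have "\<dots> = (\<Sum>e\<in>C. s e * (\<Prod>f\<in>C - {e}. rc E f x))"
      unfolding sum_distrib_right by (intro sum.cong refl) (simp add: P[symmetric])
    also have "\<dots> = s m * (\<Prod>f\<in>C - {m}. rc E f x) + (\<Sum>e\<in>C - {m}. s e * (\<Prod>f\<in>C - {e}. rc E f x))"
      by (rule sum.remove[OF fin len(5)])
    finally have "s m * (\<Prod>f\<in>C - {m}. rc E f x) = - (\<Sum>e\<in>C - {m}. s e * (\<Prod>f\<in>C - {e}. rc E f x))"
      by (simp add: eq_neg_iff_add_eq_0)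
    then have "s m * (s m * (\<Prod>f\<in>C - {m}. rc E f x)) = s m * - (\<Sum>e\<in>C - {m}. s e * (\<Prod>f\<in>C - {e}. rc E f x))"
      by (simp only:)
    then have "(s m * s m) * (\<Prod>f\<in>C - {m}. rc E f x) = - s m * (\<Sum>e\<in>C - {m}. s e * (\<Prod>f\<in>C - {e}. rc E f x))"
      by (simp only: mult.assoc mult_minus_left mult_minus_right)
    then show ?thesis
      by (simp only: s1[OF len(5)] mult_1_left sum_distrib_left mult.assoc)
  next
    case False
    have "(\<Prod>f\<in>C - {e}. rc E f x) = 0" for e
    proof -
      obtain g0 where "g0 \<in> C - {e}" using ne by blast
      then show ?thesis using fin False by (intro prod_zero) (auto simp: rc_def)
    qed
    then show ?thesis by simp
  qed
  then show ?thesis by (intro exI[of _ "\<lambda>e. - s m * s e"] allI)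
qed

text \<open>A broken circuit in the support is traded, by the circuit relation, for terms in which
  some \<open>e\<close> is replaced by the least element \<open>m\<close> of the circuit. The degree
  is kept and the sum of exponents weighted by ranks in \<open>r\<close> decreases, so the process
  ends with supports free of broken circuits.\<close>

lemma rmon_straighten:
  assumes sg: "simple_graph n E" and r: "linear_order_on E r" and "\<gamma> \<in> Gam E d"
  shows "rmon E \<gamma> \<in> fs.span (rmon E ` {\<gamma> \<in> Gam E d. nbc_free r (graphic_matroid E) {e. \<gamma> e \<noteq> 0}})"
    (is "_ \<in> fs.span ?N")
  using assms(3)
proof (induction "\<Sum>e\<in>E. \<gamma> e * card {f \<in> E. (f, e) \<in> r}" arbitrary: \<gamma> rule: less_induct)
  case less
  define rk where "rk e = card {f \<in> E. (f, e) \<in> r}" for e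
  have finE: "finite E" by (rule finite_simple_graph[OF sg])
  show ?case
  proof (cases "nbc_free r (graphic_matroid E) {e. \<gamma> e \<noteq> 0}")
    case True
    then show ?thesis using less.prems by (intro fs.span_base) auto
  next
    case False
    then obtain C m where C: "C \<in> circuits (graphic_matroid E)" "m \<in> C" "\<forall>f\<in>C. (m, f) \<in> r"
      "C - {m} \<subseteq> {e. \<gamma> e \<noteq> 0}" unfolding nbc_free_def broken_circuit_def by blast
    then obtain vs where vs: "3 \<le> length vs" "distinct vs" "C = cycle_edges vs" "C \<subseteq> E"
      by (auto simp: graphic_matroid_def)
    obtain c where c: "\<And>x. (\<Prod>f\<in>C - {m}. rc E f x) = (\<Sum>e\<in>C - {m}. c e * (\<Prod>f\<in>C - {e}. rc E f x))"
      using circuit_product_relation[OF vs C(2)] by auto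
    have finC: "finite C" using vs(4) finE finite_subset by blast
    define ind where "ind S = (\<lambda>e. if e \<in> S then 1 else 0 :: nat)" for S :: "nat set set"
    \<comment> \<open>The exponents left after one copy of the broken circuit is split off; the
      truncated subtraction is exact because the broken circuit lies in the support.\<close>
    define \<gamma>0 where "\<gamma>0 e = \<gamma> e - ind (C - {m}) e" for e
    have \<gamma>: "\<gamma> = (\<lambda>e. \<gamma>0 e + ind (C - {m}) e)"
    proof
      fix e
      show "\<gamma> e = \<gamma>0 e + ind (C - {m}) e"
      proof (cases "e \<in> C - {m}")
        case True
        then have "\<gamma> e \<noteq> 0" using C(4) by blast
        then show ?thesis using True by (simp add: \<gamma>0_def ind_def)
      next
        case False
        then show ?thesis by (auto simp: \<gamma>0_def ind_def)
      qed
    qed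
    define \<gamma>' where "\<gamma>' e = (\<lambda>f. \<gamma>0 f + ind (C - {e}) f)" for e
    have rm: "rmon E (\<lambda>f. \<gamma>0 f + ind S f) x = rmon E \<gamma>0 x * (\<Prod>f\<in>S. rc E f x)" if "S \<subseteq> E" for S x
    proof -
      have "rmon E (\<lambda>f. \<gamma>0 f + ind S f) x = rmon E \<gamma>0 x * rmon E (ind S) x"
        by (simp add: rmon_def mon_add)
      then show ?thesis using rmon_indicator[OF finE that, of x] by (simp add: ind_def)
    qed
    have sumind: "(\<Sum>f\<in>E. ind S f * h f) = sum h S" if "S \<subseteq> E" for S and h :: "nat set \<Rightarrow> nat"
      using that finE by (intro sum.mono_neutral_cong_right) (auto simp: ind_def)
    have rke: "rk m < rk e" if "e \<in> C - {m}" for e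
      unfolding rk_def
    proof (rule psubset_card_mono)
      have tr: "trans r" "antisym r" "(e, e) \<in> r" using r that vs(4) by (auto simp: order_on_defs refl_on_def)
      have me: "(m, e) \<in> r" "e \<noteq> m" "e \<in> E" using C(3) that vs(4) by auto
      then have "{f \<in> E. (f, m) \<in> r} \<subseteq> {f \<in> E. (f, e) \<in> r}" using tr by (auto dest: transD)
      moreover have "e \<notin> {f \<in> E. (f, m) \<in> r}" using me tr by (auto dest: antisymD)
      moreover have "e \<in> {f \<in> E. (f, e) \<in> r}" using me tr by auto
      ultimately show "{f \<in> E. (f, m) \<in> r} \<subset> {f \<in> E. (f, e) \<in> r}" by blast
    qed (use finE in simp)
    have each: "rmon E (\<gamma>' e) \<in> fs.span ?N" if e: "e \<in> C - {m}" for e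
    proof (rule less.hyps)
      have sums: "(\<Sum>f\<in>E. (\<gamma>0 f + ind (C - {g}) f) * h f) = (\<Sum>f\<in>E. \<gamma>0 f * h f) + sum h (C - {g})"
        for g and h :: "nat set \<Rightarrow> nat"
      proof -
        have "C - {g} \<subseteq> E" using vs(4) by auto
        then show ?thesis by (simp add: add_mult_distrib sum.distrib sumind)
      qed
      have rem: "sum h (C - {g}) + h g = sum h C" if "g \<in> C" for g and h :: "nat set \<Rightarrow> nat"
        using sum.remove[OF finC that, of h] by simp
      have eC: "e \<in> C" using e by simp
      have "sum rk (C - {e}) < sum rk (C - {m})"
        using rem[OF eC, of rk] rem[OF C(2), of rk] rke[OF e] by linarith
      then show "(\<Sum>f\<in>E. \<gamma>' e f * card {g \<in> E. (g, f) \<in> r}) < (\<Sum>f\<in>E. \<gamma> f * card {g \<in> E. (g, f) \<in> r})"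
        unfolding \<gamma> \<gamma>'_def rk_def[symmetric] sums by simp
      have "sum (\<lambda>_. 1) (C - {e}) = (sum (\<lambda>_. 1) (C - {m}) :: nat)"
        using rem[OF eC, of "\<lambda>_. 1"] rem[OF C(2), of "\<lambda>_. 1"] by linarith
      then have "sum (\<gamma>' e) E = sum \<gamma> E"
        using sums[of e "\<lambda>_. 1"] sums[of m "\<lambda>_. 1"] unfolding \<gamma>'_def
        by (subst \<gamma>) (simp only: mult_1_right)
      moreover have "\<gamma>' e f = 0" if "f \<notin> E" for f
        using that less.prems vs(4) by (auto simp: \<gamma>'_def \<gamma>0_def ind_def Gam_def)
      ultimately show "\<gamma>' e \<in> Gam E d" using less.prems by (simp add: Gam_def)
    qed
    have "rmon E \<gamma> x = (\<Sum>e\<in>C - {m}. c e * rmon E (\<gamma>' e) x)" for x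
    proof -
      have "C - {e} \<subseteq> E" for e using vs(4) by auto
      then have "rmon E \<gamma> x = rmon E \<gamma>0 x * (\<Sum>e\<in>C - {m}. c e * (\<Prod>f\<in>C - {e}. rc E f x))"
        by (subst \<gamma>) (simp only: rm c)
      also have "\<dots> = (\<Sum>e\<in>C - {m}. c e * rmon E (\<gamma>' e) x)"
        unfolding \<gamma>'_def using \<open>\<And>e. C - {e} \<subseteq> E\<close>
        by (simp add: rm sum_distrib_left mult_ac)
      finally show ?thesis .
    qed
    then have "rmon E \<gamma> = (\<lambda>x. \<Sum>e\<in>C - {m}. c e * rmon E (\<gamma>' e) x)" by (rule ext)
    then show ?thesis using fs_span_sum[of "C - {m}" "\<lambda>e. rmon E (\<gamma>' e)" ?N c] each by (simp only:)
  qed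
qed

text \<open>The support of such a monomial is a forest. With \<open>n - 1\<close> edges it is an
  nbc-basis, and contributes as many monomials as there are on \<open>I\<close>. All other supports
  have at most \<open>n - 2\<close> edges; there are at most \<open>2 ^ card E\<close> of them and
  they matter only to lower order.\<close>

lemma nbc_free_monomials_card:
  assumes sg: "simple_graph n E" and r: "linear_order_on E r" and n: "n \<ge> 2" and I: "finite I" "card I = n - 1"
  shows "card {\<gamma> \<in> Gam E d. nbc_free r (graphic_matroid E) {e. \<gamma> e \<noteq> 0}}
    \<le> nbc r (graphic_matroid E) * card (Gam I d) + 2 ^ card E * (d + 1) ^ (n - 1 - 1)"
proof -
  have finE: "finite E" by (rule finite_simple_graph[OF sg])
  define Bs where "Bs = {B. nbc_basis r (graphic_matroid E) B}"
  define Ss where "Ss = {S. S \<subseteq> E \<and> card S \<le> n - 1 - 1}"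
  have BsE: "Bs \<subseteq> Pow E" by (auto simp: Bs_def nbc_basis_def basis_def indep_def graphic_matroid_def)
  have finB: "finite Bs" "finite Ss" using finite_subset[OF BsE] finE by (auto simp: Ss_def)
  define Bs' where "Bs' = {B \<in> Bs. card B = n - 1}"
  have sub: "{\<gamma> \<in> Gam E d. nbc_free r (graphic_matroid E) {e. \<gamma> e \<noteq> 0}}
    \<subseteq> (\<Union>S\<in>Bs'. Gam S d) \<union> (\<Union>S\<in>Ss. Gam S d)"
  proof
    fix \<gamma> assume "\<gamma> \<in> {\<gamma> \<in> Gam E d. nbc_free r (graphic_matroid E) {e. \<gamma> e \<noteq> 0}}"
    then have \<gamma>: "\<gamma> \<in> Gam E d" "nbc_free r (graphic_matroid E) {e. \<gamma> e \<noteq> 0}" by auto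
    define S where "S = {e. \<gamma> e \<noteq> 0}"
    have SE: "S \<subseteq> E" using \<gamma>(1) by (auto simp: S_def Gam_def)
    have "sum \<gamma> S = sum \<gamma> E" by (rule sum.mono_neutral_left[OF finE SE]) (auto simp: S_def)
    then have \<gamma>S: "\<gamma> \<in> Gam S d" using \<gamma>(1) by (auto simp: Gam_def S_def)
    have ind: "indep (graphic_matroid E) S" using nbc_free_indep[OF r SE] \<gamma>(2) by (simp add: S_def)
    have "card S < n" using indep_graphic_card[OF sg _ ind] n by simp
    then consider "card S = n - 1" | "card S \<le> n - 1 - 1" using n by linarith
    then show "\<gamma> \<in> (\<Union>S\<in>Bs'. Gam S d) \<union> (\<Union>S\<in>Ss. Gam S d)"
    proof cases
      case 1
      then have "S \<in> Bs'" using basis_graphic[OF sg _ ind 1] n \<gamma>(2)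
        by (simp add: Bs'_def Bs_def nbc_basis_def nbc_free_def S_def)
      then show ?thesis using \<gamma>S by blast
    next
      case 2
      then have "S \<in> Ss" using SE by (simp add: Ss_def)
      then show ?thesis using \<gamma>S by blast
    qed
  qed
  have finS: "finite S" if "S \<in> Bs' \<or> S \<in> Ss" for S
    using that BsE finE finite_subset by (auto simp: Bs'_def Ss_def)
  have "card {\<gamma> \<in> Gam E d. nbc_free r (graphic_matroid E) {e. \<gamma> e \<noteq> 0}}
    \<le> card ((\<Union>S\<in>Bs'. Gam S d) \<union> (\<Union>S\<in>Ss. Gam S d))"
    by (rule card_mono[OF _ sub]) (use finB finS finite_Gam in \<open>auto simp: Bs'_def\<close>)
  also have "\<dots> \<le> card (\<Union>S\<in>Bs'. Gam S d) + card (\<Union>S\<in>Ss. Gam S d)" by (rule card_Un_le)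
  also have "\<dots> \<le> (\<Sum>S\<in>Bs'. card (Gam S d)) + (\<Sum>S\<in>Ss. card (Gam S d))"
    by (intro add_mono card_UN_le) (use finB in \<open>auto simp: Bs'_def\<close>)
  also have "(\<Sum>S\<in>Bs'. card (Gam S d)) \<le> of_nat (card Bs') * card (Gam I d)"
  proof (rule sum_bounded_above)
    fix S assume "S \<in> Bs'"
    then show "card (Gam S d) \<le> card (Gam I d)"
      using finS[of S] I by (intro Gam_card_cong) (auto simp: Bs'_def)
  qed
  also have "\<dots> \<le> card Bs * card (Gam I d)"
    using finB by (auto simp: Bs'_def intro!: mult_right_mono card_mono)
  also have "(\<Sum>S\<in>Ss. card (Gam S d)) \<le> of_nat (card Ss) * (d + 1) ^ (n - 1 - 1)"
  proof (rule sum_bounded_above)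
    fix S assume S: "S \<in> Ss"
    have "card (Gam S d) \<le> (d + 1) ^ card S" using Gam_card_le finS S by blast
    also have "\<dots> \<le> (d + 1) ^ (n - 1 - 1)" using S by (intro power_increasing) (auto simp: Ss_def)
    finally show "card (Gam S d) \<le> (d + 1) ^ (n - 1 - 1)" .
  qed
  also have "\<dots> \<le> 2 ^ card E * (d + 1) ^ (n - 1 - 1)"
  proof -
    have "card Ss \<le> card (Pow E)" by (rule card_mono) (use finE in \<open>auto simp: Ss_def\<close>)
    then show ?thesis using finE by (simp add: card_Pow)
  qed
  finally show ?thesis by (simp add: nbc_def Bs_def)
qed

section \<open>Counting nondegenerate solutions\<close>

text \<open>A relation among products of powers of functions vanishing at a common fibre and functions
  separating its points is tested on its terms of lowest order.\<close>

lemma lowest_order_indep: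
  fixes \<Phi> :: "'i \<Rightarrow> 'x \<Rightarrow> complex" and f :: "'z \<Rightarrow> 'x \<Rightarrow> complex"
  assumes fin: "finite Z" "finite I"
    and curve: "\<And>z w. z \<in> Z \<Longrightarrow> \<exists>c :: complex \<Rightarrow> 'x. (\<forall>i\<in>I. ((\<lambda>t. \<Phi> i (c t) / t) \<longlongrightarrow> w i) (at 0)) \<and>
      (\<forall>z'\<in>Z. ((\<lambda>t. f z' (c t)) \<longlongrightarrow> (if z' = z then 1 else 0)) (at 0))"
    and rel: "\<And>x. (\<Sum>z\<in>Z. \<Sum>\<alpha>\<in>Gam I k. \<kappa> z \<alpha> * (mon I \<alpha> (\<lambda>i. \<Phi> i x) * f z x)) = 0"
  shows "\<forall>z\<in>Z. \<forall>\<alpha>\<in>Gam I k. \<kappa> z \<alpha> = 0"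
proof (rule ccontr)
  assume "\<not> ?thesis"
  then have ex: "\<exists>m. \<exists>z\<in>Z. \<exists>\<alpha>\<in>Gam I k. \<kappa> z \<alpha> \<noteq> 0 \<and> sum \<alpha> I = m" by blast
  define m where "m = (LEAST m. \<exists>z\<in>Z. \<exists>\<alpha>\<in>Gam I k. \<kappa> z \<alpha> \<noteq> 0 \<and> sum \<alpha> I = m)"
  have "\<exists>z\<in>Z. \<exists>\<alpha>\<in>Gam I k. \<kappa> z \<alpha> \<noteq> 0 \<and> sum \<alpha> I = m" unfolding m_def by (rule LeastI_ex[OF ex])
  then obtain z \<alpha>0 where z: "z \<in> Z" and \<alpha>0: "\<alpha>0 \<in> Gam I k" "\<kappa> z \<alpha>0 \<noteq> 0" "sum \<alpha>0 I = m"
    by (elim bexE conjE)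
  have low: "\<kappa> z' \<alpha> = 0" if "z' \<in> Z" "\<alpha> \<in> Gam I k" "sum \<alpha> I < m" for z' \<alpha>
    using not_less_Least[OF that(3)[unfolded m_def]] that by blast
  have finG: "finite (Gam I k)" by (rule finite_Gam[OF fin(2)])
  define A where "A = {\<alpha> \<in> Gam I k. sum \<alpha> I = m}"
  have "(\<Sum>\<alpha>\<in>A. \<kappa> z \<alpha> * mon I \<alpha> w) = 0" for w
  proof -
    obtain c where c1: "\<forall>i\<in>I. ((\<lambda>t. \<Phi> i (c t) / t) \<longlongrightarrow> w i) (at 0)"
      and c2: "\<forall>z'\<in>Z. ((\<lambda>t. f z' (c t)) \<longlongrightarrow> (if z' = z then 1 else 0)) (at 0)"
      using curve[OF z, of w] by (elim exE conjE)
    \<comment> \<open>After division by \<open>t ^ m\<close>, terms of higher order tend to 0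
      through \<open>t ^ j\<close>, and terms of other points \<open>z'\<close> through
      \<open>f z'\<close>. What survives along the curve through \<open>z\<close> is a combination
      of monomials in the arbitrary vector \<open>w\<close>.\<close>
    have lim: "((\<lambda>t. \<kappa> z' \<alpha> * (mon I \<alpha> (\<lambda>i. \<Phi> i (c t)) * f z' (c t)) / t ^ m) \<longlongrightarrow>
        (if z' = z \<and> sum \<alpha> I = m then \<kappa> z \<alpha> * mon I \<alpha> w else 0)) (at 0)"
      if z': "z' \<in> Z" and \<alpha>: "\<alpha> \<in> Gam I k" for z' \<alpha>
    proof (cases "sum \<alpha> I < m")
      case True
      then show ?thesis using low[OF z' \<alpha>] by simp
    next
      case False
      define j where "j = sum \<alpha> I - m"
      have j: "sum \<alpha> I = m + j" using False by (simp add: j_def)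
      have "((\<lambda>t. \<kappa> z' \<alpha> * (mon I \<alpha> (\<lambda>i. \<Phi> i (c t) / t) * t ^ j * f z' (c t))) \<longlongrightarrow>
          \<kappa> z' \<alpha> * (mon I \<alpha> w * 0 ^ j * (if z' = z then 1 else 0))) (at 0)"
        unfolding mon_def
        by (intro tendsto_mult tendsto_const tendsto_prod tendsto_power tendsto_ident_at bspec[OF c1] bspec[OF c2] z')
      moreover have "\<kappa> z' \<alpha> * (mon I \<alpha> w * 0 ^ j * (if z' = z then 1 else 0)) =
         (if z' = z \<and> sum \<alpha> I = m then \<kappa> z \<alpha> * mon I \<alpha> w else 0)"
        using j by (simp add: power_0_left)
      moreover have "\<forall>\<^sub>F t in at 0. \<kappa> z' \<alpha> * (mon I \<alpha> (\<lambda>i. \<Phi> i (c t) / t) * t ^ j * f z' (c t)) =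
         \<kappa> z' \<alpha> * (mon I \<alpha> (\<lambda>i. \<Phi> i (c t)) * f z' (c t)) / t ^ m"
      proof -
        have "mon I \<alpha> (\<lambda>i. \<Phi> i (c t) / t) * t ^ j = mon I \<alpha> (\<lambda>i. \<Phi> i (c t)) / t ^ m" if "t \<noteq> 0" for t
        proof -
          have "mon I \<alpha> (\<lambda>i. \<Phi> i (c t) / t) = mon I \<alpha> (\<lambda>i. \<Phi> i (c t)) / t ^ (m + j)"
            unfolding mon_def power_divide prod_dividef power_sum[symmetric] j ..
          then show ?thesis using that by (simp add: power_add)
        qed
        then show ?thesis by (auto simp: eventually_at_filter)
      qed
      ultimately show ?thesis using Lim_transform_eventually by fastforce
    qed
    have "((\<lambda>t. \<Sum>z'\<in>Z. \<Sum>\<alpha>\<in>Gam I k. \<kappa> z' \<alpha> * (mon I \<alpha> (\<lambda>i. \<Phi> i (c t)) * f z' (c t)) / t ^ m) \<longlongrightarrow>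
        (\<Sum>z'\<in>Z. \<Sum>\<alpha>\<in>Gam I k. if z' = z \<and> sum \<alpha> I = m then \<kappa> z \<alpha> * mon I \<alpha> w else 0)) (at 0)"
      by (intro tendsto_sum lim)
    moreover have "(\<lambda>t. \<Sum>z'\<in>Z. \<Sum>\<alpha>\<in>Gam I k. \<kappa> z' \<alpha> * (mon I \<alpha> (\<lambda>i. \<Phi> i (c t)) * f z' (c t)) / t ^ m) = (\<lambda>t. 0)"
      using rel by (simp add: sum_divide_distrib[symmetric])
    moreover have "(\<Sum>z'\<in>Z. \<Sum>\<alpha>\<in>Gam I k. if z' = z \<and> sum \<alpha> I = m then \<kappa> z \<alpha> * mon I \<alpha> w else 0)
        = (\<Sum>\<alpha>\<in>A. \<kappa> z \<alpha> * mon I \<alpha> w)"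
    proof -
      have "(\<Sum>z'\<in>Z. \<Sum>\<alpha>\<in>Gam I k. if z' = z \<and> sum \<alpha> I = m then \<kappa> z \<alpha> * mon I \<alpha> w else 0)
        = (\<Sum>z'\<in>Z. if z' = z then \<Sum>\<alpha>\<in>Gam I k. if sum \<alpha> I = m then \<kappa> z \<alpha> * mon I \<alpha> w else 0 else 0)"
        by (intro sum.cong refl) auto
      also have "\<dots> = (\<Sum>\<alpha>\<in>Gam I k. if sum \<alpha> I = m then \<kappa> z \<alpha> * mon I \<alpha> w else 0)" using z fin by simp
      also have "\<dots> = (\<Sum>\<alpha>\<in>A. \<kappa> z \<alpha> * mon I \<alpha> w)" unfolding A_def by (rule sum.inter_filter[OF finG, symmetric])
      finally show ?thesis .
    qed
    ultimately have "((\<lambda>t::complex. 0::complex) \<longlongrightarrow> (\<Sum>\<alpha>\<in>A. \<kappa> z \<alpha> * mon I \<alpha> w)) (at 0)" by (simp only:)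
    then have "0 = (\<Sum>\<alpha>\<in>A. \<kappa> z \<alpha> * mon I \<alpha> w)"
      by (simp add: tendsto_const_iff)
    then show ?thesis by (rule sym)
  qed
  moreover have "\<alpha> = \<beta>" if "\<alpha> \<in> A" "\<beta> \<in> A" "\<forall>i\<in>I. \<alpha> i = \<beta> i" for \<alpha> \<beta>
  proof
    fix i show "\<alpha> i = \<beta> i" using that by (cases "i \<in> I") (auto simp: A_def Gam_def)
  qed
  moreover have "finite A" using finG by (simp add: A_def)
  ultimately have "\<forall>\<alpha>\<in>A. \<kappa> z \<alpha> = 0" using mon_indep[OF fin(2), of A "\<kappa> z"] by simp
  with \<alpha>0 show False by (simp add: A_def)
qed

text \<open>An edge can be read off from its functional by evaluation at unit vectors, so different
  edges have different functionals.\<close>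

lemma el_delta:
  assumes "simple_graph n E" "e \<in> E"
  shows "e = {i. el e (\<lambda>j. if j = i then 1 else 0) \<noteq> 0}"
proof -
  obtain i j where ij: "e = {i, j}" "i < j" "Min e = i" "Max e = j"
    by (rule simple_graph_edge[OF assms])
  have "el e (\<lambda>j. if j = k then 1 else 0) \<noteq> 0 \<longleftrightarrow> k = i \<or> k = j" for k
    using ij(2) by (simp add: el_def ij(3,4))
  then show ?thesis using ij(1) by auto
qed

lemma el_expand:
  assumes "simple_graph n E" "e \<in> E" "a \<in> {1..n}" "d a = 0"
  shows "el e d = (\<Sum>i\<in>{1..n} - {a}. d i * el e (\<lambda>j. if j = i then 1 else 0))"
proof -
  obtain i j where ij: "i \<in> {1..n}" "j \<in> {1..n}" "Min e = i" "Max e = j"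
    using simple_graph_edge[OF assms(1,2)] by metis
  have s: "d i = (\<Sum>k\<in>{1..n} - {a}. d k * (if i = k then 1 else 0))" if "i \<in> {1..n}" for i
  proof (cases "i = a")
    case True
    then show ?thesis using assms(4) by (subst sum.neutral) auto
  next
    case False
    then show ?thesis using that by (simp add: if_distrib sum.delta cong: if_cong)
  qed
  have "el e d = (\<Sum>k\<in>{1..n} - {a}. d k * (if i = k then 1 else 0)) - (\<Sum>k\<in>{1..n} - {a}. d k * (if j = k then 1 else 0))"
    using s[OF ij(1)] s[OF ij(2)] by (simp only: el_def ij(3,4))
  then show ?thesis by (simp only: el_def ij(3,4) sum_subtractf[symmetric] right_diff_distrib)
qed

text \<open>A spanning tree found by linear algebra: the functionals of \<open>T\<close> form a
  basis of the span of all edge functionals, extended from that of \<open>e0\<close>. All of these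
  are combinations of the \<open>n - 1\<close> functions \<open>x i - x a\<close>, and a trivial
  common kernel requires that many.\<close>

lemma spanning_edges:
  assumes sg: "simple_graph n E" and a: "a \<in> {1..n}" and e0: "e0 \<in> E"
    and conn: "\<And>d. \<forall>e\<in>E. el e d = 0 \<Longrightarrow> d a = 0 \<Longrightarrow> \<forall>i\<in>{1..n}. d i = 0"
  shows "\<exists>T\<subseteq>E. e0 \<in> T \<and> card T = n - 1 \<and> (\<forall>d. (\<forall>e\<in>T. el e d = 0) \<longrightarrow> d a = 0 \<longrightarrow> (\<forall>i\<in>{1..n}. d i = 0))"
proof -
  have finE: "finite E" by (rule finite_simple_graph[OF sg])
  have inj: "inj_on el E"
  proof (rule inj_onI)
    fix e f assume ef: "e \<in> E" "f \<in> E" "el e = el f"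
    show "e = f" using el_delta[OF sg ef(1)] el_delta[OF sg ef(2)] ef(3) by simp
  qed
  obtain i j where ij: "i < j" "Min e0 = i" "Max e0 = j" using simple_graph_edge[OF sg e0] by metis
  have "el e0 (\<lambda>k. if k = i then 1 else 0) = 1" using ij by (simp add: el_def)
  then have ne: "el e0 \<noteq> (\<lambda>x. 0)" by auto
  have "fs.independent {el e0}" using ne by (simp add: zero_fun_def)
  then obtain T' where T': "{el e0} \<subseteq> T'" "T' \<subseteq> el ` E" "fs.independent T'" "el ` E \<subseteq> fs.span T'"
    using fs.maximal_independent_subset_extend[of "{el e0}" "el ` E"] e0 by blast
  define T where "T = {e \<in> E. el e \<in> T'}"
  have TE: "T \<subseteq> E" by (auto simp: T_def)
  have T'T: "T' = el ` T" using T'(2) by (auto simp: T_def)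
  have finT: "finite T" using TE finE finite_subset by blast
  have cardT: "card T = card T'" unfolding T'T using inj_on_subset[OF inj TE] by (simp add: card_image)
  have ker: "\<forall>i\<in>{1..n}. d i = 0" if d: "\<forall>e\<in>T. el e d = 0" "d a = 0" for d
  proof (rule conn)
    show "d a = 0" by (rule d(2))
    have "f d = 0" if "f \<in> fs.span T'" for f
      using that
    proof (induction rule: fs.span_induct_alt)
      case (step c g h)
      then show ?case using d(1) by (auto simp: T'T)
    qed simp
    then show "\<forall>e\<in>E. el e d = 0" using T'(4) by blast
  qed
  have "card T = n - 1"
  proof (rule antisym)
    define V where "V = (\<lambda>i x. x i - x a :: complex) ` ({1..n} - {a})"
    have "el e \<in> fs.span V" if e: "e \<in> E" for e
    proof -
      have b: "(\<lambda>x. x i - x a) \<in> fs.span V" if "i \<in> {1..n}" for i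
      proof (cases "i = a")
        case True
        then show ?thesis using fs.span_zero[of V] by (simp add: zero_fun_def)
      next
        case False
        then show ?thesis using that by (intro fs.span_base) (auto simp: V_def)
      qed
      obtain i j where ij: "i \<in> {1..n}" "j \<in> {1..n}" "Min e = i" "Max e = j"
        using simple_graph_edge[OF sg e] by metis
      have "el e = (\<lambda>x. x i - x a) - (\<lambda>x. x j - x a)" using ij by (simp add: el_def fun_eq_iff)
      moreover have "(\<lambda>x. x i - x a) - (\<lambda>x. x j - x a) \<in> fs.span V"
        by (rule fs.span_diff[OF b[OF ij(1)] b[OF ij(2)]])
      ultimately show ?thesis by (simp only:)
    qed
    then have "T' \<subseteq> fs.span V" using T'(2) by blast
    moreover have "finite V" by (simp add: V_def)
    ultimately have "card T' \<le> card V" using fs.independent_span_bound[OF _ T'(3)] by blast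
    also have "\<dots> \<le> card ({1..n} - {a})" unfolding V_def by (rule card_image_le) simp
    also have "\<dots> = n - 1" using a by (simp add: card_Diff_singleton)
    finally show "card T \<le> n - 1" using cardT by simp
    show "n - 1 \<le> card T"
    proof (rule ccontr)
      assume "\<not> n - 1 \<le> card T"
      then have "card T < card ({1..n} - {a})" using a by (simp add: card_Diff_singleton)
      from functionals_kernel[OF _ finT this, of "\<lambda>e i. el e (\<lambda>j. if j = i then 1 else 0)"]
      obtain w where w: "\<exists>i\<in>{1..n} - {a}. w i \<noteq> 0"
        "\<forall>e\<in>T. (\<Sum>i\<in>{1..n} - {a}. w i * el e (\<lambda>j. if j = i then 1 else 0)) = 0" by auto
      define d where "d i = (if i = a then 0 else w i)" for i
      have "el e d = 0" if "e \<in> T" for e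
      proof -
        have "e \<in> E" using that TE by blast
        then have "el e d = (\<Sum>i\<in>{1..n} - {a}. d i * el e (\<lambda>j. if j = i then 1 else 0))"
          by (rule el_expand[OF sg _ a]) (simp add: d_def)
        also have "\<dots> = (\<Sum>i\<in>{1..n} - {a}. w i * el e (\<lambda>j. if j = i then 1 else 0))"
          by (intro sum.cong refl) (auto simp: d_def)
        also have "\<dots> = 0" using w(2) that by blast
        finally show ?thesis .
      qed
      moreover have "d a = 0" by (simp add: d_def)
      ultimately have "\<forall>i\<in>{1..n}. d i = 0" by (intro ker ballI)
      moreover obtain i where "i \<in> {1..n}" "i \<noteq> a" "w i \<noteq> 0" using w(1) by blast
      ultimately have "d i = 0" "i \<noteq> a" "w i \<noteq> 0" by blast+
      then show False by (simp add: d_def)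
    qed
  qed
  moreover have "e0 \<in> T" using e0 T'(1) by (simp add: T_def)
  ultimately show ?thesis using TE ker by blast
qed

lemma rsp_straighten:
  assumes "simple_graph n E" "linear_order_on E r"
  shows "rsp E d \<subseteq> fs.span (rmon E ` {\<gamma> \<in> Gam E d. nbc_free r (graphic_matroid E) {e. \<gamma> e \<noteq> 0}})"
proof -
  have "rmon E ` Gam E d \<subseteq> fs.span (rmon E ` {\<gamma> \<in> Gam E d. nbc_free r (graphic_matroid E) {e. \<gamma> e \<noteq> 0}})"
    using rmon_straighten[OF assms] by (intro image_subsetI)
  from fs.span_mono[OF this] show ?thesis unfolding rsp_def fs.span_span .
qed

lemma deriv_inverse_affine:
  fixes A B c :: complex
  assumes "A \<noteq> 0"
  shows "((\<lambda>t. c * (1 / (A + t * B))) has_field_derivative c * (- B / A\<^sup>2)) (at 0)"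
  by (rule derivative_eq_intros refl)+ (use assms in \<open>auto simp: power2_eq_square\<close>)

text \<open>For given \<open>x\<close> the differences of \<open>y\<close> must be
  \<open>lam e / el e x\<close>, and they come from some \<open>y\<close> iff the value on each edge
  outside a spanning tree is the right combination of the values on the tree. These conditions are
  linear in the reciprocals; together with the fixed value on \<open>e0\<close> they form
  \<open>\<Phi>\<close>. By nondegeneracy the differential of \<open>\<Phi>\<close> is invertible at
  the points of \<open>Z\<close>, and then the products of \<open>f z\<close> with monomials of
  degree at most \<open>k\<close> in \<open>\<Phi>\<close> are independent elements of
  \<open>rsp E (k + card Z)\<close>.\<close>

theorem nondegenerate_solutions_le_nbc:
  fixes Z :: "(nat \<Rightarrow> complex) set" and lam :: "nat set \<Rightarrow> complex" and p :: "nat \<Rightarrow> complex"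
  assumes sg: "simple_graph n E" and n3: "n \<ge> 3" and cardE: "card E + 3 = 2 * n" and r: "linear_order_on E r"
    and e0: "e0 \<in> E" "Min e0 = a" "Max e0 = b" and finZ: "finite Z"
    and fix_ab: "\<And>x. x \<in> Z \<Longrightarrow> x a = p a \<and> x b = p b"
    and nz: "\<And>x e. x \<in> Z \<Longrightarrow> e \<in> E \<Longrightarrow> el e x \<noteq> 0"
    and sol: "\<And>x. x \<in> Z \<Longrightarrow> \<exists>y. \<forall>e\<in>E. el e x * el e y = lam e"
    and nd: "\<And>x y dx dy. x \<in> Z \<Longrightarrow> \<forall>e\<in>E. el e x * el e y = lam e \<Longrightarrow>
      \<forall>e\<in>E. el e x * el e dy + el e dx * el e y = 0 \<Longrightarrow> dx a = 0 \<Longrightarrow> dy a = 0 \<Longrightarrow> dx b = 0 \<Longrightarrow>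
      \<forall>i\<in>{1..n}. dx i = 0"
    and ds: "\<And>x x'. x \<in> Z \<Longrightarrow> x' \<in> Z \<Longrightarrow> \<forall>i\<in>{1..n}. x i = x' i \<Longrightarrow> x = x'"
  shows "card Z \<le> nbc r (graphic_matroid E)"
proof (cases "Z = {}")
  case False
  then obtain x0 where x0: "x0 \<in> Z" by blast
  obtain y0 where y0: "\<forall>e\<in>E. el e x0 * el e y0 = lam e" using sol[OF x0] by (elim exE)
  have finE: "finite E" by (rule finite_simple_graph[OF sg])
  obtain i0 j0 where "i0 \<in> {1..n}" "j0 \<in> {1..n}" "i0 < j0" "Min e0 = i0" "Max e0 = j0"
    by (rule simple_graph_edge[OF sg e0(1)])
  then have ab: "a \<in> {1..n}" "b \<in> {1..n}" "a \<noteq> b" using e0 by auto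
  have ele0: "el e0 d = d a - d b" for d by (simp add: el_def e0)
  \<comment> \<open>A vector without edge differences is an infinitesimal motion when taken as
    \<open>dx\<close> with \<open>dy = 0\<close>, so nondegeneracy forces the graph to be
    connected.\<close>
  have conn: "\<forall>i\<in>{1..n}. d i = 0" if "\<forall>e\<in>E. el e d = 0" "d a = 0" for d
  proof (rule nd[OF x0 y0, of "\<lambda>_. 0" d])
    show "\<forall>e\<in>E. el e x0 * el e (\<lambda>_. 0) + el e d * el e y0 = 0"
      using that(1) by (simp add: el_def[of _ "\<lambda>_. 0"])
    show "d b = 0" using that e0(1) ele0[of d] by simp
  qed (use that in auto)
  have "\<exists>T\<subseteq>E. e0 \<in> T \<and> card T = n - 1 \<and>
      (\<forall>d. (\<forall>e\<in>T. el e d = 0) \<longrightarrow> d a = 0 \<longrightarrow> (\<forall>i\<in>{1..n}. d i = 0))"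
    by (rule spanning_edges[OF sg ab(1) e0(1) conn])
  then obtain T where T: "T \<subseteq> E" "e0 \<in> T" "card T = n - 1"
    and kerT: "\<forall>d. (\<forall>e\<in>T. el e d = 0) \<longrightarrow> d a = 0 \<longrightarrow> (\<forall>i\<in>{1..n}. d i = 0)"
    by (elim exE conjE)
  have finT: "finite T" using T(1) finE finite_subset by blast
  define V where "V = {1..n} - {a}"
  have finV: "finite V" and cardV: "card V = n - 1" using ab by (auto simp: V_def card_Diff_singleton)
  define L where "L e i = el e (\<lambda>j. if j = i then 1 else 0)" for e i
  have elL: "el e d = (\<Sum>i\<in>V. d i * L e i)" if "e \<in> E" "d a = 0" for e d
    unfolding V_def L_def by (rule el_expand[OF sg that(1) ab(1), of d]) (rule that(2))
  define ext where "ext w i = (if i \<in> V then w i else 0 :: complex)" for w :: "nat \<Rightarrow> complex" and i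
  have exta: "ext w a = 0" for w by (simp add: ext_def V_def)
  have elext: "el e (ext w) = (\<Sum>i\<in>V. w i * L e i)" if "e \<in> E" for e w
    unfolding elL[of e "ext w", OF that exta] by (intro sum.cong refl) (simp add: ext_def)
  have ext0: "\<forall>i\<in>V. w i = 0" if "\<forall>i\<in>{1..n}. ext w i = 0" for w
  proof
    fix i assume "i \<in> V"
    then show "w i = 0" using bspec[OF that, of i] by (simp add: ext_def V_def)
  qed
  have "\<forall>f\<in>T. \<exists>w. \<forall>e\<in>T. (\<Sum>i\<in>V. w i * L e i) = (if e = f then 1 else 0)"
  proof
    fix f assume "f \<in> T"
    show "\<exists>w. \<forall>e\<in>T. (\<Sum>i\<in>V. w i * L e i) = (if e = f then 1 else 0)"
    proof (rule functionals_dual[OF finV finT])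
      show "card T = card V" using T cardV by simp
      fix w assume "\<forall>e\<in>T. (\<Sum>i\<in>V. w i * L e i) = 0"
      then have "\<forall>e\<in>T. el e (ext w) = 0" using elext T(1) by auto
      then show "\<forall>v\<in>V. w v = 0" using kerT exta ext0 by blast
    qed
  qed
  then obtain W where W: "\<forall>f\<in>T. \<forall>e\<in>T. (\<Sum>i\<in>V. W f i * L e i) = (if e = f then 1 else 0)"
    unfolding bchoice_iff by (elim exE)
  \<comment> \<open>\<open>D f\<close> has difference 1 on the tree edge \<open>f\<close> and 0 on
    the other tree edges: up to sign, the indicator of one side of the fundamental cut of
    \<open>f\<close>.\<close>
  define D where "D f = ext (W f)" for f
  have elD: "el e (D f) = (if e = f then 1 else 0)" if "e \<in> T" "f \<in> T" for e f
    unfolding D_def elext[OF subsetD[OF T(1) that(1)]] using W that by blast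
  have Da: "D f a = 0" for f by (simp add: D_def exta)
  \<comment> \<open>The coefficients that express the difference along \<open>e\<close> by those
    along the tree edges of its fundamental cycle.\<close>
  define \<kappa> where "\<kappa> e f = el e (D f)" for e f
  have sumT: "(\<Sum>f\<in>T. u f * \<kappa> e f) = u e" if "e \<in> T" for u :: "nat set \<Rightarrow> complex" and e
  proof -
    have "(\<Sum>f\<in>T. u f * \<kappa> e f) = (\<Sum>f\<in>T. if f = e then u f else 0)"
      unfolding \<kappa>_def by (intro sum.cong refl) (use elD that in auto)
    then show ?thesis using that finT by simp
  qed
  have rep: "el e d = (\<Sum>f\<in>T. el f d * \<kappa> e f)" if e: "e \<in> E" for e d
  proof -
    define d' where "d' i = (d i - d a) - (\<Sum>f\<in>T. el f d * D f i)" for i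
    have eld': "el g d' = el g d - (\<Sum>f\<in>T. el f d * \<kappa> g f)" for g
    proof -
      have "el g d' = el g (\<lambda>i. d i - d a) - el g (\<lambda>i. \<Sum>f\<in>T. el f d * D f i)"
        unfolding d'_def by (rule el_linear(2))
      also have "el g (\<lambda>i. d i - d a) = el g d" by (simp add: el_def)
      also have "el g (\<lambda>i. \<Sum>f\<in>T. el f d * D f i) = (\<Sum>f\<in>T. el f d * \<kappa> g f)"
        unfolding \<kappa>_def by (rule el_sum)
      finally show ?thesis .
    qed
    have "\<forall>g\<in>T. el g d' = 0" using eld' sumT by simp
    moreover have "d' a = 0" by (simp add: d'_def Da)
    ultimately have z: "\<forall>i\<in>{1..n}. d' i = 0" using kerT by blast
    obtain i j where "i \<in> {1..n}" "j \<in> {1..n}" "Min e = i" "Max e = j"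
      by (rule simple_graph_edge[OF sg e])
    then have "el e d' = 0" using z by (simp add: el_def)
    then show ?thesis using eld'[of e] by simp
  qed
  define I where "I = insert e0 (E - T)"
  have finI: "finite I" using finE by (simp add: I_def)
  have cardI: "card I = n - 1"
  proof -
    have "card I = Suc (card (E - T))" using T finE by (simp add: I_def)
    also have "card (E - T) = card E - (n - 1)" using T finT by (simp add: card_Diff_subset)
    finally show ?thesis using cardE n3 by simp
  qed
  \<comment> \<open>Row \<open>e0\<close> reads off the reciprocal of the pinned edge. Row
    \<open>e\<close> compares \<open>lam e / el e x\<close> with the combination of the tree values
    \<open>lam f / el f x\<close>.\<close>
  define c where "c e f = (if e = e0 then (if f = e0 then 1 else 0)
      else (if f = e then lam e else 0) - (if f \<in> T then \<kappa> e f * lam f else 0))" for e f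
  have csum: "(\<Sum>f\<in>E. c e f * u f) = (if e = e0 then u e0 else lam e * u e - (\<Sum>f\<in>T. (lam f * u f) * \<kappa> e f))"
    if "e \<in> I" for e and u :: "nat set \<Rightarrow> complex"
  proof (cases "e = e0")
    case True
    have "(\<Sum>f\<in>E. c e f * u f) = (\<Sum>f\<in>E. if f = e0 then u f else 0)"
      unfolding c_def True by (intro sum.cong) auto
    then show ?thesis using True finE e0 by simp
  next
    case False
    then have eE: "e \<in> E" using that by (simp add: I_def)
    have "(\<Sum>f\<in>E. c e f * u f) = (\<Sum>f\<in>E. (if f = e then lam e * u f else 0) - (if f \<in> T then (lam f * u f) * \<kappa> e f else 0))"
      unfolding c_def using False by (intro sum.cong refl) (auto simp: algebra_simps)
    also have "\<dots> = lam e * u e - (\<Sum>f\<in>E. if f \<in> T then (lam f * u f) * \<kappa> e f else 0)"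
      using finE eE by (simp add: sum_subtractf)
    also have "(\<Sum>f\<in>E. if f \<in> T then (lam f * u f) * \<kappa> e f else 0) = (\<Sum>f\<in>T. (lam f * u f) * \<kappa> e f)"
      using T(1) finE by (intro sum.mono_neutral_cong_right) auto
    finally show ?thesis using False by simp
  qed
  define \<phi>0 where "\<phi>0 e = (if e = e0 then 1 / (p a - p b) else 0)" for e
  define \<Phi> where "\<Phi> e x = (\<Sum>f\<in>E. c e f * rc E f x) - \<phi>0 e" for e x
  have val: "(\<Sum>f\<in>E. c e f * (1 / el f x)) = \<phi>0 e" if x: "x \<in> Z" and e: "e \<in> I" for x e
  proof (cases "e = e0")
    case True
    then show ?thesis using fix_ab[OF x] unfolding csum[OF e] by (simp add: \<phi>0_def ele0)
  next
    case False
    then have eE: "e \<in> E" using e by (simp add: I_def)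
    obtain y where y: "\<forall>e\<in>E. el e x * el e y = lam e" using sol[OF x] by (elim exE)
    have ly: "lam f * (1 / el f x) = el f y" if "f \<in> E" for f
      using y that nz[OF x that] by (simp add: field_simps)
    have S: "(\<Sum>f\<in>T. (lam f * (1 / el f x)) * \<kappa> e f) = (\<Sum>f\<in>T. el f y * \<kappa> e f)"
      by (intro sum.cong refl) (simp only: ly[OF subsetD[OF T(1)]])
    have "(\<Sum>f\<in>E. c e f * (1 / el f x)) = lam e * (1 / el e x) - (\<Sum>f\<in>T. (lam f * (1 / el f x)) * \<kappa> e f)"
      unfolding csum[OF e] by (simp only: False if_False)
    also have "\<dots> = el e y - el e y" unfolding S ly[OF eE] rep[OF eE, symmetric] ..
    finally show ?thesis using False by (simp add: \<phi>0_def)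
  qed
  define K where "K = card Z"
  have "\<forall>z\<in>Z. \<forall>z'\<in>Z. \<exists>e. z \<noteq> z' \<longrightarrow> e \<in> E \<and> el e z \<noteq> el e z'"
  proof (intro ballI)
    fix z z' assume z: "z \<in> Z" "z' \<in> Z"
    show "\<exists>e. z \<noteq> z' \<longrightarrow> e \<in> E \<and> el e z \<noteq> el e z'"
    proof (rule ccontr)
      assume "\<not> ?thesis"
      then have ne: "z \<noteq> z'" and eq: "\<forall>e\<in>E. el e z = el e z'" by auto
      have "\<forall>i\<in>{1..n}. z i - z' i = 0"
        by (rule conn) (use eq fix_ab[OF z(1)] fix_ab[OF z(2)] in \<open>simp_all add: el_linear(2)\<close>)
      then show False using ds[OF z] ne by simp
    qed
  qed
  then obtain sp where sp0: "\<forall>z\<in>Z. \<forall>z'\<in>Z. z \<noteq> z' \<longrightarrow> sp z z' \<in> E \<and> el (sp z z') z \<noteq> el (sp z z') z'"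
    unfolding bchoice_iff by (elim exE)
  have sp: "sp z z' \<in> E" "el (sp z z') z \<noteq> el (sp z z') z'" if "z \<in> Z" "z' \<in> Z - {z}" for z z'
    using bspec[OF bspec[OF sp0 that(1)], of z'] that by auto
  \<comment> \<open>Interpolation by reciprocals: one affine factor for each other point, along an
    edge that separates it from \<open>z\<close>, normalised to the value 1 at \<open>z\<close>.
    There are \<open>card Z - 1\<close> factors, so the degree is below \<open>K\<close>.\<close>
  define f where "f z x = (\<Prod>z'\<in>Z - {z}. (rc E (sp z z') x + - (1 / el (sp z z') z')) *
      (1 / (1 / el (sp z z') z - 1 / el (sp z z') z')))" for z x
  have rclim: "((\<lambda>t. rc E e (\<lambda>i. z i + t * d i)) \<longlongrightarrow> 1 / el e z) (at 0) \<and>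
      (\<forall>\<^sub>F t in at 0. rc E e (\<lambda>i. z i + t * d i) = 1 / (el e z + t * el e d))"
    if z: "z \<in> Z" and e: "e \<in> E" for z d e
  proof -
    have "\<forall>\<^sub>F t in at 0. el g z + t * el g d \<noteq> 0" if g: "g \<in> E" for g
    proof -
      have "((\<lambda>t. el g z + t * el g d) \<longlongrightarrow> el g z + 0 * el g d) (at 0)"
        by (intro tendsto_intros)
      then show ?thesis using tendsto_imp_eventually_ne[of _ _ "at 0" 0] nz[OF z g] by simp
    qed
    then have "\<forall>\<^sub>F t in at 0. \<forall>g\<in>E. el g z + t * el g d \<noteq> 0"
      using finE by (intro eventually_ball_finite) auto
    then have ev: "\<forall>\<^sub>F t in at 0. rc E e (\<lambda>i. z i + t * d i) = 1 / (el e z + t * el e d)"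
      by (rule eventually_mono) (simp add: rc_def el_linear(1))
    have "((\<lambda>t. 1 / (el e z + t * el e d)) \<longlongrightarrow> 1 / (el e z + 0 * el e d)) (at 0)"
      by (intro tendsto_intros) (use nz[OF z e] in simp)
    then have "((\<lambda>t. rc E e (\<lambda>i. z i + t * d i)) \<longlongrightarrow> 1 / el e z) (at 0)"
      using ev by (subst tendsto_cong[OF ev]) simp
    with ev show ?thesis by blast
  qed
  have curve: "\<exists>c :: complex \<Rightarrow> nat \<Rightarrow> complex. (\<forall>i\<in>I. ((\<lambda>t. \<Phi> i (c t) / t) \<longlongrightarrow> w i) (at 0)) \<and>
      (\<forall>z'\<in>Z. ((\<lambda>t. f z' (c t)) \<longlongrightarrow> (if z' = z then 1 else 0)) (at 0))" if z: "z \<in> Z" for z w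
  proof -
    \<comment> \<open>The partial derivative of \<open>\<Phi> e\<close> at \<open>z\<close> with
      respect to the vertex \<open>i\<close>.\<close>
    define M where "M e i = (\<Sum>g\<in>E. c e g * (- L g i / (el g z)\<^sup>2))" for e i
    have Md: "(\<Sum>i\<in>V. d i * M e i) = (\<Sum>g\<in>E. c e g * (- el g (ext d) / (el g z)\<^sup>2))" for d e
    proof -
      have "(\<Sum>i\<in>V. d i * M e i) = (\<Sum>i\<in>V. \<Sum>g\<in>E. d i * (c e g * (- L g i / (el g z)\<^sup>2)))"
        unfolding M_def by (simp only: sum_distrib_left)
      also have "\<dots> = (\<Sum>g\<in>E. \<Sum>i\<in>V. d i * (c e g * (- L g i / (el g z)\<^sup>2)))" by (rule sum.swap)
      also have "\<dots> = (\<Sum>g\<in>E. c e g * (- el g (ext d) / (el g z)\<^sup>2))"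
      proof (intro sum.cong refl)
        fix g assume g: "g \<in> E"
        have "(\<Sum>i\<in>V. d i * (c e g * (- L g i / (el g z)\<^sup>2))) = (\<Sum>i\<in>V. (c e g * (- 1 / (el g z)\<^sup>2)) * (d i * L g i))"
          by (intro sum.cong refl) simp
        also have "\<dots> = (c e g * (- 1 / (el g z)\<^sup>2)) * el g (ext d)"
          unfolding elext[OF g] by (rule sum_distrib_left[symmetric])
        finally show "(\<Sum>i\<in>V. d i * (c e g * (- L g i / (el g z)\<^sup>2))) = c e g * (- el g (ext d) / (el g z)\<^sup>2)" by simp
      qed
      finally show ?thesis .
    qed
    obtain y where y: "\<forall>e\<in>E. el e z * el e y = lam e" using sol[OF z] by (elim exE)
    have "\<exists>d. \<forall>e\<in>I. (\<Sum>i\<in>V. d i * M e i) = w e"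
    proof (rule functionals_dual[OF finV finI])
      show "card I = card V" using cardI cardV by simp
      fix d assume d0: "\<forall>e\<in>I. (\<Sum>i\<in>V. d i * M e i) = 0"
      define \<mu> where "\<mu> g = - el g (ext d) / (el g z)\<^sup>2" for g
      have mu0: "(\<Sum>g\<in>E. c e g * \<mu> g) = 0" if "e \<in> I" for e
        using d0 that unfolding Md \<mu>_def by blast
      \<comment> \<open>A kernel vector \<open>d\<close> changes the reciprocals at the rates
        \<open>\<mu>\<close>, hence the differences of \<open>y\<close> by
        \<open>lam e * \<mu> e\<close>. The linearised conditions on the edges outside
        \<open>T\<close> let one vector \<open>dy\<close> realise all these changes, and
        \<open>ext d\<close>, \<open>dy\<close> form an infinitesimal motion.\<close>
      define dy where "dy i = (\<Sum>g\<in>T. (lam g * \<mu> g) * D g i)" for i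
      have eldy: "el e dy = lam e * \<mu> e" if e: "e \<in> E" for e
      proof -
        have el: "el e dy = (\<Sum>g\<in>T. (lam g * \<mu> g) * \<kappa> e g)" unfolding dy_def \<kappa>_def by (rule el_sum)
        show ?thesis
        proof (cases "e \<in> T")
          case True
          then show ?thesis unfolding el by (rule sumT)
        next
          case False
          then have eI: "e \<in> I" "e \<noteq> e0" using e T(2) by (auto simp: I_def)
          from mu0[OF eI(1)] eI(2) show ?thesis unfolding csum[OF eI(1)] el by simp
        qed
      qed
      have e0I: "e0 \<in> I" by (simp add: I_def)
      have "\<mu> e0 = 0" using mu0[OF e0I] unfolding csum[OF e0I] by simp
      then have "el e0 (ext d) = 0" using nz[OF z e0(1)] by (simp add: \<mu>_def)
      then have extb: "ext d b = 0" using ele0[of "ext d"] exta by simp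
      have "\<forall>i\<in>{1..n}. ext d i = 0"
      proof (rule nd[OF z y, of dy])
        show "\<forall>e\<in>E. el e z * el e dy + el e (ext d) * el e y = 0"
        proof
          fix e assume e: "e \<in> E"
          have "lam e = el e z * el e y" using y e by simp
          then show "el e z * el e dy + el e (ext d) * el e y = 0"
            unfolding eldy[OF e] \<mu>_def using nz[OF z e] by (simp add: field_simps power2_eq_square)
        qed
        show "dy a = 0" by (simp add: dy_def Da)
      qed (use exta extb in auto)
      then show "\<forall>v\<in>V. d v = 0" by (rule ext0)
    qed
    then obtain d where d: "\<forall>e\<in>I. (\<Sum>i\<in>V. d i * M e i) = w e" by (elim exE)
    define cv where "cv t = (\<lambda>i. z i + t * ext d i)" for t
    have "((\<lambda>t. \<Phi> e (cv t) / t) \<longlongrightarrow> w e) (at 0)" if e: "e \<in> I" for e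
    proof -
      define \<psi> where "\<psi> t = (\<Sum>g\<in>E. c e g * (1 / (el g z + t * el g (ext d)))) - \<phi>0 e" for t
      have "(\<psi> has_field_derivative (\<Sum>g\<in>E. c e g * (- el g (ext d) / (el g z)\<^sup>2)) - 0) (at 0)"
        unfolding \<psi>_def by (intro DERIV_diff DERIV_sum DERIV_const deriv_inverse_affine nz[OF z])
      then have "(\<psi> has_field_derivative (\<Sum>g\<in>E. c e g * (- el g (ext d) / (el g z)\<^sup>2))) (at 0)" by simp
      then have "(\<psi> has_field_derivative w e) (at 0)" using d e unfolding Md by simp
      then have "((\<lambda>h. (\<psi> (0 + h) - \<psi> 0) / h) \<longlongrightarrow> w e) (at 0)" unfolding DERIV_def .
      moreover have "\<psi> 0 = 0" using val[OF z e] by (simp add: \<psi>_def)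
      ultimately have lim: "((\<lambda>h. \<psi> h / h) \<longlongrightarrow> w e) (at 0)" by simp
      have "\<forall>\<^sub>F t in at 0. \<forall>g\<in>E. rc E g (cv t) = 1 / (el g z + t * el g (ext d))"
        unfolding cv_def using rclim[OF z] finE by (intro eventually_ball_finite) auto
      then have "\<forall>\<^sub>F t in at 0. \<Phi> e (cv t) / t = \<psi> t / t"
        by (rule eventually_mono) (simp add: \<Phi>_def \<psi>_def)
      then show ?thesis using lim by (subst tendsto_cong)
    qed
    moreover have "((\<lambda>t. f z' (cv t)) \<longlongrightarrow> (if z' = z then 1 else 0)) (at 0)" if z': "z' \<in> Z" for z'
    proof -
      have "((\<lambda>t. f z' (cv t)) \<longlongrightarrow> (\<Prod>u\<in>Z - {z'}. (1 / el (sp z' u) z + - (1 / el (sp z' u) u)) *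
          (1 / (1 / el (sp z' u) z' - 1 / el (sp z' u) u)))) (at 0)"
        unfolding f_def cv_def
        by (intro tendsto_prod tendsto_mult tendsto_add tendsto_const conjunct1[OF rclim[OF z]] sp(1)[OF z'])
      moreover have "(\<Prod>u\<in>Z - {z'}. (1 / el (sp z' u) z + - (1 / el (sp z' u) u)) *
          (1 / (1 / el (sp z' u) z' - 1 / el (sp z' u) u))) = (if z' = z then 1 else 0)"
      proof (cases "z' = z")
        case True
        have "1 / el (sp z u) z - 1 / el (sp z u) u \<noteq> 0" if "u \<in> Z - {z}" for u
          using sp(2)[OF z that] by simp
        then show ?thesis unfolding True by (subst prod.neutral) auto
      next
        case False
        then have "z \<in> Z - {z'}" using z by simp
        then show ?thesis using False finZ by (subst prod_zero) (auto intro!: bexI[of _ z])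
      qed
      ultimately show ?thesis by simp
    qed
    ultimately show ?thesis by (intro exI[of _ cv]) blast
  qed
  have \<Phi>sp: "\<Phi> e \<in> rsp E 1" for e
  proof -
    have "(\<lambda>x. (\<Sum>g\<in>E. c e g * rc E g x) + - \<phi>0 e) \<in> rsp E 1"
      by (intro rsp_add rsp_sum rsp_rc finE rsp_mono[OF rsp_const]) auto
    then show ?thesis by (simp add: \<Phi>_def[abs_def])
  qed
  have fsp: "f z \<in> rsp E K" if z: "z \<in> Z" for z
  proof -
    have "(\<lambda>x. \<Prod>z'\<in>Z - {z}. (rc E (sp z z') x + - (1 / el (sp z z') z')) *
      (1 / (1 / el (sp z z') z - 1 / el (sp z z') z'))) \<in> rsp E (\<Sum>z'\<in>Z - {z}. 1 + 0)"
      by (intro rsp_prod rsp_mult rsp_add rsp_rc finE sp(1)[OF z] rsp_const rsp_mono[OF rsp_const]) (use finZ in auto)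
    moreover have "(\<Sum>z'\<in>Z - {z}. 1 + 0) \<le> K" using finZ z by (simp add: K_def card_Diff_singleton)
    ultimately show ?thesis unfolding f_def by (rule rsp_mono)
  qed
  define N where "N d = {\<gamma> \<in> Gam E d. nbc_free r (graphic_matroid E) {e. \<gamma> e \<noteq> 0}}" for d
  have finN: "finite (N d)" for d using finite_Gam[OF finE] by (simp add: N_def)
  \<comment> \<open>Independent products on one side, spanning monomials without broken circuits on
    the other; the factors \<open>f z\<close> raise the degree from \<open>k\<close> to at most
    \<open>k + K\<close>.\<close>
  have count: "K * card (Gam I k) \<le> card (N (k + K))" for k
  proof (rule ccontr)
    assume "\<not> ?thesis"
    then have lt: "card (N (k + K)) < card (Z \<times> Gam I k)" by (simp add: K_def card_cartesian_product)
    have fin: "finite (Z \<times> Gam I k)" using finZ finite_Gam[OF finI] by blast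
    have "card (rmon E ` N (k + K)) < card (Z \<times> Gam I k)"
      using card_image_le[OF finN, of "rmon E" "k + K"] lt by linarith
    moreover have "(\<lambda>x. mon I (snd q) (\<lambda>i. \<Phi> i x) * f (fst q) x) \<in> fs.span (rmon E ` N (k + K))"
      if q: "q \<in> Z \<times> Gam I k" for q
    proof -
      have "(\<lambda>x. mon I (snd q) (\<lambda>i. \<Phi> i x) * f (fst q) x) \<in> rsp E (k + K)"
        using q by (intro rsp_mult rsp_mon finI \<Phi>sp fsp) auto
      then show ?thesis using rsp_straighten[OF sg r, of "k + K"] unfolding N_def by blast
    qed
    ultimately have "\<exists>\<kappa>. (\<exists>q\<in>Z \<times> Gam I k. \<kappa> q \<noteq> 0) \<and>
        (\<forall>x. (\<Sum>q\<in>Z \<times> Gam I k. \<kappa> q * (mon I (snd q) (\<lambda>i. \<Phi> i x) * f (fst q) x)) = 0)"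
      by (intro family_relation[OF fin, of "rmon E ` N (k + K)"] finite_imageI finN)
    then obtain \<kappa>' where k1: "\<exists>q\<in>Z \<times> Gam I k. \<kappa>' q \<noteq> 0"
      and k2: "\<forall>x. (\<Sum>q\<in>Z \<times> Gam I k. \<kappa>' q * (mon I (snd q) (\<lambda>i. \<Phi> i x) * f (fst q) x)) = 0"
      by (elim exE conjE)
    have "\<forall>z\<in>Z. \<forall>\<alpha>\<in>Gam I k. \<kappa>' (z, \<alpha>) = 0"
    proof (rule lowest_order_indep[OF finZ finI curve])
      show "(\<Sum>z\<in>Z. \<Sum>\<alpha>\<in>Gam I k. \<kappa>' (z, \<alpha>) * (mon I \<alpha> (\<lambda>i. \<Phi> i x) * f z x)) = 0" for x
        using spec[OF k2, of x] by (simp add: sum.cartesian_product case_prod_beta)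
    qed
    with k1 show False by auto
  qed
  have "K \<le> nbc r (graphic_matroid E)"
  proof (rule growth_comparison[of "n - 1" "\<lambda>k. card (Gam I k)" K])
    show "1 \<le> n - 1" using n3 by simp
    show "(j + 1) ^ (n - 1) \<le> card (Gam I ((n - 1) * j))" for j
      using Gam_card_ge[OF finI, of j] cardI by simp
    have "I \<noteq> {}" by (simp add: I_def)
    show "card (Gam I (k + K)) \<le> card (Gam I k) + K * (k + K + 1) ^ (n - 1 - 1)" for k
      using Gam_card_add[OF finI \<open>I \<noteq> {}\<close>, of k K] cardI by simp
    show "K * card (Gam I k) \<le> nbc r (graphic_matroid E) * card (Gam I (k + K)) + 2 ^ card E * (k + K + 1) ^ (n - 1 - 1)" for k
    proof -
      have "card (N (k + K)) \<le> nbc r (graphic_matroid E) * card (Gam I (k + K)) + 2 ^ card E * (k + K + 1) ^ (n - 1 - 1)"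
        unfolding N_def by (rule nbc_free_monomials_card[OF sg r _ finI cardI]) (use n3 in simp)
      with count[of k] show ?thesis by linarith
    qed
  qed
  then show ?thesis by (simp add: K_def)
qed simp

section \<open>Isotropic coordinates\<close>

text \<open>A value at \<open>(i, 1)\<close> stands for \<open>u\<^sub>i\<close>, a value at \<open>(i, 2)\<close> for \<open>v\<^sub>i\<close>.\<close>

definition prd :: "nat set \<Rightarrow> (nat \<times> 2 \<Rightarrow> complex) \<Rightarrow> complex" where
  "prd e z = (z (Min e, 1) - z (Max e, 1)) * (z (Min e, 2) - z (Max e, 2))"

definition dprd :: "nat set \<Rightarrow> (nat \<times> 2 \<Rightarrow> complex) \<Rightarrow> (nat \<times> 2 \<Rightarrow> complex) \<Rightarrow> complex" where
  "dprd e z w = (z (Min e, 1) - z (Max e, 1)) * (w (Min e, 2) - w (Max e, 2))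
    + (w (Min e, 1) - w (Max e, 1)) * (z (Min e, 2) - z (Max e, 2))"

definition uvc :: "(nat \<times> 2 \<Rightarrow> complex) \<Rightarrow> nat \<times> 2 \<Rightarrow> complex" where
  "uvc x = (\<lambda>(i, k). if k = 1 then x (i, 1) + \<i> * x (i, 2) else x (i, 1) - \<i> * x (i, 2))"

definition xyc :: "(nat \<times> 2 \<Rightarrow> complex) \<Rightarrow> nat \<times> 2 \<Rightarrow> complex" where
  "xyc z = (\<lambda>(i, k). if k = 1 then (z (i, 1) + z (i, 2)) / 2 else (z (i, 1) - z (i, 2)) / (2 * \<i>))"

lemma uvc_simps [simp]: "uvc x (i, 1) = x (i, 1) + \<i> * x (i, 2)" "uvc x (i, 2) = x (i, 1) - \<i> * x (i, 2)"
  by (simp_all add: uvc_def)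

lemma xyc_simps [simp]: "xyc z (i, 1) = (z (i, 1) + z (i, 2)) / 2" "xyc z (i, 2) = (z (i, 1) - z (i, 2)) / (2 * \<i>)"
  by (simp_all add: xyc_def)

lemma pair2_eqI:
  assumes "\<And>i. f (i, 1) = g (i, 1 :: 2)" "\<And>i. f (i, 2) = g (i, 2)"
  shows "f = g"
proof
  fix v :: "'a \<times> 2"
  obtain i k where v: "v = (i, k)" by force
  have "k = 1 \<or> k = 2" by (rule exhaust_2)
  then show "f v = g v" using assms v by auto
qed

lemma uvc_xyc [simp]: "uvc (xyc z) = z"
  by (rule pair2_eqI) (simp_all add: field_simps)

lemma xyc_uvc [simp]: "xyc (uvc x) = x"
  by (rule pair2_eqI) simp_all

lemma sqd_uvc: "sqd e x = prd e (uvc x)"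
  by (simp add: sqd_def prd_def sum_2 power2_eq_square algebra_simps)

lemma prd_pfun: "simple_graph n E \<Longrightarrow> e \<in> E \<Longrightarrow> prd e \<in> pfun (verts n)"
proof (erule simple_graph_edge, assumption)
  fix i j assume "i \<in> {1..n}" "j \<in> {1..n}" "Min e = i" "Max e = j"
  then show "prd e \<in> pfun (verts n)"
    unfolding prd_def[abs_def] by (intro pfun.mult pfun_diff pfun.var) (auto simp: verts_def)
qed

text \<open>On real arguments a complex polynomial splits into two real ones, to each of which
  independence over the reals can be applied.\<close>

lemma pfun_real_imag:
  fixes P :: "('b \<Rightarrow> complex) \<Rightarrow> complex"
  assumes "P \<in> pfun B"
  shows "\<exists>R\<in>pfun B. \<exists>I\<in>pfun B. \<forall>y. P (\<lambda>b. of_real (y b)) = Complex (R y) (I y)"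
  using assms
proof induction
  case (const c)
  show ?case
    by (rule bexI[of _ "\<lambda>_. Re c"], rule bexI[of _ "\<lambda>_. Im c"]) (auto intro: pfun.const)
next
  case (var v)
  show ?case
    by (rule bexI[of _ "\<lambda>y. y v"], rule bexI[of _ "\<lambda>_. 0"]) (use var in \<open>auto intro: pfun.intros simp: complex_of_real_def\<close>)
next
  case (add f g)
  then obtain R I R' I' where ri: "R \<in> pfun B" "I \<in> pfun B" "R' \<in> pfun B" "I' \<in> pfun B"
    "\<forall>y. f (\<lambda>b. of_real (y b)) = Complex (R y) (I y)" "\<forall>y. g (\<lambda>b. of_real (y b)) = Complex (R' y) (I' y)"
    by (elim bexE)
  show ?case
    by (rule bexI[of _ "\<lambda>y. R y + R' y"], rule bexI[of _ "\<lambda>y. I y + I' y"])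
      (use ri in \<open>auto intro: pfun.add simp: complex_eq_iff\<close>)
next
  case (mult f g)
  then obtain R I R' I' where ri: "R \<in> pfun B" "I \<in> pfun B" "R' \<in> pfun B" "I' \<in> pfun B"
    "\<forall>y. f (\<lambda>b. of_real (y b)) = Complex (R y) (I y)" "\<forall>y. g (\<lambda>b. of_real (y b)) = Complex (R' y) (I' y)"
    by (elim bexE)
  show ?case
    by (rule bexI[of _ "\<lambda>y. R y * R' y - I y * I' y"], rule bexI[of _ "\<lambda>y. R y * I' y + I y * R' y"])
      (use ri in \<open>auto intro!: pfun.add pfun.mult pfun_diff simp: complex_eq_iff\<close>)
qed

text \<open>A complex point is reached from its real part, in the direction of its imaginary part,
  at \<open>t = \<i>\<close>. On this line the polynomial vanishes for all real \<open>t\<close>, so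
  it has infinitely many roots and is zero.\<close>

lemma pfun_real_points:
  fixes P :: "('b \<Rightarrow> complex) \<Rightarrow> complex"
  assumes "P \<in> pfun B" "\<And>y. P (\<lambda>b. of_real (y b)) = 0"
  shows "P z = 0"
proof -
  obtain q where q: "\<forall>t. P (\<lambda>b. of_real (Re (z b)) + t * of_real (Im (z b))) = poly q t"
    using pfun_line[OF assms(1), of "\<lambda>b. of_real (Re (z b))" "\<lambda>b. of_real (Im (z b))"] by (elim exE)
  have "poly q (of_real t) = 0" for t
  proof -
    have "poly q (of_real t) = P (\<lambda>b. of_real (Re (z b)) + of_real t * of_real (Im (z b)))" using q by simp
    also have "\<dots> = P (\<lambda>b. of_real (Re (z b) + t * Im (z b)))" by (simp only: of_real_add of_real_mult)
    finally show ?thesis by (simp only: assms(2))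
  qed
  then have "of_real ` (UNIV :: real set) \<subseteq> {t. poly q t = 0}" by auto
  moreover have "infinite (of_real ` (UNIV :: real set) :: complex set)"
    by (simp add: finite_image_iff inj_of_real infinite_UNIV_char_0)
  ultimately have "infinite {t. poly q t = 0}" using finite_subset by blast
  then have "q = 0" using poly_roots_finite by blast
  then have "P (\<lambda>b. of_real (Re (z b)) + \<i> * of_real (Im (z b))) = 0" using q by simp
  then show ?thesis by (simp add: complex_eq[symmetric])
qed

text \<open>Evaluated at real configurations, a complex relation yields two relations among real
  squared lengths. Both are trivial by assumption, so the complex relation vanishes at all real
  arguments and hence everywhere.\<close>

lemma algindep_prd:
  assumes "algindep (sqd :: nat set \<Rightarrow> (nat \<times> 2 \<Rightarrow> real) \<Rightarrow> real) E"
  shows "algindep prd E"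
  unfolding algindep_def
proof (intro ballI impI allI)
  fix P :: "(nat set \<Rightarrow> complex) \<Rightarrow> complex" and z
  assume P: "P \<in> pfun E" "\<forall>x. P (\<lambda>e. prd e x) = 0"
  obtain R I where RI: "R \<in> pfun E" "I \<in> pfun E" "\<forall>y. P (\<lambda>b. of_real (y b)) = Complex (R y) (I y)"
    using pfun_real_imag[OF P(1)] by (elim bexE)
  have 0: "R (\<lambda>e. sqd e x) = 0 \<and> I (\<lambda>e. sqd e x) = 0" for x
  proof -
    have "of_real (sqd e x) = prd e (uvc (\<lambda>v. of_real (x v)))" for e
      by (simp add: sqd_uvc[symmetric]) (simp add: sqd_def)
    then have "P (\<lambda>e. of_real (sqd e x)) = 0" using P(2) by simp
    then show ?thesis using RI(3) by (simp add: complex_eq_iff)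
  qed
  have "R y = 0" "I y = 0" for y
    using algindepD[OF assms RI(1), of y] algindepD[OF assms RI(2), of y] 0 by simp_all
  then have "P (\<lambda>b. of_real (y b)) = 0" for y using RI(3) by (simp add: complex_eq_iff)
  then show "P z = 0" by (rule pfun_real_points[OF P(1)])
qed

section \<open>Pinning an edge\<close>

definition pins :: "nat \<Rightarrow> nat \<Rightarrow> (nat \<times> 2) set" where
  "pins a b = {(a, 1), (a, 2), (b, 1)}"

text \<open>In isotropic coordinates a rotation followed by a translation is
  \<open>u \<mapsto> s * u + \<alpha>\<close>, \<open>v \<mapsto> v / s + \<beta>\<close>; the one
  taken here carries the pinned values of \<open>z\<close> to those of \<open>y\<close>.\<close>

definition gauge :: "nat \<Rightarrow> nat \<Rightarrow> (nat \<times> 2 \<Rightarrow> complex) \<Rightarrow> (nat \<times> 2 \<Rightarrow> complex) \<Rightarrow> nat \<times> 2 \<Rightarrow> complex" where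
  "gauge a b y z = (let s = (y (b, 1) - y (a, 1)) / (z (b, 1) - z (a, 1)) in
     (\<lambda>(i, k). if k = 1 then y (a, 1) + s * (z (i, 1) - z (a, 1)) else y (a, 2) + (z (i, 2) - z (a, 2)) / s))"

lemma gauge_pins:
  assumes "z (a, 1) \<noteq> z (b, 1)"
  shows "gauge a b y z (a, 1) = y (a, 1)" "gauge a b y z (a, 2) = y (a, 2)" "gauge a b y z (b, 1) = y (b, 1)"
  using assms by (simp_all add: gauge_def Let_def)

lemma gauge_prd:
  assumes "z (a, 1) \<noteq> z (b, 1)" "y (a, 1) \<noteq> y (b, 1)"
  shows "prd e (gauge a b y z) = prd e z"
proof -
  define s where "s = (y (b, 1) - y (a, 1)) / (z (b, 1) - z (a, 1))"
  have s: "s \<noteq> 0" using assms by (simp add: s_def)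
  have "prd e (gauge a b y z) = (s * (z (Min e, 1) - z (Max e, 1))) * ((z (Min e, 2) - z (Max e, 2)) / s)"
    unfolding prd_def gauge_def Let_def s_def[symmetric]
    by (simp add: algebra_simps diff_divide_distrib)
  then show ?thesis using s by (simp add: prd_def)
qed

abbreviation cfam :: "nat set + nat \<times> 2 \<Rightarrow> (nat \<times> 2 \<Rightarrow> complex) \<Rightarrow> complex" where
  "cfam \<equiv> case_sum prd (\<lambda>v z. z v)"

text \<open>The gauge moves the pins to prescribed values without changing any edge product. Fixing
  the pins in a relation \<open>P\<close> thus leaves a relation \<open>Q\<close> among the edge
  products alone, which is trivial. The requirement that the first coordinates at \<open>a\<close>
  and \<open>b\<close> differ excludes only the zeros of a nonzero polynomial.\<close>

lemma algindep_pins: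
  assumes "algindep prd E" "a \<noteq> b"
  shows "algindep cfam (Inl ` E \<union> Inr ` pins a b)"
  unfolding algindep_def
proof (intro ballI impI allI)
  let ?B = "Inl ` E \<union> Inr ` pins a b :: (nat set + nat \<times> 2) set"
  fix P :: "(nat set + nat \<times> 2 \<Rightarrow> complex) \<Rightarrow> complex" and y
  assume P: "P \<in> pfun ?B" "\<forall>x. P (\<lambda>b. cfam b x) = 0"
  have Py: "P y = 0" if y: "y (Inr (a, 1)) \<noteq> y (Inr (b, 1))" for y
  proof -
    define y' where "y' v = y (Inr v)" for v
    define Q where "Q w = P (case_sum w y')" for w
    have Q: "Q \<in> pfun E" unfolding Q_def
      by (rule pfun_subst[OF P(1)]) (auto intro: pfun.intros)
    have Qz: "Q (\<lambda>e. prd e z) = 0" if z: "z (a, 1) \<noteq> z (b, 1)" for z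
    proof -
      have "Q (\<lambda>e. prd e z) = P (\<lambda>c. cfam c (gauge a b y' z))"
        unfolding Q_def
      proof (rule pfun_cong[OF P(1)])
        fix c assume "c \<in> ?B"
        then show "case_sum (\<lambda>e. prd e z) y' c = cfam c (gauge a b y' z)"
          using gauge_pins[OF z, of y'] gauge_prd[OF z, of y'] y by (auto simp: pins_def y'_def)
      qed
      then show ?thesis using P(2) by simp
    qed
    have "Q (\<lambda>e. prd e z) = 0" for z
    proof (rule ccontr)
      assume nz: "Q (\<lambda>e. prd e z) \<noteq> 0"
      have "prd e \<in> pfun UNIV" for e
        unfolding prd_def[abs_def] by (intro pfun.mult pfun_diff pfun.var) auto
      then have 1: "(\<lambda>z. Q (\<lambda>e. prd e z)) \<in> pfun UNIV" by (intro pfun_subst[OF Q])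
      have 2: "(\<lambda>z :: nat \<times> 2 \<Rightarrow> complex. z (a, 1) - z (b, 1)) \<in> pfun UNIV"
        by (intro pfun_diff pfun.var) auto
      have 3: "(\<lambda>v. if v = (a, 1) then 1 else 0 :: complex) (a, 1) - (\<lambda>v. if v = (a, 1) then 1 else 0) (b, 1 :: 2) \<noteq> 0"
        using assms(2) by simp
      from pfun_two_nonzero[of "\<lambda>z. Q (\<lambda>e. prd e z)" UNIV "\<lambda>z. z (a, 1) - z (b, 1)" z
          "\<lambda>v. if v = (a, 1) then 1 else 0", OF 1 2 nz 3] Qz
      show False by auto
    qed
    then have "Q (\<lambda>e. y (Inl e)) = 0" by (rule algindepD[OF assms(1) Q])
    moreover have "Q (\<lambda>e. y (Inl e)) = P y"
      unfolding Q_def by (rule pfun_cong[OF P(1)]) (auto simp: y'_def)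
    ultimately show ?thesis by simp
  qed
  show "P y = 0"
  proof (rule ccontr)
    assume nz: "P y \<noteq> 0"
    have 1: "(\<lambda>y :: nat set + nat \<times> 2 \<Rightarrow> complex. y (Inr (a, 1)) - y (Inr (b, 1))) \<in> pfun ?B"
      by (intro pfun_diff pfun.var) (auto simp: pins_def)
    have 2: "(\<lambda>v. if v = Inr (a, 1) then 1 else 0 :: complex) (Inr (a, 1) :: nat set + nat \<times> 2)
        - (\<lambda>v. if v = Inr (a, 1) then 1 else 0) (Inr (b, 1)) \<noteq> 0"
      using assms(2) by simp
    from pfun_two_nonzero[of P ?B "\<lambda>y. y (Inr (a, 1)) - y (Inr (b, 1))" y
        "\<lambda>v. if v = Inr (a, 1) then 1 else 0", OF P(1) 1 nz 2] Py
    show False by auto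
  qed
qed

text \<open>Values off \<open>verts n\<close> are set to 0 so that the solutions can be counted as
  functions.\<close>

definition fib :: "nat \<Rightarrow> nat set set \<Rightarrow> nat \<Rightarrow> nat \<Rightarrow> (nat \<times> 2 \<Rightarrow> complex) \<Rightarrow> (nat \<times> 2 \<Rightarrow> complex) set" where
  "fib n E a b z = {z'. (\<forall>e\<in>E. prd e z' = prd e z) \<and> (\<forall>v\<in>pins a b. z' v = z v) \<and> (\<forall>v. v \<notin> verts n \<longrightarrow> z' v = 0)}"

lemma dzero_prd:
  assumes "dprd e z w = 0" shows "dzero z w (prd e)"
proof -
  have "prd e (\<lambda>v. z v + t * w v) = prd e z + t * dprd e z w + t\<^sup>2 * prd e w" for t
    by (simp add: prd_def dprd_def power2_eq_square algebra_simps)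
  then have "prd e (\<lambda>v. z v + t * w v) = prd e z + t\<^sup>2 * prd e w" for t using assms by simp
  then have "(\<lambda>t. prd e (\<lambda>v. z v + t * w v)) = (\<lambda>t. prd e z + t\<^sup>2 * prd e w)" by (rule ext)
  then show ?thesis by (auto intro!: derivative_eq_intros)
qed

text \<open>A solution is split into \<open>up\<close> and \<open>vp\<close>. Two solutions with the
  same \<open>up\<close> on the vertices agree, since the difference of their \<open>vp\<close>
  would be an infinitesimal motion; so the points can be counted through \<open>up\<close>.
  Finiteness is not known in advance, and the bound is proved for finite subsets.\<close>

lemma fib_card_le_nbc:
  assumes sg: "simple_graph n E" and n3: "n \<ge> 3" and cardE: "card E + 3 = 2 * n" and r: "linear_order_on E r"
    and e0: "e0 \<in> E" "Min e0 = a" "Max e0 = b"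
    and nz: "\<And>e. e \<in> E \<Longrightarrow> prd e z \<noteq> 0"
    and nd: "\<And>z' w. z' \<in> fib n E a b z \<Longrightarrow> \<forall>e\<in>E. dprd e z' w = 0 \<Longrightarrow> \<forall>v\<in>pins a b. w v = 0 \<Longrightarrow>
      \<forall>v\<in>verts n. w v = 0"
  shows "finite (fib n E a b z) \<and> card (fib n E a b z) \<le> nbc r (graphic_matroid E)"
proof -
  define up where "up z i = z (i, 1 :: 2)" for z :: "nat \<times> 2 \<Rightarrow> complex" and i :: nat
  define vp where "vp z i = z (i, 2 :: 2)" for z :: "nat \<times> 2 \<Rightarrow> complex" and i :: nat
  define join where "join x y = (\<lambda>(i :: nat, k :: 2). if k = 1 then x i else y i :: complex)" for x y
  have prd_el: "prd e z = el e (up z) * el e (vp z)" for e z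
    by (simp add: prd_def el_def up_def vp_def)
  have dprd_el: "dprd e z (join x y) = el e (up z) * el e y + el e x * el e (vp z)" for e z x y
    by (simp add: dprd_def el_def up_def vp_def join_def)
  have elnz: "el e (up z') \<noteq> 0" if "z' \<in> fib n E a b z" "e \<in> E" for z' e
    using that nz[OF that(2)] prd_el[of e z'] by (auto simp: fib_def)
  have el_vp: "el e y = el e (vp z')"
    if "z' \<in> fib n E a b z" "e \<in> E" "el e (up z') * el e y = prd e z" for z' e y
  proof -
    have "el e (up z') * el e y = el e (up z') * el e (vp z')"
      using that by (simp add: fib_def prd_el[symmetric])
    then show ?thesis using elnz[OF that(1,2)] by simp
  qed
  have inj: "z1 = z2" if z12: "z1 \<in> fib n E a b z" "z2 \<in> fib n E a b z" "\<forall>i\<in>{1..n}. up z1 i = up z2 i" for z1 z2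
  proof -
    have ue: "el e (up z1) = el e (up z2)" if e: "e \<in> E" for e
    proof -
      obtain i j where "i \<in> {1..n}" "j \<in> {1..n}" "Min e = i" "Max e = j" by (rule simple_graph_edge[OF sg e])
      then show ?thesis using z12(3) by (simp add: el_def)
    qed
    define w where "w = join (\<lambda>_. 0) (\<lambda>i. vp z1 i - vp z2 i)"
    have "\<forall>v\<in>verts n. w v = 0"
    proof (rule nd[OF z12(1)])
      show "\<forall>e\<in>E. dprd e z1 w = 0"
      proof
        fix e assume e: "e \<in> E"
        have "el e (vp z2) = el e (vp z1)"
          by (rule el_vp[OF z12(1) e]) (use z12(2) e ue[OF e] in \<open>simp add: fib_def prd_el[symmetric]\<close>)
        then have "el e (\<lambda>i. vp z1 i - vp z2 i) = 0" by (simp add: el_linear(2))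
        then show "dprd e z1 w = 0" unfolding w_def dprd_el by (simp add: el_def[of _ "\<lambda>_. 0"])
      qed
      show "\<forall>v\<in>pins a b. w v = 0" using z12(1,2) by (auto simp: w_def join_def fib_def pins_def vp_def)
    qed
    then have "w (i, 2) = 0" if "i \<in> {1..n}" for i
      by (rule bspec) (use that in \<open>simp add: verts_def\<close>)
    then have "vp z1 i = vp z2 i" if "i \<in> {1..n}" for i
      using that by (simp add: w_def join_def)
    then have V: "z1 (i, 1) = z2 (i, 1) \<and> z1 (i, 2) = z2 (i, 2)" if "i \<in> {1..n}" for i
      using that z12(3) by (simp add: up_def vp_def)
    have out: "z1 (i, k) = z2 (i, k)" if "i \<notin> {1..n}" for i k
      using that z12(1,2) by (simp add: fib_def verts_def)
    show "z1 = z2" by (rule pair2_eqI) (use V out in blast)+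
  qed
  have bound: "card G \<le> nbc r (graphic_matroid E)" if G: "G \<subseteq> fib n E a b z" "finite G" for G
  proof -
    have "inj_on up G"
    proof (rule inj_onI)
      fix z1 z2 assume "z1 \<in> G" "z2 \<in> G" "up z1 = up z2"
      then show "z1 = z2" using G(1) by (intro inj) auto
    qed
    then have "card G = card (up ` G)" by (simp add: card_image)
    also have "\<dots> \<le> nbc r (graphic_matroid E)"
    proof (rule nondegenerate_solutions_le_nbc[OF sg n3 cardE r e0, of _ "up z" "\<lambda>e. prd e z"])
      show "finite (up ` G)" using G(2) by simp
      fix x assume "x \<in> up ` G"
      then obtain z' where z': "x = up z'" "z' \<in> fib n E a b z" using G(1) by auto
      show "x a = up z a \<and> x b = up z b" using z' by (simp add: fib_def pins_def up_def)
      show "el e x \<noteq> 0" if "e \<in> E" for e using elnz[OF z'(2) that] z'(1) by simp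
      show "\<exists>y. \<forall>e\<in>E. el e x * el e y = prd e z"
        using z' by (intro exI[of _ "vp z'"]) (simp add: fib_def prd_el)
      show "\<forall>i\<in>{1..n}. dx i = 0"
        if y: "\<forall>e\<in>E. el e x * el e y = prd e z" and d: "\<forall>e\<in>E. el e x * el e dy + el e dx * el e y = 0"
          and "dx a = 0" "dy a = 0" "dx b = 0" for y dx dy
      proof -
        have "\<forall>v\<in>verts n. join dx dy v = 0"
        proof (rule nd[OF z'(2)])
          show "\<forall>e\<in>E. dprd e z' (join dx dy) = 0"
          proof
            fix e assume e: "e \<in> E"
            have "el e y = el e (vp z')" by (rule el_vp[OF z'(2) e]) (use y e z'(1) in simp)
            then show "dprd e z' (join dx dy) = 0" unfolding dprd_el using bspec[OF d e] z'(1) by simp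
          qed
          show "\<forall>v\<in>pins a b. join dx dy v = 0" using that by (auto simp: pins_def join_def)
        qed
        then have "join dx dy (i, 1) = 0" if "i \<in> {1..n}" for i
          by (rule bspec) (use that in \<open>simp add: verts_def\<close>)
        then show ?thesis by (simp add: join_def)
      qed
      show "x = x'" if "x' \<in> up ` G" "\<forall>i\<in>{1..n}. x i = x' i" for x'
      proof -
        obtain z2 where z2: "x' = up z2" "z2 \<in> fib n E a b z" using \<open>x' \<in> up ` G\<close> G(1) by auto
        have "z' = z2" by (rule inj[OF z'(2) z2(2)]) (use that(2) z' z2 in simp)
        then show ?thesis using z' z2 by simp
      qed
    qed
    finally show ?thesis .
  qed
  show ?thesis by (rule finite_if_finite_subsets_card_bdd) (rule bound)
qed

text \<open>The Sard polynomial \<open>P\<close> is evaluated at edge products and pins, which all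
  points of a fibre share; \<open>h z \<noteq> 0\<close> therefore gives nondegeneracy at every
  point of the fibre through \<open>z\<close>. The other factors of \<open>h\<close> keep the edge
  products away from 0.\<close>

theorem generic_fib:
  assumes sg: "simple_graph n E" and n3: "n \<ge> 3" and cardE: "card E + 3 = 2 * n" and ind: "algindep prd E"
  shows "\<exists>a b h. a \<in> {1..n} \<and> b \<in> {1..n} \<and> {a, b} \<in> E \<and> h \<in> pfun (verts n) \<and> (\<exists>z. h z \<noteq> 0) \<and>
    (\<forall>z. h z \<noteq> 0 \<longrightarrow> z (a, 1) \<noteq> z (b, 1) \<and> (\<forall>e\<in>E. prd e z \<noteq> 0) \<and>
      (\<forall>r. linear_order_on E r \<longrightarrow>
        finite (fib n E a b z) \<and> card (fib n E a b z) \<le> nbc r (graphic_matroid E)) \<and>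
      (\<forall>z' w. z' \<in> fib n E a b z \<longrightarrow> (\<forall>e\<in>E. dprd e z' w = 0) \<longrightarrow> (\<forall>v\<in>pins a b. w v = 0) \<longrightarrow>
        (\<forall>v\<in>verts n. w v = 0)))"
proof -
  have finE: "finite E" by (rule finite_simple_graph[OF sg])
  have "E \<noteq> {}" using cardE n3 by auto
  then obtain e0 where e0: "e0 \<in> E" by blast
  obtain a b where ab: "e0 = {a, b}" "a \<in> {1..n}" "b \<in> {1..n}" "a < b" "Min e0 = a" "Max e0 = b"
    by (rule simple_graph_edge[OF sg e0])
  define B where "B = (Inl ` E \<union> Inr ` pins a b :: (nat set + nat \<times> 2) set)"
  have finB: "finite B" using finE by (simp add: B_def pins_def)
  have indB: "algindep cfam B" unfolding B_def by (rule algindep_pins[OF ind]) (use ab in simp)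
  have "card (pins a b) = 3" using ab(4) by (simp add: pins_def)
  then have "card (Inr ` pins a b :: (nat set + nat \<times> 2) set) = 3" by (simp add: card_image)
  moreover have "finite (pins a b)" by (simp add: pins_def)
  ultimately have cardB: "card B = card (verts n)"
    unfolding B_def using finE cardE
    by (subst card_Un_disjoint) (auto simp: card_image card_verts)
  have Bp: "cfam c \<in> pfun (verts n)" if "c \<in> B" for c
  proof (cases c)
    case (Inl e)
    then have "e \<in> E" using that by (auto simp: B_def)
    then show ?thesis using prd_pfun[OF sg] by (simp add: Inl)
  next
    case (Inr v)
    then have "v \<in> verts n" using that ab by (auto simp: B_def pins_def verts_def)
    then show ?thesis by (simp add: Inr pfun.var)
  qed
  have "\<exists>P\<in>pfun B. (\<exists>y. P y \<noteq> 0) \<and>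
    (\<forall>z w. P (\<lambda>b. cfam b z) \<noteq> 0 \<longrightarrow> (\<forall>b\<in>B. dzero z w (cfam b)) \<longrightarrow> (\<forall>v\<in>verts n. w v = 0))"
    by (rule algebraic_sard[OF finite_verts indB finB Bp cardB])
  then obtain P y where P: "P \<in> pfun B" "P y \<noteq> 0"
    "\<forall>z w. P (\<lambda>b. cfam b z) \<noteq> 0 \<longrightarrow> (\<forall>b\<in>B. dzero z w (cfam b)) \<longrightarrow> (\<forall>v\<in>verts n. w v = 0)"
    by (elim bexE exE conjE)
  define H where "H i = (case i of None \<Rightarrow> (\<lambda>z. P (\<lambda>b. cfam b z)) | Some e \<Rightarrow> prd e)" for i
  define h where "h z = (\<Prod>i\<in>insert None (Some ` E). H i z)" for z
  have Hp: "H i \<in> pfun (verts n)" if "i \<in> insert None (Some ` E)" for i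
  proof (cases i)
    case None
    have "(\<lambda>z. P (\<lambda>b. cfam b z)) \<in> pfun (verts n)" by (rule pfun_subst[OF P(1) Bp])
    then show ?thesis by (simp add: H_def None)
  next
    case (Some e)
    then show ?thesis using that prd_pfun[OF sg, of e] by (auto simp: H_def)
  qed
  have "\<exists>z. h z \<noteq> 0" unfolding h_def
  proof (rule pfun_prod_nonzero[OF _ Hp])
    fix i assume i: "i \<in> insert None (Some ` E)"
    show "\<exists>z. H i z \<noteq> 0"
    proof (cases i)
      case None
      then show ?thesis using algindep_nonzero[of cfam B P y, OF indB P(1,2)] by (simp add: H_def)
    next
      case (Some e)
      then have e: "e \<in> E" using i by auto
      obtain i' j' where "i' < j'" "Min e = i'" "Max e = j'" by (rule simple_graph_edge[OF sg e])
      then have "prd e (\<lambda>v. if fst v = i' then 1 else 0) \<noteq> 0" by (simp add: prd_def)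
      then show ?thesis by (auto simp: H_def Some)
    qed
  qed (use finE in simp)
  then obtain z0 where z0: "h z0 \<noteq> 0" by blast
  have h: "P (\<lambda>b. cfam b z) \<noteq> 0" "\<And>e. e \<in> E \<Longrightarrow> prd e z \<noteq> 0" if "h z \<noteq> 0" for z
  proof -
    have ne: "H i z \<noteq> 0" if "i \<in> insert None (Some ` E)" for i
      using \<open>h z \<noteq> 0\<close> that finE by (auto simp: h_def prod_zero_iff)
    show "P (\<lambda>b. cfam b z) \<noteq> 0" using ne[of None] by (simp add: H_def)
    show "prd e z \<noteq> 0" if "e \<in> E" for e using ne[of "Some e"] that by (simp add: H_def)
  qed
  have nd: "\<forall>v\<in>verts n. w v = 0"
    if hz: "h z \<noteq> 0" and z': "z' \<in> fib n E a b z" and d: "\<forall>e\<in>E. dprd e z' w = 0" and w: "\<forall>v\<in>pins a b. w v = 0" for z z' w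
  proof -
    have "P (\<lambda>b. cfam b z') = P (\<lambda>b. cfam b z)"
      by (rule pfun_cong[OF P(1)]) (use z' in \<open>auto simp: B_def fib_def\<close>)
    then have "P (\<lambda>b. cfam b z') \<noteq> 0" using h(1)[OF hz] by simp
    moreover have "\<forall>b\<in>B. dzero z' w (cfam b)"
    proof
      fix c assume "c \<in> B"
      then consider e where "c = Inl e" "e \<in> E" | v where "c = Inr v" "v \<in> pins a b" by (auto simp: B_def)
      then show "dzero z' w (cfam c)"
      proof cases
        case 1
        then show ?thesis using dzero_prd d by simp
      next
        case 2
        then show ?thesis using w by simp
      qed
    qed
    ultimately show ?thesis using P(3)[rule_format, of z' w] by simp
  qed
  show ?thesis
  proof (rule exI[of _ a], rule exI[of _ b], rule exI[of _ h], intro conjI allI impI)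
    show "a \<in> {1..n}" "b \<in> {1..n}" by (rule ab(2), rule ab(3))
    show "\<exists>z. h z \<noteq> 0" by (rule exI[of _ z0]) (rule z0)
    show "h \<in> pfun (verts n)" unfolding h_def[abs_def] by (rule pfun_prod) (rule Hp)
    show "{a, b} \<in> E" using e0 ab by simp
    fix z assume hz: "h z \<noteq> 0"
    show "z (a, 1) \<noteq> z (b, 1)" using h(2)[OF hz e0] ab by (simp add: prd_def)
    show "\<forall>e\<in>E. prd e z \<noteq> 0" using h(2)[OF hz] by simp
    show "\<forall>v\<in>verts n. w v = 0"
      if "z' \<in> fib n E a b z" "\<forall>e\<in>E. dprd e z' w = 0" "\<forall>v\<in>pins a b. w v = 0" for z' w
      by (rule nd[OF hz that])
    fix r assume r: "linear_order_on E r"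
    have "finite (fib n E a b z) \<and> card (fib n E a b z) \<le> nbc r (graphic_matroid E)"
      by (rule fib_card_le_nbc[OF sg n3 cardE r e0 ab(5,6) h(2)[OF hz] nd[OF hz]])
    then show "finite (fib n E a b z)" "card (fib n E a b z) \<le> nbc r (graphic_matroid E)" by simp_all
  qed
qed

section \<open>Congruence classes\<close>

lemma congruent_refl:
  assumes "q \<in> configs n" shows "(q, q) \<in> congruent_configs n"
proof -
  have "\<forall>i\<in>{1..n}. q i = mat 1 *v q i + 0" by simp
  then show ?thesis unfolding congruent_configs_def using assms orthogonal_matrix_id by blast
qed

lemma congruent_sym:
  assumes "(p, q) \<in> congruent_configs n" shows "(q, p) \<in> congruent_configs n"
proof -
  obtain A x where pq: "p \<in> configs n" "q \<in> configs n" and A: "orthogonal_matrix A"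
    and eq: "\<forall>i\<in>{1..n}. p i = A *v q i + x"
    using assms unfolding congruent_configs_def by auto
  have At: "orthogonal_matrix (transpose A)" "transpose A ** A = mat 1"
    using A by (auto simp: orthogonal_matrix_def)
  have "q i = transpose A *v p i + - (transpose A *v x)" if "i \<in> {1..n}" for i
    using eq that At(2) by (simp add: matrix_vector_right_distrib matrix_vector_mul_assoc)
  then show ?thesis unfolding congruent_configs_def using pq At(1) by blast
qed

lemma congruent_trans:
  assumes "(p, q) \<in> congruent_configs n" "(q, s) \<in> congruent_configs n" shows "(p, s) \<in> congruent_configs n"
proof -
  obtain A x where pq: "p \<in> configs n" and A: "orthogonal_matrix A"
    and eq: "\<forall>i\<in>{1..n}. p i = A *v q i + x"
    using assms(1) unfolding congruent_configs_def by auto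
  obtain B y where qs: "s \<in> configs n" and B: "orthogonal_matrix B"
    and eq': "\<forall>i\<in>{1..n}. q i = B *v s i + y"
    using assms(2) unfolding congruent_configs_def by auto
  have "transpose (A ** B) ** (A ** B) = transpose B ** ((transpose A ** A) ** B)"
    "(A ** B) ** transpose (A ** B) = A ** ((B ** transpose B) ** transpose A)"
    by (simp_all only: matrix_transpose_mul matrix_mul_assoc)
  then have "orthogonal_matrix (A ** B)"
    using A B by (simp add: orthogonal_matrix_def)
  moreover have "p i = (A ** B) *v s i + (A *v y + x)" if "i \<in> {1..n}" for i
    using eq eq' that by (simp add: matrix_vector_right_distrib matrix_vector_mul_assoc)
  ultimately show ?thesis unfolding congruent_configs_def using pq qs by blast
qed

lemma congruent_class_eq:
  assumes "q \<in> configs n"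
  shows "congruent_configs n `` {p} = congruent_configs n `` {q} \<longleftrightarrow> (p, q) \<in> congruent_configs n"
proof
  assume "congruent_configs n `` {p} = congruent_configs n `` {q}"
  then show "(p, q) \<in> congruent_configs n" using congruent_refl[OF assms] by blast
next
  assume "(p, q) \<in> congruent_configs n"
  then show "congruent_configs n `` {p} = congruent_configs n `` {q}"
    using congruent_sym congruent_trans by blast
qed

lemma config_coords: "q \<in> configs n \<Longrightarrow> config n (coords q) = q"
  by (rule ext) (auto simp: config_def coords_def configs_def vec_eq_iff PiE_iff extensional_def)

text \<open>Scaling by \<open>s\<close> is the rotation with cosine \<open>c\<close> and sine
  \<open>\<sigma>\<close>, where \<open>c + \<i> * \<sigma> = s\<close>; over the complex numbers
  such a pair exists for every \<open>s \<noteq> 0\<close>.\<close>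

lemma congruent_rotate:
  assumes s: "s \<noteq> 0" and z': "\<And>i. i \<in> {1..n} \<Longrightarrow> z' (i, 1) = s * z (i, 1) + \<alpha> \<and> z' (i, 2) = z (i, 2) / s + \<beta>"
  shows "(config n (xyc z'), config n (xyc z)) \<in> congruent_configs n"
proof -
  define c \<sigma> where "c = (s + 1 / s) / 2" and "\<sigma> = (s - 1 / s) / (2 * \<i>)"
  define A :: "complex ^ 2 ^ 2" where
    "A = (\<chi> i j. if i = 1 then (if j = 1 then c else - \<sigma>) else (if j = 1 then \<sigma> else c))"
  define x :: "complex ^ 2" where "x = (\<chi> k. if k = 1 then (\<alpha> + \<beta>) / 2 else (\<alpha> - \<beta>) / (2 * \<i>))"
  have cs: "c * c + \<sigma> * \<sigma> = 1" using s by (simp add: c_def \<sigma>_def field_simps)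
  have "orthogonal_matrix A"
    unfolding orthogonal_matrix_def matrix_matrix_mult_def transpose_def mat_def A_def
    using cs by (simp add: vec_eq_iff forall_2 sum_2 algebra_simps)
  moreover have "config n (xyc z') i = A *v config n (xyc z) i + x" if i: "i \<in> {1..n}" for i
  proof -
    have "(s * z (i, 1) + \<alpha> + (z (i, 2) / s + \<beta>)) / 2 = c * ((z (i, 1) + z (i, 2)) / 2) - \<sigma> * ((z (i, 1) - z (i, 2)) / (2 * \<i>)) + (\<alpha> + \<beta>) / 2"
      using s by (simp add: c_def \<sigma>_def field_simps)
    moreover have "(s * z (i, 1) + \<alpha> - (z (i, 2) / s + \<beta>)) / (2 * \<i>) = \<sigma> * ((z (i, 1) + z (i, 2)) / 2) + c * ((z (i, 1) - z (i, 2)) / (2 * \<i>)) + (\<alpha> - \<beta>) / (2 * \<i>)"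
      using s by (simp add: c_def \<sigma>_def field_simps)
    ultimately show ?thesis
      using i z'[OF i] by (simp add: config_def vec_eq_iff forall_2 matrix_vector_mult_def sum_2 A_def x_def)
  qed
  ultimately show ?thesis unfolding congruent_configs_def by (auto simp: config_in)
qed

text \<open>The reflection in the first axis, which exchanges \<open>x + \<i> * y\<close> and
  \<open>x - \<i> * y\<close>.\<close>

definition swp :: "(nat \<times> 2 \<Rightarrow> complex) \<Rightarrow> nat \<times> 2 \<Rightarrow> complex" where
  "swp z = (\<lambda>(i, k). if k = 1 then z (i, 2) else z (i, 1))"

lemma swp_simps [simp]: "swp z (i, 1) = z (i, 2)" "swp z (i, 2) = z (i, 1)"
  by (simp_all add: swp_def)

lemma prd_swp: "prd e (swp z) = prd e z"
  by (simp add: prd_def mult.commute)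

lemma congruent_swp: "(config n (xyc (swp z)), config n (xyc z)) \<in> congruent_configs n"
proof -
  define A :: "complex ^ 2 ^ 2" where
    "A = (\<chi> i j. if i = 1 then (if j = 1 then 1 else 0) else (if j = 1 then 0 else - 1))"
  have "orthogonal_matrix A"
    unfolding orthogonal_matrix_def matrix_matrix_mult_def transpose_def mat_def A_def
    by (simp add: vec_eq_iff forall_2 sum_2)
  moreover have "config n (xyc (swp z)) i = A *v config n (xyc z) i + 0" if i: "i \<in> {1..n}" for i
  proof -
    have "(z (i, 2) - z (i, 1)) / (2 * \<i>) = - ((z (i, 1) - z (i, 2)) / (2 * \<i>))"
      by (simp only: minus_divide_left minus_diff_eq)
    then show ?thesis
      using i by (simp add: config_def vec_eq_iff forall_2 matrix_vector_mult_def sum_2 A_def add.commute)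
  qed
  ultimately show ?thesis unfolding congruent_configs_def by (auto simp: config_in)
qed

text \<open>The copy of \<open>z\<close> whose pins are those of \<open>y\<close>, with the default
  value 0 off the vertices that \<open>fib\<close> demands.\<close>

definition rep :: "nat \<Rightarrow> nat \<Rightarrow> nat \<Rightarrow> (nat \<times> 2 \<Rightarrow> complex) \<Rightarrow> (nat \<times> 2 \<Rightarrow> complex) \<Rightarrow> nat \<times> 2 \<Rightarrow> complex" where
  "rep n a b y z v = (if v \<in> verts n then gauge a b y z v else 0)"

lemma prd_cong:
  assumes "\<And>v. v \<in> verts n \<Longrightarrow> x v = y v" "i \<in> {1..n}" "j \<in> {1..n}"
  shows "prd {i, j} x = prd {i, j} y"
proof -
  have "Min {i, j} \<in> {1..n}" "Max {i, j} \<in> {1..n}" using assms(2,3) by (auto simp: min_def max_def)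
  then show ?thesis using assms(1) by (simp add: prd_def verts_def)
qed

lemma rep_prd:
  assumes "z (a, 1) \<noteq> z (b, 1)" "y (a, 1) \<noteq> y (b, 1)" "i \<in> {1..n}" "j \<in> {1..n}"
  shows "prd {i, j} (rep n a b y z) = prd {i, j} z"
proof -
  have "prd {i, j} (rep n a b y z) = prd {i, j} (gauge a b y z)"
    by (rule prd_cong[OF _ assms(3,4)]) (simp add: rep_def)
  then show ?thesis by (simp only: gauge_prd[OF assms(1,2)])
qed

lemma edge_pair:
  assumes "simple_graph n E" "e \<in> E"
  obtains i j where "e = {i, j}" "i \<in> {1..n}" "j \<in> {1..n}"
  by (rule simple_graph_edge[OF assms])

lemma rep_fib:
  assumes sg: "simple_graph n E" and ab: "a \<in> {1..n}" "b \<in> {1..n}"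
    and z: "z (a, 1) \<noteq> z (b, 1)" and y: "y (a, 1) \<noteq> y (b, 1)" and eq: "\<forall>e\<in>E. prd e z = prd e y"
  shows "rep n a b y z \<in> fib n E a b y"
  unfolding fib_def mem_Collect_eq
proof (intro conjI ballI allI impI)
  fix e assume e: "e \<in> E"
  obtain i j where ij: "e = {i, j}" "i \<in> {1..n}" "j \<in> {1..n}" by (rule edge_pair[OF sg e])
  show "prd e (rep n a b y z) = prd e y" using rep_prd[OF z y ij(2,3)] eq e ij(1) by simp
next
  fix v assume "v \<in> pins a b"
  then show "rep n a b y z v = y v"
    using gauge_pins[OF z, of y] ab by (auto simp: pins_def rep_def verts_def)
next
  fix v assume "v \<notin> verts n" then show "rep n a b y z v = 0" by (simp add: rep_def)
qed

lemma rep_affine: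
  assumes z: "z (a, 1) \<noteq> z (b, 1)" and y: "y (a, 1) \<noteq> y (b, 1)"
  obtains s \<alpha> \<beta> where "s \<noteq> 0"
    "\<And>i. i \<in> {1..n} \<Longrightarrow> rep n a b y z (i, 1) = s * z (i, 1) + \<alpha> \<and> rep n a b y z (i, 2) = z (i, 2) / s + \<beta>"
proof (rule that)
  define s where "s = (y (b, 1) - y (a, 1)) / (z (b, 1) - z (a, 1))"
  show "s \<noteq> 0" using assms by (simp add: s_def)
  show "rep n a b y z (i, 1) = s * z (i, 1) + (y (a, 1) - s * z (a, 1)) \<and>
    rep n a b y z (i, 2) = z (i, 2) / s + (y (a, 2) - z (a, 2) / s)" if "i \<in> {1..n}" for i
    using that unfolding rep_def gauge_def Let_def s_def[symmetric]
    by (simp add: verts_def algebra_simps diff_divide_distrib)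
qed

lemma rep_congruent:
  assumes "z (a, 1) \<noteq> z (b, 1)" "y (a, 1) \<noteq> y (b, 1)"
  shows "(config n (xyc (rep n a b y z)), config n (xyc z)) \<in> congruent_configs n"
proof -
  obtain s \<alpha> \<beta> where s: "s \<noteq> 0"
    "\<And>i. i \<in> {1..n} \<Longrightarrow> rep n a b y z (i, 1) = s * z (i, 1) + \<alpha> \<and> rep n a b y z (i, 2) = z (i, 2) / s + \<beta>"
    using rep_affine[OF assms] by metis
  show ?thesis by (rule congruent_rotate[OF s])
qed

text \<open>If a realisation were fixed by a reflection, it would be collinear, and moving a single vertex
  perpendicularly to the line would be an infinitesimal flex.\<close>

lemma rep_swp_neq:
  assumes n3: "n \<ge> 3" and sg: "simple_graph n E"
    and z: "z (a, 1) \<noteq> z (b, 1)" "z (a, 2) \<noteq> z (b, 2)" and y: "y (a, 1) \<noteq> y (b, 1)"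
    and nd: "\<And>w. \<forall>e\<in>E. dprd e (rep n a b y z) w = 0 \<Longrightarrow> \<forall>v\<in>pins a b. w v = 0 \<Longrightarrow> \<forall>v\<in>verts n. w v = 0"
  shows "rep n a b y z \<noteq> rep n a b y (swp z)"
proof
  assume eq: "rep n a b y z = rep n a b y (swp z)"
  define g where "g = rep n a b y z"
  obtain s \<alpha> \<beta> where s: "s \<noteq> 0"
    "\<And>i. i \<in> {1..n} \<Longrightarrow> g (i, 1) = s * z (i, 1) + \<alpha> \<and> g (i, 2) = z (i, 2) / s + \<beta>"
    unfolding g_def using rep_affine[OF z(1) y] by metis
  obtain s' \<alpha>' \<beta>' where s': "s' \<noteq> 0"
    "\<And>i. i \<in> {1..n} \<Longrightarrow> g (i, 1) = s' * z (i, 2) + \<alpha>' \<and> g (i, 2) = z (i, 1) / s' + \<beta>'"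
    unfolding g_def eq using rep_affine[of "swp z" a b y] z(2) y by (metis swp_simps)
  \<comment> \<open>Writing \<open>g\<close> as an affine image both of \<open>z\<close> and of its
    reflection ties \<open>u\<close> to \<open>v\<close> with the single factor
    \<open>s' * s\<close>: all vertices lie on one line.\<close>
  have col: "g (i, 1) - g (j, 1) = (s' * s) * (g (i, 2) - g (j, 2))" if "i \<in> {1..n}" "j \<in> {1..n}" for i j
  proof -
    have "g (i, 1) - g (j, 1) = s' * (z (i, 2) - z (j, 2))"
      using s'(2)[OF that(1)] s'(2)[OF that(2)] by (simp add: algebra_simps)
    moreover have "s * (g (i, 2) - g (j, 2)) = z (i, 2) - z (j, 2)"
      using s(2)[OF that(1)] s(2)[OF that(2)] s(1) by (simp add: field_simps)
    ultimately show ?thesis by (simp add: mult.assoc)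
  qed
  have "card {a, b} < card {1..n}" using n3 card_insert_le_m1[of 2 "{b}" a] by (simp add: card_insert_if)
  then have "\<not> {1..n} \<subseteq> {a, b}" using card_mono[of "{a, b}" "{1..n}"] by auto
  then obtain k where k: "k \<in> {1..n}" "k \<noteq> a" "k \<noteq> b" by blast
  \<comment> \<open>Along the line the change of \<open>u\<close> is \<open>s' * s\<close> times the
    change of \<open>v\<close>; reversing one sign gives the perpendicular direction. The vertex
    \<open>k\<close> that moves is neither \<open>a\<close> nor \<open>b\<close>, so the pins stay
    fixed.\<close>
  define w where "w = (\<lambda>(i, c :: 2). if i = k then (if c = 1 then s' * s else - 1) else 0)"
  have w: "w (i, 1) = - (s' * s) * w (i, 2)" for i by (simp add: w_def)
  have "\<forall>v\<in>verts n. w v = 0"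
  proof (rule nd)
    show "\<forall>e\<in>E. dprd e (rep n a b y z) w = 0"
    proof
      fix e assume e: "e \<in> E"
      obtain i j where "i \<in> {1..n}" "j \<in> {1..n}" "Min e = i" "Max e = j" by (rule simple_graph_edge[OF sg e])
      note ij = this
      have "dprd e g w = ((g (i, 1) - g (j, 1)) - (s' * s) * (g (i, 2) - g (j, 2))) * (w (i, 2) - w (j, 2))"
        unfolding dprd_def w ij(3,4) by (simp add: algebra_simps)
      then show "dprd e (rep n a b y z) w = 0" using col[OF ij(1,2)] by (simp add: g_def)
    qed
    show "\<forall>v\<in>pins a b. w v = 0" using k by (auto simp: pins_def w_def)
  qed
  then have "w (k, 2) = 0" by (rule bspec) (use k in \<open>simp add: verts_def\<close>)
  then show False by (simp add: w_def)
qed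

section \<open>Comparing congruence classes with points of the pinned fibre\<close>

lemma edge_map_eq_iff:
  "edge_map E q = edge_map E p \<longleftrightarrow> (\<forall>e\<in>E. sqd e (coords q) = sqd e (coords p))"
proof -
  have e: "edge_map E q e = 1 / 2 * sqd e (coords q)" if "e \<in> E" for e and q :: "nat \<Rightarrow> complex ^ 2"
    using that by (simp add: edge_map_def sqd_def coords_def)
  show ?thesis
  proof
    assume eq: "edge_map E q = edge_map E p"
    show "\<forall>e\<in>E. sqd e (coords q) = sqd e (coords p)"
    proof
      fix f assume "f \<in> E"
      then show "sqd f (coords q) = sqd f (coords p)" using fun_cong[OF eq, of f] e by simp
    qed
  next
    assume s: "\<forall>e\<in>E. sqd e (coords q) = sqd e (coords p)"
    show "edge_map E q = edge_map E p"
    proof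
      fix f show "edge_map E q f = edge_map E p f"
        using s e by (cases "f \<in> E") (auto simp: edge_map_def)
    qed
  qed
qed

lemma card_two_preimages:
  assumes "finite F" "\<And>X. X \<in> R \<Longrightarrow> \<exists>g1\<in>F. \<exists>g2\<in>F. g1 \<noteq> g2 \<and> \<rho> g1 = X \<and> \<rho> g2 = X"
  shows "finite R \<and> 2 * card R \<le> card F"
proof
  have "R \<subseteq> \<rho> ` F" using assms(2) by blast
  then show fR: "finite R" using assms(1) finite_surj by blast
  have "2 * card R = (\<Sum>X\<in>R. 2)" by simp
  also have "\<dots> \<le> (\<Sum>X\<in>R. card {g \<in> F. \<rho> g = X})"
  proof (rule sum_mono)
    fix X assume "X \<in> R"
    then obtain g1 g2 where g: "g1 \<in> F" "g2 \<in> F" "g1 \<noteq> g2" "\<rho> g1 = X" "\<rho> g2 = X" using assms(2) by blast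
    then have "card {g1, g2} \<le> card {g \<in> F. \<rho> g = X}" by (intro card_mono) (use assms(1) in auto)
    then show "2 \<le> card {g \<in> F. \<rho> g = X}" using g by simp
  qed
  also have "\<dots> = card (\<Union>X\<in>R. {g \<in> F. \<rho> g = X})"
    by (rule card_UN_disjoint[symmetric]) (use fR assms(1) in auto)
  also have "\<dots> \<le> card F" by (rule card_mono) (use assms(1) in auto)
  finally show "2 * card R \<le> card F" .
qed

text \<open>Normalising a member of a class and its mirror image to the pins of \<open>z\<close>
  gives two points of the fibre, both congruent to that member and different from each other by
  nondegeneracy.\<close>

lemma realisations_card_le_fib:
  fixes p :: "nat \<Rightarrow> complex ^ 2"
  assumes sg: "simple_graph n E" and n3: "n \<ge> 3" and ab: "a \<in> {1..n}" "b \<in> {1..n}" "{a, b} \<in> E"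
    and p: "p \<in> configs n" and z: "z = uvc (coords p)"
    and nz: "prd {a, b} z \<noteq> 0" and fin: "finite (fib n E a b z)"
    and nd: "\<And>z' w. z' \<in> fib n E a b z \<Longrightarrow> \<forall>e\<in>E. dprd e z' w = 0 \<Longrightarrow> \<forall>v\<in>pins a b. w v = 0 \<Longrightarrow>
      \<forall>v\<in>verts n. w v = 0"
  shows "finite (realisations n E p) \<and> 2 * card (realisations n E p) \<le> card (fib n E a b z)"
proof (rule card_two_preimages[OF fin])
  have dif: "x (a, 1) \<noteq> x (b, 1)" "x (a, 2) \<noteq> x (b, 2)" if "prd {a, b} x \<noteq> 0" for x
  proof -
    have "prd {a, b} x = (x (a, 1) - x (b, 1)) * (x (a, 2) - x (b, 2))"
      by (cases "a \<le> b") (simp_all add: prd_def min_def max_def algebra_simps)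
    with that show "x (a, 1) \<noteq> x (b, 1)" "x (a, 2) \<noteq> x (b, 2)" by auto
  qed
  fix X assume "X \<in> realisations n E p"
  then obtain q where q: "q \<in> configs n" "edge_map E q = edge_map E p" "X = congruent_configs n `` {q}"
    unfolding realisations_def by (auto elim: quotientE)
  define y where "y = uvc (coords q)"
  have qy: "config n (xyc y) = q" using config_coords[OF q(1)] by (simp add: y_def)
  have eq: "\<forall>e\<in>E. prd e y = prd e z"
    using q(2) unfolding edge_map_eq_iff y_def z sqd_uvc .
  then have nzy: "prd {a, b} y \<noteq> 0" using nz ab(3) by simp
  have zd: "z (a, 1) \<noteq> z (b, 1)" by (rule dif(1)[OF nz])
  define g1 where "g1 = rep n a b z y"
  define g2 where "g2 = rep n a b z (swp y)"
  have g1: "g1 \<in> fib n E a b z" unfolding g1_def by (rule rep_fib[OF sg ab(1,2) dif(1)[OF nzy] zd eq])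
  have g2: "g2 \<in> fib n E a b z" unfolding g2_def
    by (rule rep_fib[OF sg ab(1,2) _ zd]) (use dif(2)[OF nzy] eq in \<open>simp_all add: prd_swp\<close>)
  have c1: "(config n (xyc g1), q) \<in> congruent_configs n"
    using rep_congruent[OF dif(1)[OF nzy] zd, of n] qy by (simp add: g1_def)
  have "(config n (xyc g2), config n (xyc (swp y))) \<in> congruent_configs n"
    unfolding g2_def by (rule rep_congruent[OF _ zd]) (use dif(2)[OF nzy] in simp)
  from congruent_trans[OF this congruent_swp] have c2: "(config n (xyc g2), q) \<in> congruent_configs n"
    using qy by simp
  have "g1 \<noteq> g2" unfolding g1_def g2_def
    by (rule rep_swp_neq[OF n3 sg dif[OF nzy] zd nd[OF g1[unfolded g1_def]]])
  then show "\<exists>g1\<in>fib n E a b z. \<exists>g2\<in>fib n E a b z. g1 \<noteq> g2 \<and>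
      congruent_configs n `` {config n (xyc g1)} = X \<and> congruent_configs n `` {config n (xyc g2)} = X"
    using g1 g2 c1 c2 congruent_class_eq[OF q(1)] q(3) by blast
qed

section \<open>Rigidity from finiteness\<close>

lemma dist2_sq: "(dist u v)\<^sup>2 = (u $ 1 - v $ 1)\<^sup>2 + (u $ 2 - v $ 2)\<^sup>2" for u v :: "real ^ 2"
  by (simp add: dist_vec_def L2_set_def sum_2 dist_real_def)

text \<open>\<open>\<alpha>\<close> and \<open>\<beta>\<close> are the dot and cross products of
  \<open>y - a\<close> with \<open>(d1, d2)\<close>; \<open>T\<close> reuses them as coordinates in
  the frame of \<open>(e1, e2)\<close>, a vector of the same squared length
  \<open>D\<close>.\<close>

lemma frame_isometry:
  fixes a b x :: "real ^ 2" and d1 d2 e1 e2 D :: real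
  assumes D: "D \<noteq> 0" "d1\<^sup>2 + d2\<^sup>2 = D" "e1\<^sup>2 + e2\<^sup>2 = D"
  defines "\<alpha> \<equiv> \<lambda>y :: real ^ 2. (y $ 1 - a $ 1) * d1 + (y $ 2 - a $ 2) * d2"
    and "\<beta> \<equiv> \<lambda>y :: real ^ 2. (y $ 1 - a $ 1) * d2 - (y $ 2 - a $ 2) * d1"
  defines "T \<equiv> (\<lambda>y. \<chi> k. if k = 1 then b $ 1 + (\<alpha> y * e1 + \<beta> y * e2) / D else b $ 2 + (\<alpha> y * e2 - \<beta> y * e1) / D) :: real ^ 2 \<Rightarrow> real ^ 2"
  shows "dist (T x) (T y) = dist x y"
proof -
  define p q where "p = \<alpha> x - \<alpha> y" and "q = \<beta> x - \<beta> y"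
  have pq: "p = (x $ 1 - y $ 1) * d1 + (x $ 2 - y $ 2) * d2" "q = (x $ 1 - y $ 1) * d2 - (x $ 2 - y $ 2) * d1"
    by (simp_all add: p_def q_def \<alpha>_def \<beta>_def algebra_simps)
  have s: "p\<^sup>2 + q\<^sup>2 = ((x $ 1 - y $ 1)\<^sup>2 + (x $ 2 - y $ 2)\<^sup>2) * D"
    unfolding pq D(2)[symmetric] by (simp add: power2_eq_square algebra_simps)
  have 1: "T x $ 1 - T y $ 1 = (p * e1 + q * e2) / D"
    by (simp add: T_def p_def q_def diff_divide_distrib add_divide_distrib algebra_simps)
  have 2: "T x $ 2 - T y $ 2 = (p * e2 - q * e1) / D"
    by (simp add: T_def p_def q_def diff_divide_distrib add_divide_distrib algebra_simps)
  have "(dist (T x) (T y))\<^sup>2 = ((p * e1 + q * e2)\<^sup>2 + (p * e2 - q * e1)\<^sup>2) / D\<^sup>2"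
    unfolding dist2_sq 1 2 by (simp only: power_divide add_divide_distrib[symmetric])
  also have "(p * e1 + q * e2)\<^sup>2 + (p * e2 - q * e1)\<^sup>2 = (p\<^sup>2 + q\<^sup>2) * (e1\<^sup>2 + e2\<^sup>2)"
    by (simp add: power2_eq_square algebra_simps)
  also have "\<dots> / D\<^sup>2 = (dist x y)\<^sup>2"
    unfolding s D(3) dist2_sq using D(1) by (simp add: power2_eq_square)
  finally show ?thesis by simp
qed

text \<open>The motion of the two points \<open>a\<close> and \<open>b\<close>, which do not
  coincide, already determines an isometry. Constant distances keep dot products fixed, continuity
  keeps cross products fixed, and so every vertex follows the same isometry.\<close>

lemma constant_distances_congruent:
  fixes p :: "nat \<Rightarrow> real ^ 2" and \<gamma> :: "real \<Rightarrow> nat \<Rightarrow> real ^ 2"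
  assumes cont: "\<And>i. i \<in> {1..n} \<Longrightarrow> continuous_on {0..1} (\<lambda>t. \<gamma> t i)"
    and start: "\<And>i. i \<in> {1..n} \<Longrightarrow> \<gamma> 0 i = p i"
    and const: "\<And>t i j. t \<in> {0..1} \<Longrightarrow> i \<in> {1..n} \<Longrightarrow> j \<in> {1..n} \<Longrightarrow>
      sqd {i, j} (coords (\<gamma> t)) = sqd {i, j} (coords (\<gamma> 0))"
    and ab: "a \<in> {1..n}" "b \<in> {1..n}" and nz: "sqd {a, b} (coords p) \<noteq> 0" and t: "t \<in> {0..1}"
  shows "\<exists>T :: real ^ 2 \<Rightarrow> real ^ 2. (\<forall>x y. dist (T x) (T y) = dist x y) \<and> (\<forall>i\<in>{1..n}. \<gamma> t i = T (p i))"
proof -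
  define x where "x t = coords (\<gamma> t)" for t
  have xc: "x t (i, k) = \<gamma> t i $ k" for t i k by (simp add: x_def coords_def)
  have contx: "continuous_on {0..1} (\<lambda>t. x t v)" if "v \<in> verts n" for v
  proof -
    obtain i k where v: "v = (i, k)" "i \<in> {1..n}" using \<open>v \<in> verts n\<close> by (auto simp: verts_def)
    show ?thesis unfolding v(1) xc by (intro continuous_on_component cont v(2))
  qed
  have x0: "x 0 (i, k) = p i $ k" if "i \<in> {1..n}" for i k by (simp add: xc start[OF that])
  define D where "D = sqd {a, b} (x 0)"
  have D: "D \<noteq> 0" using nz x0 ab by (simp add: D_def sqd_pair coords_def)
  have Dt: "sqd {a, b} (x t) = D" unfolding D_def x_def by (rule const[OF t ab])
  define d1 d2 e1 e2 where "d1 = x 0 (b,1) - x 0 (a,1)" and "d2 = x 0 (b,2) - x 0 (a,2)"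
    and "e1 = x t (b,1) - x t (a,1)" and "e2 = x t (b,2) - x t (a,2)"
  have sq: "d1\<^sup>2 + d2\<^sup>2 = D" "e1\<^sup>2 + e2\<^sup>2 = D"
    unfolding D_def d1_def d2_def using Dt unfolding D_def e1_def e2_def
    by (simp_all add: sqd_pair power2_commute)
  define \<alpha> \<beta> where "\<alpha> = (\<lambda>y :: real ^ 2. (y $ 1 - p a $ 1) * d1 + (y $ 2 - p a $ 2) * d2)"
    and "\<beta> = (\<lambda>y :: real ^ 2. (y $ 1 - p a $ 1) * d2 - (y $ 2 - p a $ 2) * d1)"
  define T :: "real ^ 2 \<Rightarrow> real ^ 2" where "T = (\<lambda>y. \<chi> k. if k = 1 then \<gamma> t a $ 1 + (\<alpha> y * e1 + \<beta> y * e2) / D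
      else \<gamma> t a $ 2 + (\<alpha> y * e2 - \<beta> y * e1) / D)"
  have "dist (T u) (T v) = dist u v" for u v
    unfolding T_def \<alpha>_def \<beta>_def by (rule frame_isometry[OF D sq])
  moreover have "\<gamma> t i = T (p i)" if i: "i \<in> {1..n}" for i
  proof -
    have dtc: "dt a b i (x t) = dt a b i (x 0)"
      using dt_sqd[of a b i "x t"] dt_sqd[of a b i "x 0"] const[OF t] ab i unfolding x_def by simp
    have crc: "crs a b i (x t) = crs a b i (x 0)"
    proof (rule crs_const[of n x])
      show "sqd {i, j} (x t) = sqd {i, j} (x 0)" if "t \<in> {0..1}" "i \<in> {1..n}" "j \<in> {1..n}" for t i j
        unfolding x_def by (rule const[OF that])
    qed (use contx ab i t in simp_all)
    have "\<alpha> (p i) = dt a b i (x 0)" "\<beta> (p i) = crs a b i (x 0)"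
      using x0[OF i] x0[OF ab(1)] by (simp_all add: \<alpha>_def \<beta>_def dt_def crs_def d1_def d2_def)
    then have al: "\<alpha> (p i) = dt a b i (x t)" "\<beta> (p i) = crs a b i (x t)" using dtc crc by simp_all
    have f: "(x t (i,1) - x t (a,1)) * D = dt a b i (x t) * e1 + crs a b i (x t) * e2"
      "(x t (i,2) - x t (a,2)) * D = dt a b i (x t) * e2 - crs a b i (x t) * e1"
      using from_dt_crs[of "x t" i a b] unfolding Dt e1_def e2_def by simp_all
    have "x t (i,1) = x t (a,1) + (\<alpha> (p i) * e1 + \<beta> (p i) * e2) / D"
      "x t (i,2) = x t (a,2) + (\<alpha> (p i) * e2 - \<beta> (p i) * e1) / D"
      unfolding al f[symmetric] using D by simp_all
    then have "\<gamma> t i $ 1 = \<gamma> t a $ 1 + (\<alpha> (p i) * e1 + \<beta> (p i) * e2) / D"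
      "\<gamma> t i $ 2 = \<gamma> t a $ 2 + (\<alpha> (p i) * e2 - \<beta> (p i) * e1) / D"
      unfolding xc by simp_all
    then show ?thesis by (simp add: vec_eq_iff forall_2 T_def)
  qed
  ultimately show ?thesis by (intro exI[of _ T]) simp
qed

lemma uvc_pfun:
  assumes "v \<in> verts n" shows "(\<lambda>x. uvc x v) \<in> pfun (verts n)"
proof -
  obtain i k where v: "v = (i, k)" "i \<in> {1..n}" using assms by (auto simp: verts_def)
  have "(i, c) \<in> verts n" for c using v by (simp add: verts_def)
  then have "(\<lambda>x. x (i, 1) + \<i> * x (i, 2)) \<in> pfun (verts n)" "(\<lambda>x. x (i, 1) - \<i> * x (i, 2)) \<in> pfun (verts n)"
    by (intro pfun.add pfun_diff pfun.mult pfun.const pfun.var; simp)+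
  then show ?thesis by (cases "k = 1") (simp_all add: v uvc_def)
qed

text \<open>Along a real motion with constant edge lengths every position, once normalised, lies in
  one and the same finite complex fibre. Each squared distance between vertices thus takes finitely
  many values and is constant by continuity.\<close>

lemma algindep_imp_rigid:
  assumes sg: "simple_graph n E" and n3: "n \<ge> 3" and cardE: "card E + 3 = 2 * n" and ind: "algindep prd E"
  shows "rigid TYPE(2) n E"
proof -
  obtain a b h z0 where ab: "a \<in> {1..n}" "b \<in> {1..n}" and abE: "{a, b} \<in> E"
    and hp: "h \<in> pfun (verts n)" "h z0 \<noteq> 0"
    and hh: "\<forall>z. h z \<noteq> 0 \<longrightarrow> z (a, 1) \<noteq> z (b, 1) \<and> (\<forall>e\<in>E. prd e z \<noteq> 0) \<and>
      (\<forall>r. linear_order_on E r \<longrightarrow>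
        finite (fib n E a b z) \<and> card (fib n E a b z) \<le> nbc r (graphic_matroid E)) \<and>
      (\<forall>z' w. z' \<in> fib n E a b z \<longrightarrow> (\<forall>e\<in>E. dprd e z' w = 0) \<longrightarrow> (\<forall>v\<in>pins a b. w v = 0) \<longrightarrow>
        (\<forall>v\<in>verts n. w v = 0))"
    using generic_fib[OF sg n3 cardE ind] by (elim exE conjE)
  have hd: "z (a, 1) \<noteq> z (b, 1)" and hn: "\<And>e. e \<in> E \<Longrightarrow> prd e z \<noteq> 0"
    and hf: "\<And>r. linear_order_on E r \<Longrightarrow> finite (fib n E a b z)" if "h z \<noteq> 0" for z
    using hh[rule_format, OF that] by auto
  obtain r where "well_order_on E r" using well_order_on by blast
  then have r: "linear_order_on E r" by (simp add: well_order_on_def)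
  define H where "H x = h (uvc x)" for x
  have Hp: "H \<in> pfun (verts n)" unfolding H_def by (intro pfun_subst[OF hp(1)] uvc_pfun)
  have "H (xyc z0) \<noteq> 0" using hp(2) by (simp add: H_def)
  then obtain y where y: "H (\<lambda>b. of_real (y b)) \<noteq> 0" using pfun_real_points[OF Hp] by blast
  obtain R I where RI: "R \<in> pfun (verts n)" "I \<in> pfun (verts n)" "\<forall>y. H (\<lambda>b. of_real (y b)) = Complex (R y) (I y)"
    using pfun_real_imag[OF Hp] by (elim bexE)
  have fr: "rigid_framework n E p" if p: "H (\<lambda>v. of_real (coords p v)) \<noteq> 0" for p :: "nat \<Rightarrow> real ^ 2"
    unfolding rigid_framework_def
  proof (intro allI impI ballI)
    fix \<gamma> :: "real \<Rightarrow> nat \<Rightarrow> real ^ 2" and t :: real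
    assume as: "(\<forall>i\<in>{1..n}. continuous_on {0..1} (\<lambda>t. \<gamma> t i) \<and> \<gamma> 0 i = p i) \<and>
       (\<forall>t\<in>{0..1}. \<forall>i j. {i, j} \<in> E \<longrightarrow> dist (\<gamma> t i) (\<gamma> t j) = dist (p i) (p j))" and t: "t \<in> {0..1}"
    define cz where "cz x = uvc (\<lambda>v. of_real (x v :: real))" for x
    have sqc: "of_real (sqd e x) = prd e (cz x)" for e x
      by (simp add: cz_def sqd_uvc[symmetric]) (simp add: sqd_def)
    define z where "z = cz (coords p)"
    have hz: "h z \<noteq> 0" using p by (simp add: H_def z_def cz_def)
    have fin: "finite (fib n E a b z)" by (rule hf[OF hz r])
    have edges: "\<forall>e\<in>E. prd e (cz (coords (\<gamma> t))) = prd e z" if "t \<in> {0..1}" for t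
    proof
      fix e assume e: "e \<in> E"
      obtain i j where ij: "e = {i, j}" by (rule edge_pair[OF sg e])
      have "dist (\<gamma> t i) (\<gamma> t j) = dist (p i) (p j)" using as that e ij by blast
      then have "sqd e (coords (\<gamma> t)) = sqd e (coords p)" unfolding ij dist_sqd[symmetric] by simp
      then show "prd e (cz (coords (\<gamma> t))) = prd e z" unfolding z_def sqc[symmetric] by simp
    qed
    have vals: "sqd {i, j} (coords (\<gamma> t)) \<in> Re ` prd {i, j} ` fib n E a b z"
      if t: "t \<in> {0..1}" and ij: "i \<in> {1..n}" "j \<in> {1..n}" for t i j
    proof -
      have "prd {a, b} (cz (coords (\<gamma> t))) \<noteq> 0" using edges[OF t] hn[OF hz] abE by simp
      then have d: "cz (coords (\<gamma> t)) (a, 1) \<noteq> cz (coords (\<gamma> t)) (b, 1)"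
        by (cases "a \<le> b") (auto simp: prd_def min_def max_def)
      have "rep n a b z (cz (coords (\<gamma> t))) \<in> fib n E a b z"
        by (rule rep_fib[OF sg ab d hd[OF hz] edges[OF t]])
      moreover have "prd {i, j} (rep n a b z (cz (coords (\<gamma> t)))) = of_real (sqd {i, j} (coords (\<gamma> t)))"
        unfolding sqc by (rule rep_prd[OF d hd[OF hz] ij])
      ultimately show ?thesis by (metis Re_complex_of_real imageI)
    qed
    have cont: "continuous_on {0..1} (\<lambda>t. sqd {i, j} (coords (\<gamma> t)))" if "i \<in> {1..n}" "j \<in> {1..n}" for i j
      unfolding sqd_pair coords_def using as that by (auto intro!: continuous_intros)
    have const: "sqd {i, j} (coords (\<gamma> t)) = sqd {i, j} (coords (\<gamma> 0))"
      if t: "t \<in> {0..1}" and ij: "i \<in> {1..n}" "j \<in> {1..n}" for t i j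
      by (rule continuous_finite_values_const[OF cont[OF ij] _ vals[OF _ ij] t]) (use fin in simp)
    show "\<exists>T :: real ^ 2 \<Rightarrow> real ^ 2. (\<forall>x y. dist (T x) (T y) = dist x y) \<and> (\<forall>i\<in>{1..n}. \<gamma> t i = T (p i))"
    proof (rule constant_distances_congruent[of n \<gamma> p a b t])
      have "prd {a, b} (cz (coords p)) \<noteq> 0" using hn[OF hz abE] by (simp add: z_def)
      then show "sqd {a, b} (coords p) \<noteq> 0" unfolding sqc[symmetric] by simp
      show "sqd {i, j} (coords (\<gamma> t)) = sqd {i, j} (coords (\<gamma> 0))"
        if "t \<in> {0..1}" "i \<in> {1..n}" "j \<in> {1..n}" for t i j
        by (rule const[OF that])
      show "a \<in> {1..n}" "b \<in> {1..n}" "t \<in> {0..1}" by (fact ab t)+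
      show "continuous_on {0..1} (\<lambda>t. \<gamma> t i)" "\<gamma> 0 i = p i" if "i \<in> {1..n}" for i
        using as that by auto
    qed
  qed
  \<comment> \<open>A complex number is nonzero through its real or its imaginary part; whichever of
    the two real polynomials is nonzero at \<open>y\<close> becomes the witness of genericity over
    the reals.\<close>
  have "R y \<noteq> 0 \<or> I y \<noteq> 0" using y RI(3) by (auto simp: complex_eq_iff)
  then have "generically n (\<lambda>p :: nat \<Rightarrow> real ^ 2. rigid_framework n E p)"
  proof
    assume "R y \<noteq> 0"
    then show ?thesis
      by (rule generically_pfunI[OF RI(1)]) (rule fr, use RI(3) in \<open>simp add: complex_eq_iff\<close>)
  next
    assume "I y \<noteq> 0"
    then show ?thesis
      by (rule generically_pfunI[OF RI(2)]) (rule fr, use RI(3) in \<open>simp add: complex_eq_iff\<close>)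
  qed
  then show ?thesis by (simp add: rigid_def)
qed

lemma generically_mono: "generically n P \<Longrightarrow> (\<And>p. P p \<Longrightarrow> Q p) \<Longrightarrow> generically n Q"
  unfolding generically_def by (elim exE conjE, rule exI, intro conjI) (assumption+, simp)

lemma rigid_mono:
  assumes "rigid TYPE(2) n E" "E \<subseteq> E'" shows "rigid TYPE(2) n E'"
proof -
  have "rigid_framework n E' p" if p: "rigid_framework n E p" for p :: "nat \<Rightarrow> real ^ 2"
    unfolding rigid_framework_def
  proof (intro allI impI)
    fix \<gamma> :: "real \<Rightarrow> nat \<Rightarrow> real ^ 2"
    assume as: "(\<forall>i\<in>{1..n}. continuous_on {0..1} (\<lambda>t. \<gamma> t i) \<and> \<gamma> 0 i = p i) \<and>
       (\<forall>t\<in>{0..1}. \<forall>i j. {i, j} \<in> E' \<longrightarrow> dist (\<gamma> t i) (\<gamma> t j) = dist (p i) (p j))"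
    show "\<forall>t\<in>{0..1}. \<exists>T :: real ^ 2 \<Rightarrow> real ^ 2.
            (\<forall>x y. dist (T x) (T y) = dist x y) \<and> (\<forall>i\<in>{1..n}. \<gamma> t i = T (p i))"
      by (rule p[unfolded rigid_framework_def, THEN spec, of \<gamma>, THEN mp]) (use as assms(2) in blast)
  qed
  with assms(1) show ?thesis unfolding rigid_def by (rule generically_mono)
qed

lemma minimally_rigid_algindep:
  assumes sg: "simple_graph n E" and n3: "n \<ge> 3" and mr: "minimally_rigid TYPE(2) n E"
  shows "card E + 3 = 2 * n \<and> algindep prd E"
proof -
  have rig: "rigid TYPE(2) n E" and min: "\<And>e. e \<in> E \<Longrightarrow> \<not> rigid TYPE(2) n (E - {e})"
    using mr by (auto simp: minimally_rigid_def)
  have "\<exists>E'\<subseteq>E. algindep (sqd :: nat set \<Rightarrow> (nat \<times> 2 \<Rightarrow> real) \<Rightarrow> real) E' \<and> 2 * n \<le> card E' + 3"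
    by (rule rigid_imp_algindep[OF sg _ rig]) (use n3 in simp)
  then obtain E1 where E1: "E1 \<subseteq> E" "algindep (sqd :: nat set \<Rightarrow> (nat \<times> 2 \<Rightarrow> real) \<Rightarrow> real) E1" "2 * n \<le> card E1 + 3"
    by (elim exE conjE)
  have "2 * n - 3 \<le> card E1" using E1(3) by simp
  then obtain E' where E': "E' \<subseteq> E1" "card E' = 2 * n - 3" by (meson obtain_subset_with_card_n)
  have sg': "simple_graph n E'" using sg E1(1) E'(1) by (auto simp: simple_graph_def)
  have ind: "algindep prd E'" by (rule algindep_subset[OF algindep_prd[OF E1(2)] E'(1)])
  have card: "card E' + 3 = 2 * n" using E'(2) n3 by simp
  have rig': "rigid TYPE(2) n E'" by (rule algindep_imp_rigid[OF sg' n3 card ind])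
  have "E' = E"
  proof (rule ccontr)
    assume "E' \<noteq> E"
    then obtain e where e: "e \<in> E" "e \<notin> E'" using E'(1) E1(1) by blast
    have "rigid TYPE(2) n (E - {e})" by (rule rigid_mono[OF rig']) (use E'(1) E1(1) e in auto)
    with min[OF e(1)] show False by simp
  qed
  then show ?thesis using card ind by simp
qed

section \<open>The generic number of realisations\<close>

text \<open>Several configurations are encoded in one assignment of values to variables \<open>(k, i, c)\<close>, where
  \<open>k\<close> is the number of the configuration.\<close>

definition blk :: "nat \<Rightarrow> (nat \<times> nat \<times> 2 \<Rightarrow> complex) \<Rightarrow> nat \<times> 2 \<Rightarrow> complex" where
  "blk k x = (\<lambda>(i, c). x (k, i, c))"

lemma blk_simp [simp]: "blk k x (i, c) = x (k, i, c)"
  by (simp add: blk_def)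

text \<open>The matrix and the translation become coordinates of an extra block \<open>m\<close>,
  beyond both \<open>k\<close> and \<open>l\<close> so that the two configurations are not
  disturbed; rows 1 and 2 hold the matrix and row 3 the translation. The conditions on them are
  polynomial, and the block is eliminated.\<close>

lemma constr_congruent:
  "{x. (config n (blk k x), config n (blk l x)) \<in> congruent_configs n} \<in> constr"
proof -
  define m where "m = Suc (k + l)"
  define row :: "2 \<Rightarrow> nat" where "row i = (if i = 1 then 1 else 2)" for i
  define W :: "(nat \<times> nat \<times> 2) set" where "W = {m} \<times> {1, 2, 3} \<times> UNIV"
  define S1 where "S1 = {y :: nat \<times> nat \<times> 2 \<Rightarrow> complex. \<forall>ij\<in>UNIV. y \<in> {y.
     (\<Sum>t\<in>UNIV. y (m, row t, fst ij) * y (m, row t, snd ij)) = (if fst ij = snd ij then 1 else 0)}}"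
  define S2 where "S2 = {y :: nat \<times> nat \<times> 2 \<Rightarrow> complex. \<forall>ij\<in>UNIV. y \<in> {y.
     (\<Sum>t\<in>UNIV. y (m, row (fst ij), t) * y (m, row (snd ij), t)) = (if fst ij = snd ij then 1 else 0)}}"
  define S3 where "S3 = {y :: nat \<times> nat \<times> 2 \<Rightarrow> complex. \<forall>ic\<in>{1..n} \<times> UNIV. y \<in> {y.
     y (k, fst ic, snd ic) = (\<Sum>t\<in>UNIV. y (m, row (snd ic), t) * y (l, fst ic, t)) + y (m, 3, snd ic)}}"
  have "S1 \<in> constr" unfolding S1_def
    by (intro constr_Inter constr_eq pfun_sum pfun.intros) auto
  moreover have "S2 \<in> constr" unfolding S2_def
    by (intro constr_Inter constr_eq pfun_sum pfun.intros) auto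
  moreover have "S3 \<in> constr" unfolding S3_def
    by (intro constr_Inter constr_eq pfun_sum pfun.intros) auto
  ultimately have "S1 \<inter> S2 \<inter> S3 \<in> constr" by (intro constr.inter)
  then have "{x. \<exists>y. (\<forall>v. v \<notin> W \<longrightarrow> y v = x v) \<and> y \<in> S1 \<inter> S2 \<inter> S3} \<in> constr"
    by (rule constr_block_ex) (simp add: W_def)
  also have "{x. \<exists>y. (\<forall>v. v \<notin> W \<longrightarrow> y v = x v) \<and> y \<in> S1 \<inter> S2 \<inter> S3}
    = {x. (config n (blk k x), config n (blk l x)) \<in> congruent_configs n}"
  proof (intro set_eqI iffI)
    fix x assume "x \<in> {x. \<exists>y. (\<forall>v. v \<notin> W \<longrightarrow> y v = x v) \<and> y \<in> S1 \<inter> S2 \<inter> S3}"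
    then obtain y where y: "\<forall>v. v \<notin> W \<longrightarrow> y v = x v" and S: "y \<in> S1" "y \<in> S2" "y \<in> S3" by blast
    define A :: "complex ^ 2 ^ 2" where "A = (\<chi> i j. y (m, row i, j))"
    define t :: "complex ^ 2" where "t = (\<chi> j. y (m, 3, j))"
    have "orthogonal_matrix A"
      unfolding orthogonal_matrix_def matrix_matrix_mult_def transpose_def mat_def A_def
      using S(1,2) by (simp add: vec_eq_iff S1_def S2_def)
    moreover have "config n (blk k x) i = A *v config n (blk l x) i + t" if i: "i \<in> {1..n}" for i
    proof -
      have "y (k, i, c) = x (k, i, c)" "y (l, i, c) = x (l, i, c)" for c
        using y by (simp_all add: W_def m_def)
      moreover have "y (k, i, c) = (\<Sum>t\<in>UNIV. y (m, row c, t) * y (l, i, t)) + y (m, 3, c)" for c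
        using S(3) i by (simp add: S3_def)
      ultimately show ?thesis
        using i by (simp add: config_def vec_eq_iff matrix_vector_mult_def A_def t_def)
    qed
    ultimately show "x \<in> {x. (config n (blk k x), config n (blk l x)) \<in> congruent_configs n}"
      unfolding congruent_configs_def by (auto simp: config_in)
  next
    fix x assume "x \<in> {x. (config n (blk k x), config n (blk l x)) \<in> congruent_configs n}"
    then obtain A :: "complex ^ 2 ^ 2" and t where A: "orthogonal_matrix A"
      and eq: "\<forall>i\<in>{1..n}. config n (blk k x) i = A *v config n (blk l x) i + t"
      unfolding congruent_configs_def by auto
    define y where "y = (\<lambda>(k', i, c). if k' = m then
        (if i = 1 then A $ 1 $ c else if i = 2 then A $ 2 $ c else if i = 3 then t $ c else x (k', i, c)) else x (k', i, c))"
    have ym: "y (m, row i, c) = A $ i $ c" "y (m, 3, c) = t $ c" for i c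
      using exhaust_2[of i] by (auto simp: y_def row_def)
    have ykl: "y (k, i, c) = x (k, i, c)" "y (l, i, c) = x (l, i, c)" for i c
      by (simp_all add: y_def m_def)
    have "y v = x v" if "v \<notin> W" for v
      using that by (cases v) (auto simp: y_def W_def)
    moreover have "y \<in> S1" "y \<in> S2"
      using A unfolding orthogonal_matrix_def matrix_matrix_mult_def transpose_def mat_def
      by (simp_all add: S1_def S2_def ym vec_eq_iff)
    moreover have "y \<in> S3"
      unfolding S3_def mem_Collect_eq
    proof
      fix ic :: "nat \<times> 2" assume ic: "ic \<in> {1..n} \<times> UNIV"
      then have i: "fst ic \<in> {1..n}" by auto
      have "config n (blk k x) (fst ic) $ snd ic = (A *v config n (blk l x) (fst ic) + t) $ snd ic"
        using eq i by simp
      then show "y (k, fst ic, snd ic) = (\<Sum>t\<in>UNIV. y (m, row (snd ic), t) * y (l, fst ic, t)) + y (m, 3, snd ic)"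
        using i ykl[of "fst ic" "snd ic"] by (simp add: config_def matrix_vector_mult_def ym ykl)
    qed
    ultimately show "x \<in> {x. \<exists>y. (\<forall>v. v \<notin> W \<longrightarrow> y v = x v) \<and> y \<in> S1 \<inter> S2 \<inter> S3}" by blast
  qed
  finally show ?thesis .
qed

text \<open>Representatives of the classes are placed in the blocks 1 to \<open>K\<close> and
  quantified away; block 0 is the given configuration. A subset with \<open>K\<close> elements
  expresses that there are at least \<open>K\<close> classes without presupposing
  finiteness.\<close>

lemma constr_realisations_ge:
  assumes sg: "simple_graph n E"
  shows "{x. \<exists>S\<subseteq>realisations n E (config n (blk 0 x)). finite S \<and> card S = K} \<in> constr"
proof -
  define W :: "(nat \<times> nat \<times> 2) set" where "W = {1..K} \<times> {1..n} \<times> UNIV"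
  define G1 where "G1 = {y. \<forall>ke\<in>{1..K} \<times> E. y \<in> {y. sqd (snd ke) (blk (fst ke) y) = sqd (snd ke) (blk 0 y)}}"
  define G2 where "G2 = {y. \<forall>kl\<in>{kl \<in> {1..K} \<times> {1..K}. fst kl \<noteq> snd kl}. y \<in> - {y.
    (config n (blk (fst kl) y), config n (blk (snd kl) y)) \<in> congruent_configs n}}"
  have finE: "finite E" by (rule finite_simple_graph[OF sg])
  have "(\<lambda>y. sqd e (blk k y)) \<in> pfun UNIV" for e k
    unfolding sqd_def blk_simp by (intro pfun_sum pfun_power pfun_diff pfun.var) auto
  then have "G1 \<in> constr" unfolding G1_def using finE by (intro constr_Inter constr_eq) auto
  moreover have "G2 \<in> constr" unfolding G2_def by (intro constr_Inter constr.compl constr_congruent) auto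
  ultimately have "G1 \<inter> G2 \<in> constr" by (rule constr.inter)
  then have "{x. \<exists>y. (\<forall>v. v \<notin> W \<longrightarrow> y v = x v) \<and> y \<in> G1 \<inter> G2} \<in> constr"
    by (rule constr_block_ex) (simp add: W_def)
  also have "{x. \<exists>y. (\<forall>v. v \<notin> W \<longrightarrow> y v = x v) \<and> y \<in> G1 \<inter> G2}
    = {x. \<exists>S\<subseteq>realisations n E (config n (blk 0 x)). finite S \<and> card S = K}"
  proof (intro set_eqI iffI)
    fix x assume "x \<in> {x. \<exists>y. (\<forall>v. v \<notin> W \<longrightarrow> y v = x v) \<and> y \<in> G1 \<inter> G2}"
    then obtain y where y: "\<forall>v. v \<notin> W \<longrightarrow> y v = x v" and G: "y \<in> G1" "y \<in> G2" by blast
    have "y (0, v) = x (0, v)" for v using y by (cases v) (simp add: W_def)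
    then have y0: "blk 0 y = blk 0 x" by (auto simp: blk_def)
    define q where "q k = config n (blk k y)" for k
    define X where "X k = congruent_configs n `` {q k}" for k
    have sq: "sqd e (coords (config n u)) = sqd e u" if "e \<in> E" for e and u :: "nat \<times> 2 \<Rightarrow> complex"
      by (rule pfun_cong[OF sqd_pfun[OF sg that]]) (rule coords_config)
    have "X k \<in> realisations n E (config n (blk 0 x))" if k: "k \<in> {1..K}" for k
    proof -
      have "edge_map E (q k) = edge_map E (config n (blk 0 x))"
        unfolding edge_map_eq_iff
      proof
        fix e assume e: "e \<in> E"
        have "sqd e (blk k y) = sqd e (blk 0 y)" using G(1) k e unfolding G1_def by auto
        then show "sqd e (coords (q k)) = sqd e (coords (config n (blk 0 x)))"
          unfolding q_def sq[OF e] y0 .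
      qed
      then show ?thesis unfolding realisations_def X_def
        by (intro quotientI) (simp add: q_def config_in)
    qed
    moreover have "inj_on X {1..K}"
    proof (rule inj_onI, rule ccontr)
      fix k l assume kl: "k \<in> {1..K}" "l \<in> {1..K}" "X k = X l" "k \<noteq> l"
      then have "(q k, q l) \<in> congruent_configs n"
        unfolding X_def using congruent_class_eq[of "q l" n "q k"] by (simp add: q_def config_in)
      moreover have "(k, l) \<in> {kl \<in> {1..K} \<times> {1..K}. fst kl \<noteq> snd kl}" using kl by simp
      ultimately show False using G(2) unfolding G2_def q_def by fastforce
    qed
    then have "card (X ` {1..K}) = K" by (simp add: card_image)
    ultimately show "x \<in> {x. \<exists>S\<subseteq>realisations n E (config n (blk 0 x)). finite S \<and> card S = K}"
      by (intro CollectI exI[of _ "X ` {1..K}"]) auto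
  next
    fix x assume "x \<in> {x. \<exists>S\<subseteq>realisations n E (config n (blk 0 x)). finite S \<and> card S = K}"
    then obtain S where S: "S \<subseteq> realisations n E (config n (blk 0 x))" "finite S" "card S = K" by blast
    obtain X where X: "bij_betw X {1..K} S" using ex_bij_betw_nat_finite_1[OF S(2)] S(3) by auto
    have "\<forall>k\<in>{1..K}. \<exists>q. q \<in> configs n \<and> edge_map E q = edge_map E (config n (blk 0 x)) \<and> X k = congruent_configs n `` {q}"
    proof
      fix k assume "k \<in> {1..K}"
      then have "X k \<in> realisations n E (config n (blk 0 x))" using X S(1) by (auto simp: bij_betw_def)
      then show "\<exists>q. q \<in> configs n \<and> edge_map E q = edge_map E (config n (blk 0 x)) \<and> X k = congruent_configs n `` {q}"
        unfolding realisations_def by (auto elim!: quotientE)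
    qed
    then obtain q where q: "\<forall>k\<in>{1..K}. q k \<in> configs n \<and> edge_map E (q k) = edge_map E (config n (blk 0 x)) \<and> X k = congruent_configs n `` {q k}"
      unfolding bchoice_iff by (elim exE)
    define y where "y = (\<lambda>(k, i, c). if k \<in> {1..K} \<and> i \<in> {1..n} then q k i $ c else x (k, i, c))"
    have y0: "blk 0 y = blk 0 x" by (rule ext) (auto simp: blk_def y_def)
    have yk: "blk k y v = coords (q k) v" if "k \<in> {1..K}" "v \<in> verts n" for k v
      using that by (auto simp: blk_def y_def coords_def verts_def)
    have ck: "config n (blk k y) = q k" if k: "k \<in> {1..K}" for k
    proof -
      have "config n (blk k y) = config n (coords (q k))"
        unfolding config_def by (rule restrict_ext) (simp add: verts_def vec_eq_iff yk[OF k, unfolded verts_def] del: blk_simp)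
      then show ?thesis using config_coords[of "q k" n] bspec[OF q k] by simp
    qed
    have "y \<in> G1" unfolding G1_def mem_Collect_eq
    proof
      fix ke assume ke: "ke \<in> {1..K} \<times> E"
      obtain k e where ke': "ke = (k, e)" "k \<in> {1..K}" "e \<in> E" using ke by auto
      have "sqd e (coords (q k)) = sqd e (coords (config n (blk 0 x)))"
        using q ke' unfolding edge_map_eq_iff by blast
      moreover have "sqd e (blk k y) = sqd e (coords (q k))"
        by (rule pfun_cong[OF sqd_pfun[OF sg ke'(3)]]) (rule yk[OF ke'(2)])
      moreover have "sqd e (coords (config n (blk 0 x))) = sqd e (blk 0 x)"
        by (rule pfun_cong[OF sqd_pfun[OF sg ke'(3)]]) (rule coords_config)
      ultimately show "sqd (snd ke) (blk (fst ke) y) = sqd (snd ke) (blk 0 y)" unfolding ke' y0 by simp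
    qed
    moreover have "y \<in> G2" unfolding G2_def mem_Collect_eq
    proof
      fix kl assume "kl \<in> {kl \<in> {1..K} \<times> {1..K}. fst kl \<noteq> snd kl}"
      then obtain k l where kl: "kl = (k, l)" "k \<in> {1..K}" "l \<in> {1..K}" "k \<noteq> l" by auto
      then have "X k \<noteq> X l" using X by (auto simp: bij_betw_def dest: inj_onD)
      then have "(q k, q l) \<notin> congruent_configs n" using q kl congruent_class_eq[of "q l" n "q k"] by simp
      then show "y \<in> - {y. (config n (blk (fst kl) y), config n (blk (snd kl) y)) \<in> congruent_configs n}"
        using kl ck by simp
    qed
    moreover have "\<forall>v. v \<notin> W \<longrightarrow> y v = x v" by (auto simp: y_def W_def)
    ultimately show "x \<in> {x. \<exists>y. (\<forall>v. v \<notin> W \<longrightarrow> y v = x v) \<and> y \<in> G1 \<inter> G2}" by blast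
  qed
  finally show ?thesis .
qed

text \<open>An exact count is written as two statements of the form "at least", so that finiteness
  needs no formula of its own.\<close>

lemma finite_card_eq_iff:
  "finite R \<and> card R = c \<longleftrightarrow> (\<exists>S\<subseteq>R. finite S \<and> card S = c) \<and> \<not> (\<exists>S\<subseteq>R. finite S \<and> card S = Suc c)"
proof
  assume R: "finite R \<and> card R = c"
  have "card S \<noteq> Suc c" if "S \<subseteq> R" for S
    using card_mono[of R S] R that by simp
  then show "(\<exists>S\<subseteq>R. finite S \<and> card S = c) \<and> \<not> (\<exists>S\<subseteq>R. finite S \<and> card S = Suc c)"
    using R by blast
next
  assume as: "(\<exists>S\<subseteq>R. finite S \<and> card S = c) \<and> \<not> (\<exists>S\<subseteq>R. finite S \<and> card S = Suc c)"
  have fin: "finite R"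
  proof (rule ccontr)
    assume "infinite R"
    then show False using infinite_arbitrarily_large[of R "Suc c"] as by blast
  qed
  moreover have "c \<le> card R" using as card_mono[OF fin] by blast
  moreover have "\<not> Suc c \<le> card R"
  proof
    assume "Suc c \<le> card R"
    then obtain S where "S \<subseteq> R" "card S = Suc c" "finite S" by (rule obtain_subset_with_card_n)
    with as show False by blast
  qed
  ultimately show "finite R \<and> card R = c" by simp
qed

text \<open>Each \<open>D c\<close> is generically full or generically empty. If all those with
  \<open>c \<le> N\<close> were generically empty, a common point of their witnesses and of
  \<open>h\<close> would have at most \<open>N\<close> classes and yet belong to none of the
  sets.\<close>

lemma generic_count:
  assumes sg: "simple_graph n E" and h: "h \<in> pfun (verts n)" "h z0 \<noteq> (0::complex)"
    and fin: "\<And>p :: nat \<Rightarrow> complex ^ 2. p \<in> configs n \<Longrightarrow> h (coords p) \<noteq> 0 \<Longrightarrow>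
      finite (realisations n E p) \<and> card (realisations n E p) \<le> N"
  shows "\<exists>c\<le>N. generically n (\<lambda>p :: nat \<Rightarrow> complex ^ 2. finite (realisations n E p) \<and> card (realisations n E p) = c)"
proof -
  define D where "D c = {x. finite (realisations n E (config n (blk 0 x))) \<and> card (realisations n E (config n (blk 0 x))) = c}" for c
  have "D c \<in> constr" for c
  proof -
    have "D c = {x. \<exists>S\<subseteq>realisations n E (config n (blk 0 x)). finite S \<and> card S = c}
        \<inter> - {x. \<exists>S\<subseteq>realisations n E (config n (blk 0 x)). finite S \<and> card S = Suc c}"
      unfolding D_def by (intro set_eqI) (use finite_card_eq_iff[of "realisations n E (config n (blk 0 _))" c] in simp)
    then show ?thesis by (simp only:) (intro constr.inter constr.compl constr_realisations_ge[OF sg])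
  qed
  note Dc = this
  have "\<forall>c. \<exists>g. g \<in> pfun UNIV \<and> (\<exists>x. g x \<noteq> 0) \<and> ({x. g x \<noteq> 0} \<subseteq> D c \<or> {x. g x \<noteq> 0} \<subseteq> - D c)"
    by (intro allI) (rule constr_generic[OF Dc, unfolded Bex_def])
  then obtain g where g: "\<forall>c. g c \<in> pfun UNIV \<and> (\<exists>x. g c x \<noteq> 0) \<and> ({x. g c x \<noteq> 0} \<subseteq> D c \<or> {x. g c x \<noteq> 0} \<subseteq> - D c)"
    unfolding choice_iff by (elim exE)
  have gp: "g c \<in> pfun UNIV" "\<exists>x. g c x \<noteq> 0" for c using spec[OF g, of c] by simp_all
  have "\<exists>c\<le>N. {x. g c x \<noteq> 0} \<subseteq> D c"
  proof (rule ccontr)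
    assume "\<not> ?thesis"
    then have neg: "{x. g c x \<noteq> 0} \<subseteq> - D c" if "c \<le> N" for c using spec[OF g, of c] that by auto
    define H where "H i = (case i of None \<Rightarrow> (\<lambda>x. h (blk 0 x)) | Some c \<Rightarrow> g c)" for i
    have hb: "(\<lambda>x. h (blk 0 x)) \<in> pfun UNIV"
      by (rule pfun_subst[OF h(1)]) (auto simp: blk_def case_prod_beta intro: pfun.var)
    have "\<exists>x. (\<Prod>i\<in>insert None (Some ` {..N}). H i x) \<noteq> 0"
    proof (rule pfun_prod_nonzero[where V = UNIV])
      fix i
      show "H i \<in> pfun UNIV" using hb gp by (cases i) (simp_all add: H_def)
      have "h (blk 0 (\<lambda>(k, v). z0 v)) \<noteq> 0" using h(2) by (simp add: blk_def case_prod_beta)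
      then have "\<exists>x. h (blk 0 x) \<noteq> 0" by (rule exI[of "\<lambda>x. h (blk 0 x) \<noteq> 0"])
      then show "\<exists>x. H i x \<noteq> 0" using gp by (cases i) (simp_all add: H_def)
    qed simp
    then obtain x where "(\<Prod>i\<in>insert None (Some ` {..N}). H i x) \<noteq> 0" by blast
    then have x: "H i x \<noteq> 0" if "i \<in> insert None (Some ` {..N})" for i
      using that by (auto simp: prod_zero_iff)
    have "h (coords (config n (blk 0 x))) = h (blk 0 x)"
      by (rule pfun_cong[OF h(1)]) (rule coords_config)
    then have "h (coords (config n (blk 0 x))) \<noteq> 0" using x[of None] by (simp add: H_def)
    from fin[OF config_in this]
    have f: "finite (realisations n E (config n (blk 0 x)))" "card (realisations n E (config n (blk 0 x))) \<le> N" by simp_all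
    define c where "c = card (realisations n E (config n (blk 0 x)))"
    have "x \<in> D c" using f(1) by (simp add: D_def c_def)
    moreover have "g c x \<noteq> 0" using x[of "Some c"] f(2) by (simp add: H_def c_def)
    ultimately show False using neg[of c] f(2) by (auto simp: c_def)
  qed
  then obtain c where c: "c \<le> N" "{x. g c x \<noteq> 0} \<subseteq> D c" by blast
  obtain x0 where x0: "g c x0 \<noteq> 0" using gp(2) by blast
  \<comment> \<open>The witness \<open>g c\<close> may involve variables outside the coordinates of
    block 0; they are frozen at their values in \<open>x0\<close>. The resulting polynomial in one
    configuration is still nonzero at \<open>blk 0 x0\<close>.\<close>
  define emb where "emb z = (\<lambda>(k, v). if k = 0 \<and> v \<in> verts n then z v else x0 (k, v))" for z
  have "(\<lambda>z. g c (emb z)) \<in> pfun (verts n)"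
  proof (rule pfun_subst[OF gp(1)])
    fix kv :: "nat \<times> nat \<times> 2"
    obtain k v where kv: "kv = (k, v)" by (rule prod.exhaust)
    show "(\<lambda>z. emb z kv) \<in> pfun (verts n)"
      by (cases "k = 0 \<and> v \<in> verts n") (auto simp: emb_def kv intro: pfun.intros)
  qed
  moreover have "emb (blk 0 x0) = x0" by (auto simp: emb_def blk_def fun_eq_iff)
  then have "g c (emb (blk 0 x0)) \<noteq> 0" using x0 by simp
  ultimately have "generically n (\<lambda>p :: nat \<Rightarrow> complex ^ 2. finite (realisations n E p) \<and> card (realisations n E p) = c)"
  proof (rule generically_pfunI)
    fix p :: "nat \<Rightarrow> complex ^ 2" assume p: "p \<in> configs n" "g c (emb (coords p)) \<noteq> 0"
    have "config n (blk 0 (emb (coords p))) = config n (coords p)"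
      unfolding config_def by (rule restrict_ext) (simp add: emb_def verts_def)
    then have "config n (blk 0 (emb (coords p))) = p" using config_coords[OF p(1)] by simp
    moreover have "emb (coords p) \<in> D c" using c(2) p(2) by blast
    ultimately show "finite (realisations n E p) \<and> card (realisations n E p) = c" by (simp add: D_def)
  qed
  then show ?thesis using c(1) by blast
qed

text \<open>Two generic conditions always meet, which makes the generic number of realisations
  unique and justifies its definite description.\<close>

lemma generically_common_point:
  fixes P Q :: "(nat \<Rightarrow> complex ^ 2) \<Rightarrow> bool"
  assumes "generically n P" "generically n Q"
  shows "\<exists>p. P p \<and> Q p"
proof -
  obtain h x where h: "h \<in> pfun (verts n)" "h x \<noteq> 0" "\<And>p. p \<in> configs n \<Longrightarrow> h (coords p) \<noteq> 0 \<Longrightarrow> P p"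
    by (rule generically_pfunD[OF assms(1)]) (rule that)
  obtain k y where k: "k \<in> pfun (verts n)" "k y \<noteq> 0" "\<And>p. p \<in> configs n \<Longrightarrow> k (coords p) \<noteq> 0 \<Longrightarrow> Q p"
    by (rule generically_pfunD[OF assms(2)]) (rule that)
  obtain z where z: "h z \<noteq> 0 \<and> k z \<noteq> 0"
    using pfun_two_nonzero[of h "verts n" k x y, OF h(1) k(1) h(2) k(2)] by blast
  have "h (coords (config n z)) = h z" by (rule pfun_cong[OF h(1)]) (rule coords_config)
  moreover have "k (coords (config n z)) = k z" by (rule pfun_cong[OF k(1)]) (rule coords_config)
  ultimately show ?thesis using z h(3)[OF config_in] k(3)[OF config_in] by metis
qed

theorem theorem5p3:
  fixes n :: nat and E :: "nat set set" and r :: "(nat set \<times> nat set) set"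
  assumes "simple_graph n E"
    and "n \<ge> 3"
    and "minimally_rigid TYPE(2) n E"
    and "linear_order_on E r"
  shows "2 * realisation_number TYPE(2) n E \<le> nbc r (graphic_matroid E)"
proof -
  note sg = assms(1) and n3 = assms(2)
  have E: "card E + 3 = 2 * n" "algindep prd E"
    using minimally_rigid_algindep[OF sg n3 assms(3)] by simp_all
  obtain a b h z0 where ab: "a \<in> {1..n}" "b \<in> {1..n}" "{a, b} \<in> E"
    and hp: "h \<in> pfun (verts n)" "h z0 \<noteq> 0"
    and hh: "\<forall>z. h z \<noteq> 0 \<longrightarrow> z (a, 1) \<noteq> z (b, 1) \<and> (\<forall>e\<in>E. prd e z \<noteq> 0) \<and>
      (\<forall>r. linear_order_on E r \<longrightarrow>
        finite (fib n E a b z) \<and> card (fib n E a b z) \<le> nbc r (graphic_matroid E)) \<and>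
      (\<forall>z' w. z' \<in> fib n E a b z \<longrightarrow> (\<forall>e\<in>E. dprd e z' w = 0) \<longrightarrow> (\<forall>v\<in>pins a b. w v = 0) \<longrightarrow>
        (\<forall>v\<in>verts n. w v = 0))"
    using generic_fib[OF sg n3 E] by (elim exE conjE)
  define R where "R p = realisations n E p" for p :: "nat \<Rightarrow> complex ^ 2"
  \<comment> \<open>Integer division loses nothing here: \<open>2 * c\<close> is at most a natural
    number iff \<open>c\<close> is at most its half, rounded down.\<close>
  have bound: "finite (R p) \<and> card (R p) \<le> nbc r (graphic_matroid E) div 2"
    if p: "p \<in> configs n" "h (uvc (coords p)) \<noteq> 0" for p
  proof -
    define z where "z = uvc (coords p)"
    note hz = hh[rule_format, OF p(2), folded z_def]
    have fin: "finite (fib n E a b z)" "card (fib n E a b z) \<le> nbc r (graphic_matroid E)"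
      using hz assms(4) by simp_all
    have nd: "\<forall>v\<in>verts n. w v = 0"
      if "z' \<in> fib n E a b z" "\<forall>e\<in>E. dprd e z' w = 0" "\<forall>v\<in>pins a b. w v = 0" for z' w
      using hz that by simp
    have "finite (realisations n E p) \<and> 2 * card (realisations n E p) \<le> card (fib n E a b z)"
      by (rule realisations_card_le_fib[OF sg n3 ab p(1) z_def _ fin(1) nd]) (use hz ab(3) in simp)
    then show ?thesis using fin(2) unfolding R_def by linarith
  qed
  \<comment> \<open>\<open>h\<close> is a polynomial in isotropic coordinates, while genericity
    refers to the coordinates of \<open>p\<close>; the change of coordinates \<open>uvc\<close> is
    linear with inverse \<open>xyc\<close>.\<close>
  have "(\<lambda>x. h (uvc x)) \<in> pfun (verts n)" by (intro pfun_subst[OF hp(1)] uvc_pfun)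
  moreover have "h (uvc (xyc z0)) \<noteq> 0" using hp(2) by simp
  ultimately have "\<exists>c\<le>nbc r (graphic_matroid E) div 2. generically n (\<lambda>p. finite (R p) \<and> card (R p) = c)"
    unfolding R_def by (rule generic_count[OF sg]) (use bound in \<open>simp add: R_def\<close>)
  then obtain c where c: "c \<le> nbc r (graphic_matroid E) div 2" "generically n (\<lambda>p. finite (R p) \<and> card (R p) = c)"
    by (elim exE conjE)
  have "realisation_number TYPE(2) n E = c"
    unfolding realisation_number_def R_def[symmetric]
  proof (rule the_equality)
    show "generically n (\<lambda>p. finite (R p) \<and> card (R p) = c)" by (rule c(2))
    fix c' assume "generically n (\<lambda>p. finite (R p) \<and> card (R p) = c')"
    from generically_common_point[OF this c(2)] show "c' = c" by auto
  qed
  with c(1) show ?thesis by simp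
qed

end
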